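(* Let $m\in\mathbb N$, $\sigma>0$, $\delta_1>0$, $\delta>0$, $q\in[1,\infty]$, and set $d:=1$ if $m=1$ and $d:=\lfloor m/q\rfloor+1$ if $m>1$ (with $m/\infty:=0$). Let $\Omega=\{X_\nu\}_{\nu=1}^\infty\subset\mathbb R^m$ be a countable set and let $f\in B_{\sigma,m}$. Then: (a) There is a constant $C(m,q)>0$ depending only on $m,q$ such that if $\Omega$ is a $(\delta_1,N)$-packing net for $\mathbb R^m$ for some $N\in\mathbb Z_+$ and $q\in[1,\infty)$, then $$\Big(\sum_{\nu=1}^\infty|f(X_\nu)|^q\Big)^{1/q}\le C_1\|f\|_{L_q(\mathbb R^m)},\qquad C_1\le (\delta_1/2)^{-m/q}(N+1)^{1/q}\big(1+C(m,q)\max\{\delta_1\sigma,(\delta_1\sigma)^d\}\big)$$ (the right-hand side may be $+\infty$). (b) There are constants $c_0(m,q)>0$ and $C(m,q)>0$ depending only on $m,q$ such that the following holds for $q\in[1,\infty)$: if $\Omega$ is a $\delta$-covering net for $\mathbb R^m$ with $\delta\sigma\le c_0(m,q)$, and $\big(\sum_{\nu}|f(X_\nu)|^q\big)^{1/q}<\infty$, then $1-C(m,q)\max\{(\delta\sigma)^q,(\delta\sigma)^{dq}\}>0$, $f\in L_q(\mathbb R^m)$, and $$\Big(\sum_{\nu=1}^\infty|f(X_\nu)|^q\Big)^{1/q}\ge C_2\|f\|_{L_q(\mathbb R^m)},\qquad C_2\ge(4\delta)^{-m/q}2^{1/q-1}\big(1-C(m,q)\max\{(\delta\sigma)^q,(\delta\sigma)^{dq}\}\big)^{1/q}>0.$$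 (c) If $\Omega$ is a $\delta$-covering net for $\mathbb R^m$ with $11m^{3/2}\delta\sigma\le 1$ and $\sup_{\nu}|f(X_\nu)|<\infty$, then $f$ is bounded on $\mathbb R^m$ and $$\sup_{\nu\in\mathbb N}|f(X_\nu)|\ge(1-m\delta\sigma)\|f\|_{L_\infty(\mathbb R^m)}.$$
   Context: For $x\in\mathbb R^m$: $\|x\|_\infty=\max_j|x_j|$. For $x\in\mathbb R^m$, $h>0$: $Q^m_h(x)=\{y:\|y-x\|_\infty\le h\}$ and $\mathring Q^m_h(x)=\{y:\|y-x\|_\infty<h\}$. For $\sigma>0$, $B_{\sigma,m}$ is the set of entire functions $f:\mathbb C^m\to\mathbb C$ of exponential type $\sigma$: for every $\varepsilon>0$ there is $C_0(\varepsilon,f)$ with $|f(z)|\le C_0(\varepsilon,f)\exp(\sigma(1+\varepsilon)\sum_{j=1}^m|z_j|)$ for all $z\in\mathbb C^m$; $f$ is identified with its restriction to $\mathbb R^m$, and $\|f\|_{L_q(\mathbb R^m)}$ is the usual (possibly infinite) $L_q$ norm. A countable set $\Omega=\{X_\nu\}\subset\mathbb R^m$ is a $\delta$-covering net if for every $x\in\mathbb R^m$ there is $X_\nu$ with $\|x-X_\nu\|_\infty<\delta$; it is a $\delta_1$-packing net if $\inf_{\nu\ne\mu}\|X_\nu-X_\mu\|_\infty\ge\delta_1$; it is a $(\delta_1,N)$-packing net ($N\in\mathbb Z_+$) if $\sup_\nu\operatorname{card}(\Omega\cap\mathring Q^m_{\delta_1/2}(X_\nu))\le N+1$. *)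

theory Defs
  imports "HOL-Analysis.Analysis"
begin

definition supn :: "real^'n \<Rightarrow> real" where
  "supn x = Max (range (\<lambda>j. \<bar>x $ j\<bar>))"

definition open_cube :: "real \<Rightarrow> real^'n \<Rightarrow> (real^'n) set" where
  "open_cube h x = {y. supn (y - x) < h}"

definition covering_net :: "real \<Rightarrow> (real^'n) set \<Rightarrow> bool" where
  "covering_net \<delta> \<Omega> \<longleftrightarrow> (\<forall>x. \<exists>X\<in>\<Omega>. supn (x - X) < \<delta>)"

definition packing_net :: "real \<Rightarrow> nat \<Rightarrow> (real^'n) set \<Rightarrow> bool" where
  "packing_net \<delta>\<^sub>1 N \<Omega> \<longleftrightarrow>
     (\<forall>X\<in>\<Omega>. finite (\<Omega> \<inter> open_cube (\<delta>\<^sub>1/2) X) \<and> card (\<Omega> \<inter> open_cube (\<delta>\<^sub>1/2) X) \<le> N + 1)"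

definition entire_m :: "(complex^'n \<Rightarrow> complex) \<Rightarrow> bool" where
  "entire_m f \<longleftrightarrow> (\<forall>z. \<exists>D. (f has_derivative D) (at z) \<and> (\<forall>c w. D (c *s w) = c * D w))"

definition exp_type_class :: "real \<Rightarrow> (complex^'n \<Rightarrow> complex) set" where
  "exp_type_class \<sigma> = {f. entire_m f \<and>
     (\<forall>\<epsilon>>0. \<exists>C0. \<forall>z. cmod (f z) \<le> C0 * exp (\<sigma> * (1 + \<epsilon>) * (\<Sum>j\<in>UNIV. cmod (z $ j))))}"

definition restr :: "(complex^'n \<Rightarrow> complex) \<Rightarrow> real^'n \<Rightarrow> complex" where
  "restr f x = f (\<chi> j. complex_of_real (x $ j))"

definition eroot :: "real \<Rightarrow> ennreal \<Rightarrow> ennreal" where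
  "eroot q I = (if I = \<infinity> then \<infinity> else ennreal (enn2real I powr (1 / q)))"

definition lq_sum :: "real \<Rightarrow> (real^'n) set \<Rightarrow> (real^'n \<Rightarrow> complex) \<Rightarrow> ennreal" where
  "lq_sum q \<Omega> g = eroot q (\<integral>\<^sup>+ X. ennreal (cmod (g X) powr q) \<partial>count_space \<Omega>)"

definition Lq_norm :: "real \<Rightarrow> (real^'n \<Rightarrow> complex) \<Rightarrow> ennreal" where
  "Lq_norm q g = eroot q (\<integral>\<^sup>+ x. ennreal (cmod (g x) powr q) \<partial>lborel)"

definition dexp :: "nat \<Rightarrow> real \<Rightarrow> nat" where
  "dexp m q = (if m = 1 then 1 else nat \<lfloor>real m / q\<rfloor> + 1)"

end

theory Submission
  imports Defs "HOL-Complex_Analysis.Complex_Analysis" "HOL-Real_Asymp.Real_Asymp"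
begin

text \<open>The residues of \<open>\<psi>(z) / (z\<^sup>2 cos z)\<close> give the Riesz interpolation formula: the derivative of
  a bounded function of exponential type \<open>a\<close> is dominated by \<open>a\<close> times an average of translates of
  its modulus. This yields the Bernstein inequality, and, applied in each coordinate in turn, a
  majorant \<open>H(y)\<close> of the oscillation of \<open>f\<close> on the cube of half side \<open>h\<close> around \<open>y\<close> that is itself
  built from averages of translates of the modulus of \<open>f\<close>. By convexity its \<open>L\<^sub>q\<close> norm is
  \<open>O(h \<sigma>)\<close> times that of \<open>f\<close>. Comparing a sample with the values on a small cube around it gives
  (a); comparing each value with a nearby sample gives (b) and (c).

  Boundedness of \<open>f\<close> is needed first. If every point has a neighbour at distance at most \<open>\<delta>\<close> where
  \<open>|f| \<le> M\<close>, multiply \<open>f\<close> by \<open>(1 - x\<^sub>i\<^sup>2 / R\<^sup>2) ^ k\<close> in each variable, with \<open>k\<close> proportional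
  to \<open>R\<close>; at its maximum the product has a gradient of the order of its size, so the maximum is
  controlled by \<open>M\<close> uniformly in \<open>R\<close>. In (b) integrability is first obtained for \<open>f\<close> multiplied by
  squared sinc factors, which are then removed by Fatou's lemma.\<close>

text \<open>Derivative estimates need growth governed by the imaginary part alone, which
  Phragmen-Lindelof yields only for functions bounded on the reals. In (b) and (c) nothing but the
  samples is controlled, so boundedness must come from the type and the samples together, before any
  Bernstein inequality. Polynomial damping suits this: its degree grows with R and can offset the
  exponential growth, yet its effect at a fixed point disappears as R grows. The estimates hold for
  all finite q at once because every majorant is an integral against a positive measure. In (b) the
  oscillation term is absorbed into the left side, which is legitimate only if that side is finite.
  The exponent d matters only in (a) with \<open>\<delta>\<^sub>1 * \<sigma> > 1\<close>: there the
  cells are shrunk to size 1/\<sigma>, and the change of volume costs the power m/q, at most d. In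
  (b) the argument \<delta>\<sigma> is below 1 and the maximum is its first term. The class gives
  growth of type a only for a > \<sigma>, so (a) and (b) work with 3\<sigma>/2 or 2\<sigma>, while
  (c), whose constant leaves no room, lets a tend to \<sigma>.\<close>

no_notation fps_nth (infixl \<open>$\<close> 75)

subsection \<open>Phragmen-Lindelof bounds\<close>

text \<open>A quadrant tolerates growth of order below 2, so the damping factor needs an order
  strictly between 1 and 2; it is 3/2. Writing \<open>z = w * s^2\<close> turns this power of z into
  the polynomial \<open>s^3\<close> and avoids branches. On \<open>S\<close>, where the argument of
  s is at most pi/8, that of \<open>s^3\<close> is at most 3 pi/8; hence the cubic decay
  \<open>re3\<close>, which beats the growth, quadratic in s. At the end \<eta> tends to 0.\<close>

lemma phragmen_lindelof_quadrant:
  fixes F :: "complex \<Rightarrow> complex"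
  assumes hol: "F holomorphic_on UNIV"
    and growth: "\<And>z. cmod (F z) \<le> C * exp (c * cmod z)"
    and real_axis: "\<And>x. x \<ge> 0 \<Longrightarrow> cmod (F (of_real x)) \<le> B"
    and imag_axis: "\<And>y. y \<ge> 0 \<Longrightarrow> cmod (F (\<i> * of_real y)) \<le> B"
    and "B > 0" "C \<ge> 0" and z: "Re z \<ge> 0" "Im z \<ge> 0"
  shows "cmod (F z) \<le> B"
proof -
  define w where "w = cis (pi/4)"
  define S where "S = {s. Re s \<ge> 0 \<and> \<bar>Im (s^2)\<bar> \<le> Re (s^2)}"
  define c' where "c' = max 1 c"
  have c': "c' > 0" by (simp add: c'_def)
  have growth': "cmod (F z) \<le> C * exp (c' * cmod z)" for z
    using \<open>C \<ge> 0\<close>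
    by (intro order_trans[OF growth[of z]]) (auto simp: c'_def intro!: mult_left_mono mult_right_mono)
  have w: "w = (1 + \<i>) / sqrt 2" "cmod w = 1"
    by (auto simp: w_def complex_eq_iff cos_45 sin_45 field_simps)
  have re3: "Re (s^3) \<ge> cmod s ^ 3 / 8" if "s \<in> S" for s
  proof -
    define x y where "x = Re s" and "y = Im s"
    have x: "x \<ge> 0" and xy: "2 * x * \<bar>y\<bar> \<le> x^2 - y^2"
      using that by (auto simp: S_def x_def y_def power2_eq_square abs_mult algebra_simps)
    have "2 * \<bar>y\<bar> \<le> x"
    proof (rule ccontr)
      assume "\<not> 2 * \<bar>y\<bar> \<le> x"
      then have "x < 2 * \<bar>y\<bar>" by simp
      then have "x * x \<le> x * (2 * \<bar>y\<bar>)" "y^2 > 0"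
        using x by (auto intro!: mult_left_mono)
      then show False using xy by (simp add: power2_eq_square algebra_simps)
    qed
    then have "(2 * \<bar>y\<bar>)^2 \<le> x^2" by (intro power_mono) auto
    then have y2: "4 * y^2 \<le> x^2" by (simp add: power_mult_distrib)
    have "Re (s^3) = x * (x^2 - 3 * y^2)"
      by (simp add: x_def y_def power3_eq_cube power2_eq_square algebra_simps)
    moreover have "x * (x^2 - 3 * y^2) \<ge> x * (x^2/4)"
      using y2 x by (intro mult_left_mono) auto
    moreover have "cmod s \<le> (5/4) * x"
    proof -
      have "cmod s ^ 2 = x^2 + y^2" by (simp add: cmod_power2 x_def y_def)
      also have "\<dots> \<le> (25/16) * x^2" using y2 zero_le_power2[of x] by linarith
      also have "\<dots> = ((5/4) * x)^2" by (simp add: power_mult_distrib power_divide)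
      finally show ?thesis using x power2_le_imp_le by fastforce
    qed
    then have "cmod s ^ 3 \<le> ((5/4) * x)^3" by (intro power_mono) auto
    moreover have "((5/4) * x)^3 = 125/64 * (x*(x*x))"
      by (simp add: power3_eq_cube)
    moreover have "x*(x*x) \<ge> 0" using x by simp
    ultimately show ?thesis by (simp add: power2_eq_square)
  qed
  have key: "cmod (F (w * s^2)) \<le> B * exp (\<eta> * Re (s^3))" if s: "s \<in> S" and eta: "\<eta> > 0" for s \<eta>
  proof -
    define H where "H = (\<lambda>s. F (w * s^2) * exp (- of_real \<eta> * s^3))"
    have "eventually (\<lambda>r. C * exp (c' * r^2) * exp (- \<eta> * (r^3/8)) < B) at_top"
    proof -
      have "((\<lambda>r. exp (c' * r^2) * exp (- \<eta> * (r^3/8))) \<longlongrightarrow> 0) at_top"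
        using eta c' by real_asymp
      from tendsto_mult_right_zero[OF this, of C]
      have "((\<lambda>r. C * exp (c' * r^2) * exp (- \<eta> * (r^3/8))) \<longlongrightarrow> 0) at_top"
        by (simp add: mult.assoc)
      then show ?thesis using \<open>B > 0\<close> order_tendstoD(2) by blast
    qed
    then have "eventually (\<lambda>r. C * exp (c' * r^2) * exp (- \<eta> * (r^3/8)) < B \<and> r > cmod s) at_top"
      using eventually_gt_at_top eventually_conj by blast
    then have "\<exists>r. C * exp (c' * r^2) * exp (- \<eta> * (r^3/8)) < B \<and> r > cmod s"
      by (rule eventually_happens'[OF trivial_limit_at_top_linorder])
    then obtain r where r: "C * exp (c' * r^2) * exp (- \<eta> * (r^3/8)) < B" "r > cmod s" by blast
    define T where "T = S \<inter> cball 0 r"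
    have clS: "closed S" unfolding S_def
      by (intro closed_Collect_conj closed_Collect_le continuous_intros)
    then have clT: "closed T" by (auto simp: T_def)
    have "(\<lambda>s. F (w * s^2)) holomorphic_on UNIV"
      using holomorphic_on_compose_gen[OF _ hol, of "\<lambda>s. w * s^2" UNIV]
      by (simp add: o_def holomorphic_intros)
    then have holH: "H holomorphic_on UNIV"
      unfolding H_def by (intro holomorphic_intros)
    have "cmod (H s) \<le> B"
    proof (rule maximum_modulus_frontier[of H T])
      show "H holomorphic_on interior T" using holH holomorphic_on_subset by blast
      show "continuous_on (closure T) H"
        using holH holomorphic_on_imp_continuous_on holomorphic_on_subset by blast
      show "bounded T" by (simp add: T_def bounded_Int)
      show "s \<in> T" using s r by (simp add: T_def)
      fix u assume "u \<in> frontier T"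
      then have uT: "u \<in> T" and ni: "u \<notin> interior T"
        using clT by (auto simp: frontier_def)
      have uS: "u \<in> S" "cmod u \<le> r" using uT by (auto simp: T_def)
      have Hu: "cmod (H u) = cmod (F (w * u^2)) * exp (- \<eta> * Re (u^3))"
        by (simp add: H_def norm_mult)
      have le1: "exp (- \<eta> * Re (u^3)) \<le> 1"
        using re3[OF uS(1)] eta order_trans[of 0 "cmod u ^ 3 / 8"] by simp
      \<comment> \<open>A point of \<open>T\<close> off the arc and off both rays lies in the open
        set \<open>V\<close> inside \<open>T\<close>, hence is interior. The apex 0 satisfies both
        ray equations.\<close>
      consider "cmod u = r" | "Im (u^2) = Re (u^2)" | "Im (u^2) = - Re (u^2)"
      proof -
        have "cmod u = r \<or> Im (u^2) = Re (u^2) \<or> Im (u^2) = - Re (u^2)"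
        proof (rule ccontr)
          assume neg: "\<not> ?thesis"
          have "Re u > 0"
          proof (rule ccontr)
            assume "\<not> Re u > 0"
            then have "Re u = 0" using uS by (simp add: S_def)
            moreover have "\<bar>Im (u^2)\<bar> \<le> Re (u^2)" using uS by (simp add: S_def)
            ultimately have "Im u * Im u \<le> 0" by (simp add: power2_eq_square)
            then have "Im u = 0" using mult_le_0_iff by force
            then show False using neg \<open>Re u = 0\<close> by (simp add: power2_eq_square)
          qed
          define V where "V = {s. Re s > 0 \<and> \<bar>Im (s^2)\<bar> < Re (s^2) \<and> cmod s < r}"
          have "open V" unfolding V_def
            by (intro open_Collect_conj open_Collect_less continuous_intros)
          moreover have "V \<subseteq> T" by (auto simp: V_def T_def S_def)
          moreover have "\<bar>Im (u^2)\<bar> < Re (u^2)"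
            using neg uS(1) unfolding S_def by auto
          then have "u \<in> V" using neg uS \<open>Re u > 0\<close> by (auto simp: V_def)
          ultimately show False using ni interior_maximal by blast
        qed
        then show ?thesis using that by blast
      qed
      then show "cmod (H u) \<le> B"
      proof cases
        case 1
        have "cmod (F (w * u^2)) \<le> C * exp (c' * r^2)"
          using growth'[of "w * u^2"] 1 w(2) by (simp add: norm_mult norm_power)
        moreover have "exp (- \<eta> * Re (u^3)) \<le> exp (- \<eta> * (r^3/8))"
          using re3[OF uS(1)] 1 eta by simp
        ultimately have "cmod (H u) \<le> C * exp (c' * r^2) * exp (- \<eta> * (r^3/8))"
          unfolding Hu using \<open>C \<ge> 0\<close> by (intro mult_mono) auto
        then show ?thesis using r by simp
      next
        case 2
        have "Re (u^2) \<ge> 0" using uS(1) by (auto simp: S_def)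
        have "u^2 = of_real (Re (u^2)) * (1 + \<i>)" using 2 by (simp add: complex_eq_iff)
        then have "w * u^2 = \<i> * of_real (sqrt 2 * Re (u^2))"
          unfolding w by (simp add: complex_eq_iff real_div_sqrt field_simps)
        then have "cmod (F (w * u^2)) \<le> B"
          using imag_axis[of "sqrt 2 * Re (u^2)"] \<open>Re (u^2) \<ge> 0\<close> by simp
        then have "cmod (H u) \<le> B * 1" unfolding Hu using le1 \<open>B > 0\<close> by (intro mult_mono) auto
        then show ?thesis by simp
      next
        case 3
        have "Re (u^2) \<ge> 0" using uS(1) by (auto simp: S_def)
        have "u^2 = of_real (Re (u^2)) * (1 - \<i>)" using 3 by (simp add: complex_eq_iff)
        then have "w * u^2 = of_real (sqrt 2 * Re (u^2))"
          unfolding w by (simp add: complex_eq_iff real_div_sqrt field_simps)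
        then have "cmod (F (w * u^2)) \<le> B"
          using real_axis[of "sqrt 2 * Re (u^2)"] \<open>Re (u^2) \<ge> 0\<close> by simp
        then have "cmod (H u) \<le> B * 1" unfolding Hu using le1 \<open>B > 0\<close> by (intro mult_mono) auto
        then show ?thesis by simp
      qed
    qed
    then have "cmod (F (w * s^2)) * exp (- (\<eta> * Re (s^3))) \<le> B" by (simp add: H_def norm_mult)
    then show ?thesis by (simp add: exp_minus field_simps)
  qed
  \<comment> \<open>Division by \<open>w\<close> rotates the quadrant to the sector within pi/4 of
    the positive axis, and the principal root halves the angle.\<close>
  define s where "s = csqrt (z / w)"
  have "w \<noteq> 0" using w(2) by auto
  then have zs: "w * s^2 = z" by (simp add: s_def)
  have s2: "s^2 = z * ((1 - \<i>) / sqrt 2)"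
  proof -
    have "w * ((1 - \<i>) / sqrt 2) = 1" unfolding w by (simp add: complex_eq_iff field_simps)
    then show ?thesis using zs by (metis (no_types, lifting) mult.assoc mult.commute mult.right_neutral)
  qed
  have "Re (s^2) = (Re z + Im z) / sqrt 2" "Im (s^2) = (Im z - Re z) / sqrt 2"
    unfolding s2 by (auto simp: field_simps)
  then have "\<bar>Im (s^2)\<bar> \<le> Re (s^2)" using z by (auto simp: divide_right_mono)
  moreover have "Re s \<ge> 0" unfolding s_def using csqrt_principal[of "z/w"] by auto
  ultimately have sS: "s \<in> S" by (auto simp: S_def)
  have "((\<lambda>\<eta>. B * exp (\<eta> * Re (s^3))) \<longlongrightarrow> B * exp (0 * Re (s^3))) (at_right 0)"
    by (intro tendsto_intros)
  moreover have "eventually (\<lambda>\<eta>. cmod (F (w * s^2)) \<le> B * exp (\<eta> * Re (s^3))) (at_right 0)"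
    using key[OF sS] by (auto simp: eventually_at_right_field intro!: exI[of _ 1])
  ultimately have "cmod (F (w * s^2)) \<le> B * exp (0 * Re (s^3))"
    by (intro tendsto_lowerbound[where F="at_right 0"]) auto
  then show ?thesis by (simp add: zs)
qed

text \<open>In the first quadrant the factor exp(i a z) has modulus 1 on the real axis and cancels
  the growth on the imaginary axis, leaving \<open>C\<close> there; this is where
  \<open>C \<le> B\<close> enters. The second quadrant follows from the function cnj (f (- cnj z)),
  which is again entire, and the lower half plane from z -> -z.\<close>

lemma exp_type_bounded_on_reals:
  fixes \<phi> :: "complex \<Rightarrow> complex"
  assumes hol: "\<phi> holomorphic_on UNIV"
    and growth: "\<And>z. cmod (\<phi> z) \<le> C * exp (a * cmod z)"
    and bd: "\<And>x. cmod (\<phi> (of_real x)) \<le> B"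
    and "B > 0" "C \<le> B" "a \<ge> 0"
  shows "cmod (\<phi> z) \<le> B * exp (a * \<bar>Im z\<bar>)"
proof -
  have quad: "cmod (f z) \<le> B * exp (a * Im z)"
    if hol: "f holomorphic_on UNIV" and growth: "\<And>z. cmod (f z) \<le> C * exp (a * cmod z)"
      and bd: "\<And>x. cmod (f (of_real x)) \<le> B" and z: "Re z \<ge> 0" "Im z \<ge> 0"
    for f :: "complex \<Rightarrow> complex" and z
  proof -
    have C: "C \<ge> 0" using order_trans[OF norm_ge_zero growth[of 0]] by simp
    have "cmod (f z * exp (\<i> * of_real a * z)) \<le> B"
    proof (rule phragmen_lindelof_quadrant[where F="\<lambda>z. f z * exp (\<i> * of_real a * z)" and z=z and C=C and c="2*a"])
      show "(\<lambda>z. f z * exp (\<i> * of_real a * z)) holomorphic_on UNIV"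
        using hol by (intro holomorphic_intros)
      show "cmod (f z * exp (\<i> * of_real a * z)) \<le> C * exp (2 * a * cmod z)" for z
      proof -
        have "exp (- (a * Im z)) \<le> exp (a * cmod z)"
          using abs_Im_le_cmod[of z] \<open>a \<ge> 0\<close> mult_left_mono[of "- Im z" "cmod z" a] by auto
        then have "cmod (f z * exp (\<i> * of_real a * z)) \<le> C * exp (a * cmod z) * exp (a * cmod z)"
          unfolding norm_mult using growth[of z] C by (intro mult_mono) auto
        then show ?thesis by (simp add: exp_add[symmetric] mult.assoc)
      qed
      show "cmod (f (of_real x) * exp (\<i> * of_real a * of_real x)) \<le> B" for x
        using bd[of x] by (simp add: norm_mult)
      show "cmod (f (\<i> * of_real y) * exp (\<i> * of_real a * (\<i> * of_real y))) \<le> B" if "y \<ge> 0" for y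
      proof -
        have "cmod (f (\<i> * of_real y) * exp (\<i> * of_real a * (\<i> * of_real y)))
            \<le> C * exp (a * y) * exp (- (a * y))"
          unfolding norm_mult using growth[of "\<i> * of_real y"] that
          by (intro mult_mono) (auto simp: norm_mult C)
        then show ?thesis using \<open>C \<le> B\<close> by (simp add: mult.assoc flip: exp_add)
      qed
    qed (use z C \<open>B > 0\<close> in auto)
    then show ?thesis by (simp add: norm_mult exp_minus field_simps)
  qed
  have up: "cmod (f z) \<le> B * exp (a * Im z)"
    if hol: "f holomorphic_on UNIV" and growth: "\<And>z. cmod (f z) \<le> C * exp (a * cmod z)"
      and bd: "\<And>x. cmod (f (of_real x)) \<le> B" and z: "Im z \<ge> 0"
    for f :: "complex \<Rightarrow> complex" and z
  proof (cases "Re z \<ge> 0")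
    case True
    then show ?thesis using quad[OF hol growth bd] z by blast
  next
    case False
    have "cmod ((cnj \<circ> (f \<circ> uminus) \<circ> cnj) (- cnj z)) \<le> B * exp (a * Im (- cnj z))"
    proof (rule quad)
      have "(f \<circ> uminus) holomorphic_on UNIV"
        using hol by (intro holomorphic_on_compose holomorphic_intros) (auto intro: holomorphic_on_subset)
      then show "(cnj \<circ> (f \<circ> uminus) \<circ> cnj) holomorphic_on UNIV"
        using holomorphic_on_compose_cnj_cnj[of "f \<circ> uminus" UNIV] by (simp add: o_assoc surj_def) (metis complex_cnj_cnj open_UNIV surjI)
      show "cmod ((cnj \<circ> (f \<circ> uminus) \<circ> cnj) z) \<le> C * exp (a * cmod z)" for z
        using growth[of "- cnj z"] by simp
      show "cmod ((cnj \<circ> (f \<circ> uminus) \<circ> cnj) (of_real x)) \<le> B" for x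
        using bd[of "- x"] by simp
    qed (use False z in auto)
    then show ?thesis by simp
  qed
  show ?thesis
  proof (cases "Im z \<ge> 0")
    case True
    then show ?thesis using up[OF hol growth bd] by simp
  next
    case False
    have "cmod ((\<phi> \<circ> uminus) (- z)) \<le> B * exp (a * Im (- z))"
    proof (rule up)
      show "(\<phi> \<circ> uminus) holomorphic_on UNIV"
        using hol by (intro holomorphic_on_compose holomorphic_intros) (auto intro: holomorphic_on_subset)
      show "cmod ((\<phi> \<circ> uminus) z) \<le> C * exp (a * cmod z)" for z
        using growth[of "- z"] by simp
      show "cmod ((\<phi> \<circ> uminus) (of_real x)) \<le> B" for x
        using bd[of "- x"] by simp
    qed (use False in auto)
    then show ?thesis using False by simp
  qed
qed

subsection \<open>Riesz interpolation and the Bernstein inequality\<close>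

text \<open>The numerator may vanish at the zero of \<open>g\<close>. In that case f = (f + 1) - 1
  splits the quotient into two with nonvanishing numerators, and residues add.\<close>

lemma residue_quotient_simple_zero:
  assumes f: "f holomorphic_on s" and g: "g holomorphic_on s"
    and s: "open s" "connected s" "z \<in> s"
    and g': "(g has_field_derivative g') (at z)" "g z = 0" "g' \<noteq> 0"
    and nz: "\<And>w. w \<in> s - {z} \<Longrightarrow> g w \<noteq> 0"
  shows "residue (\<lambda>w. f w / g w) z = f z / g'"
proof (cases "f z = 0")
  case False
  then show ?thesis using residue_simple_pole_deriv[OF f g s g'(1) _ g'(2,3)] by blast
next
  case True
  have 1: "residue (\<lambda>w. (f w + 1) / g w) z = (f z + 1) / g'"
    using f True by (intro residue_simple_pole_deriv[OF _ g s g'(1) _ g'(2,3)] holomorphic_intros) auto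
  have 2: "residue (\<lambda>w. - 1 / g w) z = - 1 / g'"
    using residue_simple_pole_deriv[OF _ g s g'(1) _ g'(2,3), of "\<lambda>_. - 1"] by (auto intro: holomorphic_intros)
  have sub: "f holomorphic_on s - {z}" "g holomorphic_on s - {z}"
    using f g holomorphic_on_subset by blast+
  have "residue (\<lambda>w. (f w + 1) / g w + (- 1) / g w) z
      = residue (\<lambda>w. (f w + 1) / g w) z + residue (\<lambda>w. - 1 / g w) z"
    using nz sub by (intro residue_add[OF s(1,3)] holomorphic_intros) auto
  then have "residue (\<lambda>w. (f w + 1) / g w + (- 1) / g w) z = f z / g'"
    unfolding 1 2 by (simp add: add_divide_distrib)
  then show ?thesis by (simp add: add_divide_distrib)
qed

section \<open>Zeros of the cosine and the contour integral\<close>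

definition cos_zero :: "int \<Rightarrow> real" where
  "cos_zero k = (2 * real_of_int k + 1) * (pi / 2)"

lemma cos_zero_props:
  "cos (complex_of_real (cos_zero k)) = 0" "cos_zero k \<noteq> 0" "\<bar>sin (cos_zero k)\<bar> = 1"
  "\<bar>cos_zero k\<bar> \<ge> pi / 2"
proof -
  have e: "cos_zero k = real_of_int k * pi + pi / 2" by (simp add: cos_zero_def algebra_simps)
  then show "cos (complex_of_real (cos_zero k)) = 0" by (auto simp: cos_eq_0)
  then have "cos (cos_zero k) = 0" by (metis cos_of_real of_real_eq_0_iff)
  then show "\<bar>sin (cos_zero k)\<bar> = 1"
    using sin_cos_squared_add[of "cos_zero k"] by (simp add: abs_square_eq_1)
  have "\<bar>2 * k + 1\<bar> \<ge> 1" by presburger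
  then have "\<bar>2 * real_of_int k + 1\<bar> \<ge> 1" by linarith
  then show "\<bar>cos_zero k\<bar> \<ge> pi / 2" by (simp add: cos_zero_def abs_mult)
  moreover have "pi / 2 > 0" by simp
  ultimately show "cos_zero k \<noteq> 0" by linarith
qed

lemma cos_eq_0_iff_cos_zero: "cos z = 0 \<longleftrightarrow> (\<exists>k. z = complex_of_real (cos_zero k))"
  unfolding cos_eq_0 by (simp add: cos_zero_def complex_eq_iff algebra_simps)

lemma inj_cos_zero: "inj (\<lambda>k. complex_of_real (cos_zero k))"
  by (auto simp: inj_def cos_zero_def)

text \<open>From |cos z|^2 = cos^2 (Re z) + sinh^2 (Im z). The two alternatives describe the
  vertical and the horizontal sides of the contour: on the former the modulus is a cosh, on the
  latter it is at least a sinh whose argument is not small.\<close>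

lemma norm_cos_lower:
  fixes z :: complex
  assumes "\<bar>cos (Re z)\<bar> = 1 \<or> \<bar>Im z\<bar> \<ge> 1"
  shows "exp \<bar>Im z\<bar> \<le> 4 * cmod (cos z)"
proof -
  define y where "y = \<bar>Im z\<bar>"
  have sq: "cmod (cos z) ^ 2 = cos (Re z) ^ 2 + (exp y - exp (- y)) ^ 2 / 4"
    unfolding norm_cos_squared y_def by (cases "Im z \<ge> 0") (auto simp: exp_minus power2_commute)
  have "(exp y / 4) ^ 2 \<le> cmod (cos z) ^ 2"
    using assms
  proof
    assume "\<bar>cos (Re z)\<bar> = 1"
    then have "cos (Re z) ^ 2 = 1" by (simp add: abs_square_eq_1)
    then have "cmod (cos z) ^ 2 = ((exp y + exp (- y)) / 2) ^ 2"
      unfolding sq by (simp add: power2_eq_square algebra_simps exp_minus field_simps)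
    moreover have "(exp y / 4) ^ 2 \<le> ((exp y + exp (- y)) / 2) ^ 2"
      by (intro power_mono) (auto simp: add_nonneg_nonneg)
    ultimately show ?thesis by (simp only:)
  next
    assume "\<bar>Im z\<bar> \<ge> 1"
    then have y: "y \<ge> 1" by (simp add: y_def)
    have "exp (- y) \<le> exp y / 2"
    proof -
      have "exp (2 * y) \<ge> 1 + 2 * y" by (rule exp_ge_add_one_self)
      then have "exp (2 * y) \<ge> 2" using y by linarith
      then have "exp y * exp y \<ge> 2" using y by (simp flip: exp_add)
      then show ?thesis by (simp add: exp_minus field_simps)
    qed
    then have "(exp y / 4) ^ 2 \<le> ((exp y - exp (- y)) / 2) ^ 2"
      by (intro power_mono) auto
    also have "\<dots> \<le> cmod (cos z) ^ 2" unfolding sq by (simp add: power_divide)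
    finally show ?thesis .
  qed
  then have "exp y / 4 \<le> cmod (cos z)" using power2_le_imp_le norm_ge_zero by blast
  then show ?thesis by (simp add: y_def)
qed

text \<open>The square of half side \<open>N * pi\<close> crosses the real axis midway between zeros
  of cos, so on it |cos| majorizes the growth of \<psi> up to a factor 4. The factor
  \<open>z^2\<close> then makes the integrand O(1/N^2) on a contour of length O(N), and it also
  makes 0 a double pole, so that the residue there is a derivative.\<close>

lemma riesz_interpolation_partial:
  fixes \<psi> :: "complex \<Rightarrow> complex"
  assumes hol: "\<psi> holomorphic_on UNIV"
    and growth: "\<And>z. cmod (\<psi> z) \<le> K * exp \<bar>Im z\<bar>"
    and N: "N \<ge> (1::nat)"
  shows "cmod (deriv \<psi> 0 - (\<Sum>k\<in>{- int N..int N - 1}.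
            \<psi> (of_real (cos_zero k)) / of_real (cos_zero k ^ 2 * sin (cos_zero k)))) \<le> 16 * K / N"
proof -
  define L where "L = real N * pi"
  have L1: "L \<ge> 1" and L0: "L > 0"
  proof -
    have "1 * 1 \<le> real N * pi" using N pi_ge_two by (intro mult_mono) auto
    then show "L \<ge> 1" "L > 0" by (auto simp: L_def)
  qed
  have K: "K \<ge> 0" using order_trans[OF norm_ge_zero growth[of 0]] by simp
  define a1 where "a1 = Complex (- L) (- L)"
  define a3 where "a3 = Complex L L"
  define I where "I = {- int N..int N - 1}"
  define y where "y = (\<lambda>k. complex_of_real (cos_zero k))"
  define pts where "pts = insert 0 (y ` I)"
  define F where "F = (\<lambda>z. \<psi> z / (z^2 * cos z))"
  define S where "S = {z. \<bar>Re z\<bar> < L + 1}"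
  have S: "open S" "connected S"
  proof -
    have "S = {z. Re z < L + 1} \<inter> {z. Re z > - (L + 1)}" by (auto simp: S_def)
    then show "open S" "connected S"
      by (auto simp: open_halfspace_Re_lt open_halfspace_Re_gt convex_halfspace_Re_lt
          convex_halfspace_Re_gt intro!: convex_connected convex_Int open_Int)
  qed
  \<comment> \<open>\<open>S\<close> reaches a distance 1 beyond the square, while the first zeros
    outside lie pi/2 > 1 beyond it; so \<open>S\<close> contains no further pole.\<close>
  have Ireal: "k \<in> I \<longleftrightarrow> \<bar>cos_zero k\<bar> < L + 1" for k
  proof -
    have p: "pi > 3" using pi_gt3 .
    show ?thesis
    proof
      assume "k \<in> I"
      then have "- real N \<le> k" "real_of_int k \<le> real N - 1" by (auto simp: I_def)
      then have "\<bar>2 * real_of_int k + 1\<bar> \<le> 2 * real N - 1" by linarith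
      then have "\<bar>cos_zero k\<bar> \<le> (2 * real N - 1) * (pi / 2)"
        by (simp add: cos_zero_def abs_mult)
      then show "\<bar>cos_zero k\<bar> < L + 1" using p by (simp add: L_def algebra_simps)
    next
      assume "\<bar>cos_zero k\<bar> < L + 1"
      then have "\<bar>2 * real_of_int k + 1\<bar> * pi < 2 * real N * pi + 2"
        by (simp add: cos_zero_def L_def abs_mult)
      also have "\<dots> < (2 * real N + 1) * pi" using p by (simp add: algebra_simps)
      finally have "\<bar>2 * real_of_int k + 1\<bar> < 2 * real N + 1" by simp
      then have "\<bar>2 * k + 1\<bar> < 2 * int N + 1" by linarith
      then show "k \<in> I" by (auto simp: I_def)
    qed
  qed
  have cos0: "cos z = 0 \<longleftrightarrow> z \<in> y ` I" if "z \<in> S" for z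
    using that Ireal unfolding cos_eq_0_iff_cos_zero y_def S_def by auto
  have Ilt: "\<bar>cos_zero k\<bar> < L" if "k \<in> I" for k
  proof -
    have "- real N \<le> k" "real_of_int k \<le> real N - 1" using that by (auto simp: I_def)
    then have "\<bar>2 * real_of_int k + 1\<bar> \<le> 2 * real N - 1" by linarith
    then have "\<bar>cos_zero k\<bar> \<le> (2 * real N - 1) * (pi / 2)"
      by (simp add: cos_zero_def abs_mult)
    moreover have "(2 * real N - 1) * (pi / 2) < L" by (simp add: L_def algebra_simps)
    ultimately show ?thesis by linarith
  qed
  have img: "path_image (rectpath a1 a3) = {z. \<bar>Re z\<bar> = L \<and> \<bar>Im z\<bar> \<le> L} \<union> {z. \<bar>Im z\<bar> = L \<and> \<bar>Re z\<bar> \<le> L}"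
    using L0 by (subst path_image_rectpath) (auto simp: a1_def a3_def)
  have pbox: "p \<in> box a1 a3" if "p \<in> pts" for p
    using that L0 by (auto simp: pts_def y_def in_box_complex_iff a1_def a3_def abs_less_iff dest!: Ilt)
  have ptsS: "path_image (rectpath a1 a3) \<subseteq> S - pts"
  proof -
    have "path_image (rectpath a1 a3) \<inter> box a1 a3 = {}"
      using L0 by (intro path_image_rectpath_inter_box) (auto simp: a1_def a3_def)
    then show ?thesis using pbox L0 unfolding img by (auto simp: S_def)
  qed
  have holF: "F holomorphic_on S - pts"
    unfolding F_def using hol cos0
    by (intro holomorphic_intros) (auto simp: pts_def intro: holomorphic_on_subset)
  have "contour_integral (rectpath a1 a3) F
      = 2 * pi * \<i> * (\<Sum>p\<in>pts. winding_number (rectpath a1 a3) p * residue F p)"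
  proof (rule Residue_theorem[OF S _ holF _ _ ptsS])
    show "finite pts" by (simp add: pts_def I_def)
    show "\<forall>z. z \<notin> S \<longrightarrow> winding_number (rectpath a1 a3) z = 0"
      using L0 by (auto simp: S_def in_cbox_complex_iff a1_def a3_def intro!: winding_number_rectpath_outside)
  qed auto
  also have "(\<Sum>p\<in>pts. winding_number (rectpath a1 a3) p * residue F p) = (\<Sum>p\<in>pts. residue F p)"
    using pbox by (intro sum.cong) (auto simp: winding_number_rectpath)
  also have "\<dots> = residue F 0 + (\<Sum>k\<in>I. residue F (y k))"
  proof -
    have "inj_on y I" using inj_cos_zero by (auto simp: y_def inj_on_def inj_def)
    moreover have "0 \<notin> y ` I" using cos_zero_props(2) by (auto simp: y_def)
    ultimately show ?thesis unfolding pts_def by (simp add: I_def sum.reindex)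
  qed
  also have "residue F 0 = deriv \<psi> 0"
  proof -
    have nz: "cos z \<noteq> 0" if "z \<in> ball 0 (pi/2)" for z :: complex
    proof
      assume "cos z = 0"
      then obtain k where "z = of_real (cos_zero k)" by (auto simp: cos_eq_0_iff_cos_zero)
      then show False using that cos_zero_props(4)[of k] by simp
    qed
    have "residue (\<lambda>z. (\<psi> z / cos z) / z ^ Suc 1) 0 = (deriv ^^ 1) (\<lambda>z. \<psi> z / cos z) 0 / fact 1"
      using nz hol by (intro residue_holomorphic_over_power'[of "ball 0 (pi/2)"] holomorphic_intros)
        (auto intro: holomorphic_on_subset)
    moreover have "(\<lambda>z. (\<psi> z / cos z) / z ^ Suc 1) = F"
      by (auto simp: F_def power2_eq_square field_simps fun_eq_iff)
    \<comment> \<open>At 0 the cosine has value 1 and derivative 0, so the division leaves the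
      derivative unchanged.\<close>
    moreover have "deriv (\<lambda>z. \<psi> z / cos z) 0 = deriv \<psi> 0"
    proof -
      have d: "(\<psi> has_field_derivative deriv \<psi> 0) (at 0)"
        using hol by (simp add: holomorphic_derivI)
      show ?thesis
        by (rule DERIV_imp_deriv) (auto intro!: derivative_eq_intros d)
    qed
    ultimately show ?thesis by simp
  qed
  also have "(\<Sum>k\<in>I. residue F (y k))
      = (\<Sum>k\<in>I. - \<psi> (of_real (cos_zero k)) / of_real (cos_zero k ^ 2 * sin (cos_zero k)))"
  proof (rule sum.cong[OF refl])
    fix k assume k: "k \<in> I"
    have ne: "y k \<noteq> 0" "sin (y k) \<noteq> 0" "cos (y k) = 0"
      using cos_zero_props[of k] by (auto simp: y_def sin_of_real)
    have "residue (\<lambda>w. \<psi> w / (w^2 * cos w)) (y k) = \<psi> (y k) / (- ((y k)^2) * sin (y k))"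
    \<comment> \<open>The radius pi/2 excludes the other zeros, which are at distance pi or more,
      and also 0, since |y k| is at least pi/2.\<close>
    proof (rule residue_quotient_simple_zero[where s="ball (y k) (pi/2)"])
      show "((\<lambda>w. w^2 * cos w) has_field_derivative - ((y k)^2) * sin (y k)) (at (y k))"
        using ne by (auto intro!: derivative_eq_intros)
      show "- ((y k)^2) * sin (y k) \<noteq> 0" using ne by simp
      fix w assume w: "w \<in> ball (y k) (pi/2) - {y k}"
      have "w \<noteq> 0" using w cos_zero_props(4)[of k] by (auto simp: y_def dist_norm)
      moreover have "cos w \<noteq> 0"
      proof
        assume "cos w = 0"
        then obtain l where l: "w = y l" by (auto simp: cos_eq_0_iff_cos_zero y_def)
        then have "l \<noteq> k" using w by auto
        then have "\<bar>real_of_int (k - l)\<bar> \<ge> 1" by linarith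
        then have "\<bar>real_of_int k - real_of_int l\<bar> * pi \<ge> 1 * pi" by (intro mult_right_mono) auto
        moreover have "dist (y k) (y l) = \<bar>real_of_int k - real_of_int l\<bar> * pi"
        proof -
          have "dist (y k) (y l) = \<bar>cos_zero k - cos_zero l\<bar>"
            by (simp add: y_def dist_norm flip: of_real_diff)
          also have "cos_zero k - cos_zero l = (real_of_int k - real_of_int l) * pi"
            by (simp add: cos_zero_def algebra_simps)
          finally show ?thesis by (simp add: abs_mult)
        qed
        ultimately show False using w l pi_gt_zero by simp
      qed
      ultimately show "w^2 * cos w \<noteq> 0" by simp
    qed (use hol ne in \<open>auto intro!: holomorphic_intros intro: holomorphic_on_subset\<close>)
    then show "residue F (y k) = - \<psi> (of_real (cos_zero k)) / of_real (cos_zero k ^ 2 * sin (cos_zero k))"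
      by (simp add: F_def y_def sin_of_real)
  qed
  also have "deriv \<psi> 0 + (\<Sum>k\<in>I. - \<psi> (of_real (cos_zero k)) / of_real (cos_zero k ^ 2 * sin (cos_zero k)))
      = deriv \<psi> 0 - (\<Sum>k\<in>I. \<psi> (of_real (cos_zero k)) / of_real (cos_zero k ^ 2 * sin (cos_zero k)))" (is "_ = ?D")
    by (simp add: sum_negf)
  finally have CI: "contour_integral (rectpath a1 a3) F = 2 * pi * \<i> * ?D" .
  \<comment> \<open>On the contour |\<psi>| is at most 4K |cos z| and |z| is at least L. The four
    sides of length 2L then contribute 32K/L in all, and division by 2 pi gives the stated
    error.\<close>
  define \<beta> where "\<beta> = 4 * K / L^2"
  have \<beta>: "\<beta> \<ge> 0" using K by (simp add: \<beta>_def)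
  have bnd: "cmod (F z) \<le> \<beta>" if "z \<in> path_image (rectpath a1 a3)" for z
  proof -
    have "\<bar>cos (Re z)\<bar> = 1 \<or> \<bar>Im z\<bar> \<ge> 1"
    proof (cases "\<bar>Re z\<bar> = L")
      case True
      then have "Re z = L \<or> Re z = - L" by linarith
      then have "cos (Re z) = (-1) ^ N" unfolding L_def by (auto simp: cos_npi)
      then show ?thesis by simp
    next
      case False
      then show ?thesis using that L1 by (auto simp: img)
    qed
    then have c: "exp \<bar>Im z\<bar> \<le> 4 * cmod (cos z)" by (rule norm_cos_lower)
    then have cpos: "cmod (cos z) > 0" using exp_gt_zero[of "\<bar>Im z\<bar>"] by linarith
    have zL: "L \<le> cmod z" using that abs_Re_le_cmod[of z] abs_Im_le_cmod[of z] by (auto simp: img)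
    have "cmod (\<psi> z) \<le> K * (4 * cmod (cos z))"
      using growth[of z] c K by (meson mult_left_mono order_trans)
    then have "cmod (F z) \<le> K * (4 * cmod (cos z)) / (cmod z ^ 2 * cmod (cos z))"
      unfolding F_def norm_divide norm_mult norm_power by (intro divide_right_mono) auto
    also have "\<dots> = 4 * K / cmod z ^ 2" using cpos by simp
    also have "\<dots> \<le> \<beta>" unfolding \<beta>_def using zL L0 K by (intro divide_left_mono power_mono mult_pos_pos) auto
    finally show ?thesis .
  qed
  define a2 where "a2 = Complex L (- L)"
  define a4 where "a4 = Complex (- L) L"
  have rp: "rectpath a1 a3 = linepath a1 a2 +++ linepath a2 a3 +++ linepath a3 a4 +++ linepath a4 a1"
    by (simp add: rectpath_def Let_def a1_def a2_def a3_def a4_def)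
  have imgs: "path_image (rectpath a1 a3) = closed_segment a1 a2 \<union> closed_segment a2 a3 \<union>
      closed_segment a3 a4 \<union> closed_segment a4 a1"
    unfolding rp by (simp add: path_image_join Un_assoc)
  have contF: "continuous_on (path_image (rectpath a1 a3)) F"
    using holF ptsS holomorphic_on_imp_continuous_on continuous_on_subset by blast
  have ci: "F contour_integrable_on linepath u v"
    and cb: "cmod (contour_integral (linepath u v) F) \<le> \<beta> * cmod (v - u)"
    if "closed_segment u v \<subseteq> path_image (rectpath a1 a3)" for u v
  proof -
    show i: "F contour_integrable_on linepath u v"
      using that contF continuous_on_subset by (blast intro: contour_integrable_continuous_linepath)
    show "cmod (contour_integral (linepath u v) F) \<le> \<beta> * cmod (v - u)"
      using has_contour_integral_bound_linepath[OF has_contour_integral_integral[OF i] \<beta>] bnd that by blast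
  qed
  have cis: "F contour_integrable_on linepath a1 a2" "F contour_integrable_on linepath a2 a3"
      "F contour_integrable_on linepath a3 a4" "F contour_integrable_on linepath a4 a1"
    by (rule ci; simp add: imgs; blast)+
  have len: "cmod (a2 - a1) = 2 * L" "cmod (a3 - a2) = 2 * L" "cmod (a4 - a3) = 2 * L" "cmod (a1 - a4) = 2 * L"
    using L0 by (auto simp: a1_def a2_def a3_def a4_def cmod_def power2_eq_square real_sqrt_mult)
  have "contour_integral (rectpath a1 a3) F = contour_integral (linepath a1 a2) F +
     (contour_integral (linepath a2 a3) F + (contour_integral (linepath a3 a4) F + contour_integral (linepath a4 a1) F))"
    unfolding rp using cis by (simp add: contour_integrable_join)
  also have "cmod \<dots> \<le> \<beta> * (2 * L) + (\<beta> * (2 * L) + (\<beta> * (2 * L) + \<beta> * (2 * L)))"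
    using cb[of a1 a2] cb[of a2 a3] cb[of a3 a4] cb[of a4 a1] unfolding len imgs
    by (intro norm_triangle_le add_mono) auto
  also have "\<dots> = 32 * K / L" using L0 by (simp add: \<beta>_def power2_eq_square)
  finally have "2 * pi * cmod ?D \<le> 32 * K / L" unfolding CI by (simp add: norm_mult)
  then have "cmod ?D \<le> 16 * K / (L * pi)" using L0 by (simp add: field_simps)
  also have "\<dots> \<le> 16 * K / N"
  proof (rule divide_left_mono)
    have "1 * 1 \<le> pi * pi" using pi_ge_two by (intro mult_mono) auto
    then have "real N * 1 \<le> real N * (pi * pi)" by (intro mult_left_mono) auto
    then show "real N \<le> L * pi" by (simp add: L_def)
  qed (use K N L0 in auto)
  finally show ?thesis by (simp add: I_def)
qed

section \<open>Nodes and weights of the Riesz formula\<close>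

definition riesz_node :: "nat \<Rightarrow> real" where
  "riesz_node n = cos_zero (int n)"

definition riesz_weight :: "nat \<Rightarrow> real" where
  "riesz_weight n = 1 / riesz_node n ^ 2"

lemma riesz_weight_nonneg: "riesz_weight n \<ge> 0"
  by (simp add: riesz_weight_def)

lemma sum_int_symmetric:
  "(\<Sum>k\<in>{- int N..int N - 1}. h k) = (\<Sum>n<N. h (int n) + h (- int n - 1))" for h :: "int \<Rightarrow> 'a::comm_monoid_add"
proof (induction N)
  case (Suc N)
  have e: "{- int (Suc N)..int (Suc N) - 1} = insert (int N) (insert (- int N - 1) {- int N..int N - 1})"
    by auto
  show ?case unfolding e using Suc by (simp add: add_ac)
qed simp

lemma norm_sin_le_exp_Im: "cmod (sin z) \<le> exp \<bar>Im z\<bar>"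
proof -
  define y where "y = Im z"
  have "- 2 * cos (2 * Re z) \<le> 2 * (exp y * exp (- y))" using cos_ge_minus_one[of "2 * Re z"]
    by (simp flip: exp_add del: cos_ge_minus_one)
  then have "cmod (sin z) ^ 2 \<le> (exp y ^ 2 + exp (- y) ^ 2 + 2 * (exp y * exp (- y))) / 4"
    unfolding norm_sin_squared by (simp add: y_def exp_double exp_minus power_inverse)
  also have "\<dots> = ((exp y + exp (- y)) / 2) ^ 2"
    by (simp add: power2_eq_square algebra_simps)
  finally have "cmod (sin z) \<le> (exp y + exp (- y)) / 2"
    by (rule power2_le_imp_le) (simp add: add_nonneg_nonneg)
  also have "\<dots> \<le> exp \<bar>y\<bar>"
  proof -
    have "(exp y + exp (- y)) / 2 \<le> (exp \<bar>y\<bar> + exp \<bar>y\<bar>) / 2"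
      by (intro divide_right_mono add_mono) auto
    then show ?thesis by simp
  qed
  finally show ?thesis by (simp add: y_def)
qed

lemma cos_zero_neg: "cos_zero (- int n - 1) = - riesz_node n"
  by (simp add: cos_zero_def riesz_node_def algebra_simps)

text \<open>Riesz interpolation applied to \<open>sin\<close> itself: every quotient sin(y)/(y^2 sin
  y) collapses to 1/y^2, so the weights over all positive and negative nodes add up to the
  derivative 1 of sin at 0.\<close>

lemma riesz_weight_sums: "riesz_weight sums (1/2)"
proof -
  have est: "\<bar>1 - 2 * (\<Sum>n<N. riesz_weight n)\<bar> \<le> 16 / real N" if "N \<ge> 1" for N
  proof -
    have "cmod (deriv sin 0 - (\<Sum>k\<in>{- int N..int N - 1}.
            sin (of_real (cos_zero k)) / of_real (cos_zero k ^ 2 * sin (cos_zero k)))) \<le> 16 * 1 / N"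
      using norm_sin_le_exp_Im by (intro riesz_interpolation_partial that holomorphic_intros) auto
    also have "(\<Sum>k\<in>{- int N..int N - 1}.
            sin (complex_of_real (cos_zero k)) / of_real (cos_zero k ^ 2 * sin (cos_zero k)))
        = (\<Sum>k\<in>{- int N..int N - 1}. complex_of_real (1 / cos_zero k ^ 2))"
    proof (rule sum.cong[OF refl])
      fix k
      have "sin (cos_zero k) \<noteq> 0" using cos_zero_props(3)[of k] by auto
      then show "sin (complex_of_real (cos_zero k)) / of_real (cos_zero k ^ 2 * sin (cos_zero k))
        = complex_of_real (1 / cos_zero k ^ 2)" by (simp add: sin_of_real)
    qed
    also have "\<dots> = complex_of_real (2 * (\<Sum>n<N. riesz_weight n))"
      unfolding sum_int_symmetric
      by (simp add: cos_zero_neg riesz_weight_def riesz_node_def sum_distrib_left sum.distrib)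
    also have "deriv sin (0::complex) = 1"
      by (rule DERIV_imp_deriv) (auto intro!: derivative_eq_intros)
    also have "1 - complex_of_real (2 * (\<Sum>n<N. riesz_weight n)) = of_real (1 - 2 * (\<Sum>n<N. riesz_weight n))"
      by simp
    finally show ?thesis by (simp only: norm_of_real mult_1_right)
  qed
  have "(\<lambda>N. 1 - 2 * (\<Sum>n<N. riesz_weight n)) \<longlonglongrightarrow> 0"
  proof (rule Lim_null_comparison)
    show "eventually (\<lambda>N. norm (1 - 2 * (\<Sum>n<N. riesz_weight n)) \<le> 16 / real N) sequentially"
      using est by (auto simp: eventually_sequentially)
    show "(\<lambda>N. 16 / real N) \<longlonglongrightarrow> 0" by real_asymp
  qed
  then have "(\<lambda>N. (1 - (1 - 2 * (\<Sum>n<N. riesz_weight n))) / 2) \<longlonglongrightarrow> (1 - 0) / 2"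
    by (intro tendsto_intros) auto
  then show ?thesis by (simp add: sums_def)
qed

text \<open>The rescaling z -> x + z/a reduces to growth exp |Im z| and to the derivative at 0.
  Since |sin| = 1 at the nodes, moduli replace the signed terms, and the error 16K/N vanishes in the
  limit; \<open>K\<close> therefore does not appear in the result. Positive and negative nodes are
  kept as two series.\<close>

lemma riesz_derivative_bound:
  fixes \<psi> :: "complex \<Rightarrow> complex"
  assumes hol: "\<psi> holomorphic_on UNIV"
    and growth: "\<And>z. cmod (\<psi> z) \<le> K * exp (a * \<bar>Im z\<bar>)" and a: "a > 0"
  shows "summable (\<lambda>n. riesz_weight n * cmod (\<psi> (of_real (x + riesz_node n / a))))"
    and "summable (\<lambda>n. riesz_weight n * cmod (\<psi> (of_real (x - riesz_node n / a))))"
    and "cmod (deriv \<psi> (of_real x)) \<le>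
      a * ((\<Sum>n. riesz_weight n * cmod (\<psi> (of_real (x + riesz_node n / a))))
         + (\<Sum>n. riesz_weight n * cmod (\<psi> (of_real (x - riesz_node n / a)))))"
proof -
  have bd: "cmod (\<psi> (of_real t)) \<le> K" for t using growth[of "of_real t"] by simp
  have sm: "summable (\<lambda>n. riesz_weight n * cmod (\<psi> (of_real (t n))))" for t
  proof (rule summable_comparison_test[where g="\<lambda>n. riesz_weight n * K"])
    show "summable (\<lambda>n. riesz_weight n * K)"
      using riesz_weight_sums by (intro summable_mult2) (auto simp: sums_iff)
    show "\<exists>N. \<forall>n\<ge>N. norm (riesz_weight n * cmod (\<psi> (of_real (t n)))) \<le> riesz_weight n * K"
      using bd riesz_weight_nonneg by (auto intro!: mult_left_mono simp: abs_mult)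
  qed
  show s1: "summable (\<lambda>n. riesz_weight n * cmod (\<psi> (of_real (x + riesz_node n / a))))"
    and s2: "summable (\<lambda>n. riesz_weight n * cmod (\<psi> (of_real (x - riesz_node n / a))))"
    by (rule sm)+
  define \<tau> where "\<tau> = (\<lambda>z. \<psi> (of_real x + z / of_real a))"
  have hol\<tau>: "\<tau> holomorphic_on UNIV"
    unfolding \<tau>_def
    using holomorphic_on_compose_gen[OF _ hol, of "\<lambda>z. of_real x + z / of_real a" UNIV] a
    by (simp add: o_def holomorphic_intros)
  have "(\<tau> has_field_derivative deriv \<psi> (of_real x) * (1 / of_real a)) (at 0)"
    unfolding \<tau>_def using a
    by (intro DERIV_chain'[where g=\<psi>]) (auto intro!: derivative_eq_intros holomorphic_derivI[OF hol])
  then have d\<tau>: "deriv \<tau> 0 = deriv \<psi> (of_real x) / of_real a" using DERIV_imp_deriv by fastforce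
  have gr\<tau>: "cmod (\<tau> z) \<le> K * exp \<bar>Im z\<bar>" for z
    using growth[of "of_real x + z / of_real a"] a by (simp add: \<tau>_def abs_divide)
  have part: "cmod (deriv \<tau> 0) \<le> (\<Sum>n<N. riesz_weight n * cmod (\<psi> (of_real (x + riesz_node n / a))))
      + (\<Sum>n<N. riesz_weight n * cmod (\<psi> (of_real (x - riesz_node n / a)))) + 16 * K / N" if "N \<ge> 1" for N
  proof -
    let ?t = "\<lambda>k. \<tau> (of_real (cos_zero k)) / of_real (cos_zero k ^ 2 * sin (cos_zero k))"
    have "cmod (deriv \<tau> 0) \<le> cmod (\<Sum>k\<in>{- int N..int N - 1}. ?t k) + 16 * K / N"
      using riesz_interpolation_partial[OF hol\<tau> gr\<tau> that]
        norm_triangle_sub[of "deriv \<tau> 0" "\<Sum>k\<in>{- int N..int N - 1}. ?t k"] by linarith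
    also have "cmod (\<Sum>k\<in>{- int N..int N - 1}. ?t k) \<le> (\<Sum>k\<in>{- int N..int N - 1}. cmod (?t k))"
      by (rule norm_sum)
    also have "\<dots> = (\<Sum>k\<in>{- int N..int N - 1}. cmod (\<tau> (of_real (cos_zero k))) / cos_zero k ^ 2)"
      using cos_zero_props(3)
      by (intro sum.cong refl) (simp add: norm_divide norm_mult norm_power del: of_real_mult of_real_power add: abs_mult)
    also have "\<dots> = (\<Sum>n<N. riesz_weight n * cmod (\<psi> (of_real (x + riesz_node n / a))))
      + (\<Sum>n<N. riesz_weight n * cmod (\<psi> (of_real (x - riesz_node n / a))))"
      unfolding sum_int_symmetric cos_zero_neg
      by (simp add: sum.distrib riesz_weight_def riesz_node_def[symmetric] \<tau>_def)
    finally show ?thesis by simp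
  qed
  have "cmod (deriv \<tau> 0) \<le> (\<Sum>n. riesz_weight n * cmod (\<psi> (of_real (x + riesz_node n / a))))
         + (\<Sum>n. riesz_weight n * cmod (\<psi> (of_real (x - riesz_node n / a)))) + 0"
  proof (rule LIMSEQ_le_const)
    show "(\<lambda>N. (\<Sum>n<N. riesz_weight n * cmod (\<psi> (of_real (x + riesz_node n / a))))
      + (\<Sum>n<N. riesz_weight n * cmod (\<psi> (of_real (x - riesz_node n / a)))) + 16 * K / N) \<longlonglongrightarrow>
      (\<Sum>n. riesz_weight n * cmod (\<psi> (of_real (x + riesz_node n / a))))
         + (\<Sum>n. riesz_weight n * cmod (\<psi> (of_real (x - riesz_node n / a)))) + 0"
      using s1 s2 by (intro tendsto_add summable_LIMSEQ tendsto_divide_0[OF tendsto_const] filterlim_real_sequentially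
        filterlim_at_top_imp_at_infinity)
  qed (use part in auto)
  then have "cmod (deriv \<psi> (of_real x)) / a \<le> (\<Sum>n. riesz_weight n * cmod (\<psi> (of_real (x + riesz_node n / a))))
         + (\<Sum>n. riesz_weight n * cmod (\<psi> (of_real (x - riesz_node n / a))))"
    unfolding d\<tau> using a by (simp add: norm_divide)
  then show "cmod (deriv \<psi> (of_real x)) \<le>
      a * ((\<Sum>n. riesz_weight n * cmod (\<psi> (of_real (x + riesz_node n / a))))
         + (\<Sum>n. riesz_weight n * cmod (\<psi> (of_real (x - riesz_node n / a)))))"
    using a by (simp add: field_simps)
qed

text \<open>Each of the two series has total weight 1/2, so together they average values bounded by
  \<open>M\<close>. The growth constant \<open>K\<close> may be much larger than
  \<open>M\<close>.\<close>

lemma bernstein_inequality: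
  fixes \<psi> :: "complex \<Rightarrow> complex"
  assumes hol: "\<psi> holomorphic_on UNIV"
    and growth: "\<And>z. cmod (\<psi> z) \<le> K * exp (a * \<bar>Im z\<bar>)" and a: "a > 0"
    and bd: "\<And>t. cmod (\<psi> (of_real t)) \<le> M"
  shows "cmod (deriv \<psi> (of_real x)) \<le> a * M"
proof -
  have le: "(\<Sum>n. riesz_weight n * cmod (\<psi> (of_real (t n)))) \<le> 1/2 * M"
    if "summable (\<lambda>n. riesz_weight n * cmod (\<psi> (of_real (t n))))" for t
    using riesz_weight_nonneg bd
    by (intro sums_le[OF _ summable_sums[OF that] sums_mult2[OF riesz_weight_sums]] mult_left_mono) auto
  have "cmod (deriv \<psi> (of_real x)) \<le> a * (1/2 * M + 1/2 * M)"
    using riesz_derivative_bound[OF hol growth a, of x] a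
    by (intro order_trans[OF riesz_derivative_bound(3)[OF hol growth a, of x]] mult_left_mono add_mono le) auto
  then show ?thesis by simp
qed

subsection \<open>Functions of exponential type in each variable\<close>

text \<open>A counterpart of Phragmen-Lindelof on a bounded domain, where the arc is controlled
  directly: the factor exp(i b s z), with s = 1 or s = -1 according to the half disc containing z,
  has modulus exp(-b |Im z|) there, and the maximum principle applies to the product.\<close>

lemma half_disc_bound:
  fixes \<Phi> :: "complex \<Rightarrow> complex"
  assumes hol: "\<Phi> holomorphic_on UNIV"
    and real_axis: "\<And>t. \<bar>t\<bar> \<le> R \<Longrightarrow> cmod (\<Phi> (of_real t)) \<le> B"
    and arc: "\<And>z. cmod z = R \<Longrightarrow> cmod (\<Phi> z) \<le> B * exp (b * \<bar>Im z\<bar>)"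
    and z: "cmod z \<le> R"
  shows "cmod (\<Phi> z) \<le> B * exp (b * \<bar>Im z\<bar>)"
proof -
  define s :: real where "s = (if Im z \<ge> 0 then 1 else - 1)"
  define T where "T = {z. cmod z \<le> R \<and> s * Im z \<ge> 0}"
  define H where "H = (\<lambda>z. \<Phi> z * exp (\<i> * of_real (b * s) * z))"
  have H: "cmod (H u) = cmod (\<Phi> u) * exp (- (b * (s * Im u)))" for u
    by (simp add: H_def norm_mult mult.assoc)
  have holH: "H holomorphic_on UNIV"
    unfolding H_def using hol by (intro holomorphic_intros)
  have clT: "closed T" unfolding T_def
    by (intro closed_Collect_conj closed_Collect_le continuous_intros)
  have sIm: "s * Im u = \<bar>Im u\<bar>" if "u \<in> T" for u
    using that by (auto simp: T_def s_def split: if_splits)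
  have "cmod (H z) \<le> B"
  proof (rule maximum_modulus_frontier[of H T])
    show "H holomorphic_on interior T" using holH holomorphic_on_subset by blast
    show "continuous_on (closure T) H"
      using holH holomorphic_on_imp_continuous_on holomorphic_on_subset by blast
    have "T \<subseteq> cball 0 R" by (auto simp: T_def)
    then show "bounded T" using bounded_subset bounded_cball by blast
    show "z \<in> T" using z by (auto simp: T_def s_def)
    fix u assume "u \<in> frontier T"
    then have uT: "u \<in> T" and ni: "u \<notin> interior T"
      using clT by (auto simp: frontier_def)
    consider "cmod u = R" | "Im u = 0"
    proof -
      have "cmod u = R \<or> Im u = 0"
      proof (rule ccontr)
        assume neg: "\<not> ?thesis"
        define V where "V = {z. cmod z < R \<and> s * Im z > 0}"
        have "open V" unfolding V_def
          by (intro open_Collect_conj open_Collect_less continuous_intros)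
        moreover have "V \<subseteq> T" by (auto simp: V_def T_def)
        moreover have "u \<in> V" using neg uT sIm[OF uT] by (auto simp: V_def T_def)
        ultimately show False using ni interior_maximal by blast
      qed
      then show ?thesis using that by blast
    qed
    then show "cmod (H u) \<le> B"
    proof cases
      case 1
      have "cmod (H u) \<le> B * exp (b * \<bar>Im u\<bar>) * exp (- (b * \<bar>Im u\<bar>))"
        unfolding H sIm[OF uT] using arc[OF 1] by (intro mult_right_mono) auto
      then show ?thesis by (simp add: mult.assoc flip: exp_add)
    next
      case 2
      then have u: "u = of_real (Re u)" by (simp add: complex_eq_iff)
      have "\<bar>Re u\<bar> \<le> R" using uT abs_Re_le_cmod[of u] by (auto simp: T_def)
      then show ?thesis using real_axis[of "Re u"] 2 u unfolding H by simp
    qed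
  qed
  moreover have "s * Im z = \<bar>Im z\<bar>" by (simp add: s_def)
  ultimately show ?thesis unfolding H by (simp add: exp_minus field_simps)
qed

text \<open>The coordinates of x are replaced by those of y one at a time. Each intermediate point
  takes all its coordinates from x or y and so stays in the cube on which \<open>step\<close> is
  available.\<close>

lemma coordinatewise_lipschitz:
  fixes F :: "real^'n \<Rightarrow> 'a::real_normed_vector"
  assumes step: "\<And>x j t. (\<And>i. \<bar>x $ i\<bar> \<le> \<rho>) \<Longrightarrow> (\<And>i. \<bar>(x + t *\<^sub>R axis j 1) $ i\<bar> \<le> \<rho>) \<Longrightarrow>
      norm (F (x + t *\<^sub>R axis j 1) - F x) \<le> L * \<bar>t\<bar>"
    and x: "\<And>i. \<bar>x $ i\<bar> \<le> \<rho>" and y: "\<And>i. \<bar>y $ i\<bar> \<le> \<rho>"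
  shows "norm (F y - F x) \<le> L * (\<Sum>i\<in>UNIV. \<bar>y $ i - x $ i\<bar>)"
proof -
  define p where "p = (\<lambda>S. (\<chi> i. if i \<in> S then y $ i else x $ i) :: real^'n)"
  have pb: "\<bar>p S $ i\<bar> \<le> \<rho>" for S i using x y by (simp add: p_def)
  have "norm (F (p S) - F x) \<le> L * (\<Sum>i\<in>S. \<bar>y $ i - x $ i\<bar>)" if "finite S" for S
    using that
  proof induction
    case empty
    have "p {} = x" by (simp add: p_def vec_eq_iff)
    then show ?case by simp
  next
    case (insert j S)
    have e: "p (insert j S) = p S + (y $ j - x $ j) *\<^sub>R axis j 1"
      using insert.hyps by (auto simp: p_def vec_eq_iff axis_def)
    have "norm (F (p (insert j S)) - F (p S)) \<le> L * \<bar>y $ j - x $ j\<bar>"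
      unfolding e using pb[of S] pb[of "insert j S"] by (intro step) (auto simp: e)
    then have "norm (F (p (insert j S)) - F x) \<le> L * \<bar>y $ j - x $ j\<bar> + L * (\<Sum>i\<in>S. \<bar>y $ i - x $ i\<bar>)"
      using insert.IH norm_triangle_ineq[of "F (p (insert j S)) - F (p S)" "F (p S) - F x"] by simp
    then show ?case using insert.hyps by (simp add: algebra_simps)
  qed
  moreover have "p UNIV = y" by (simp add: p_def vec_eq_iff)
  ultimately show ?thesis by (metis finite)
qed

text \<open>The function is required to be entire in each variable separately while the others stay real;
  unlike the exponential type condition on the complex space, this involves only the restriction to
  the reals.\<close>

definition slice_exp_type :: "real \<Rightarrow> (real^'n \<Rightarrow> complex) \<Rightarrow> bool" where
  "slice_exp_type a g \<longleftrightarrow> continuous_on UNIV g \<and> (\<exists>C. \<forall>j x. \<exists>\<phi>. \<phi> holomorphic_on UNIV \<and>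
     (\<forall>t. \<phi> (of_real t) = g (x + t *\<^sub>R axis j 1)) \<and>
     (\<forall>z. cmod (\<phi> z) \<le> C * exp (a * ((\<Sum>i\<in>UNIV. \<bar>x $ i\<bar>) + cmod z))))"

lemma slice_exp_type_obtain:
  assumes "slice_exp_type a g"
  obtains C where "C > 0" "\<And>j x. \<exists>\<phi>. \<phi> holomorphic_on UNIV \<and>
     (\<forall>t. \<phi> (of_real t) = g (x + t *\<^sub>R axis j 1)) \<and>
     (\<forall>z. cmod (\<phi> z) \<le> C * exp (a * ((\<Sum>i\<in>UNIV. \<bar>x $ i\<bar>) + cmod z)))"
proof -
  obtain C where C: "\<And>j x. \<exists>\<phi>. \<phi> holomorphic_on UNIV \<and>
     (\<forall>t. \<phi> (of_real t) = g (x + t *\<^sub>R axis j 1)) \<and>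
     (\<forall>z. cmod (\<phi> z) \<le> C * exp (a * ((\<Sum>i\<in>UNIV. \<bar>x $ i\<bar>) + cmod z)))"
    using assms unfolding slice_exp_type_def by blast
  have "C * exp u \<le> max C 1 * exp u" for u by simp
  then have "\<exists>\<phi>. \<phi> holomorphic_on UNIV \<and>
     (\<forall>t. \<phi> (of_real t) = g (x + t *\<^sub>R axis j 1)) \<and>
     (\<forall>z. cmod (\<phi> z) \<le> max C 1 * exp (a * ((\<Sum>i\<in>UNIV. \<bar>x $ i\<bar>) + cmod z)))" for j x
    using C[of x j] order_trans by meson
  then show ?thesis using that[of "max C 1"] by simp
qed

lemma slice_exp_type_growth:
  assumes "\<exists>\<phi>. \<phi> holomorphic_on UNIV \<and>
     (\<forall>t. \<phi> (of_real t) = g (x + t *\<^sub>R axis j 1)) \<and>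
     (\<forall>z. cmod (\<phi> z) \<le> C * exp (a * ((\<Sum>i\<in>UNIV. \<bar>x $ i\<bar>) + cmod z)))"
  shows "cmod (g x) \<le> C * exp (a * (\<Sum>i\<in>UNIV. \<bar>x $ i\<bar>))"
proof -
  obtain \<phi> where p: "\<forall>t. \<phi> (of_real t) = g (x + t *\<^sub>R axis j 1)"
     "\<forall>z. cmod (\<phi> z) \<le> C * exp (a * ((\<Sum>i\<in>UNIV. \<bar>x $ i\<bar>) + cmod z))" using assms by blast
  show ?thesis using p(1)[rule_format, of 0] p(2)[rule_format, of 0] by simp
qed

text \<open>The inequality \<open>a > \<sigma>\<close> is strict because the class allows an
  arbitrarily small excess of type; the choice \<epsilon> = a/\<sigma> - 1 uses it up. Complex
  linearity of the derivative of f makes each one-variable slice complex differentiable.\<close>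

lemma slice_exp_type_restr:
  fixes f :: "complex^'n \<Rightarrow> complex"
  assumes f: "f \<in> exp_type_class \<sigma>" and "\<sigma> > 0" "a > \<sigma>"
  shows "slice_exp_type a (restr f)"
proof -
  have ent: "entire_m f" using f by (simp add: exp_type_class_def)
  define \<epsilon> where "\<epsilon> = a / \<sigma> - 1"
  have "\<epsilon> > 0" "\<sigma> * (1 + \<epsilon>) = a" using assms by (auto simp: \<epsilon>_def field_simps)
  moreover obtain C where "\<And>z. cmod (f z) \<le> C * exp (\<sigma> * (1 + \<epsilon>) * (\<Sum>j\<in>UNIV. cmod (z $ j)))"
    using f \<open>\<epsilon> > 0\<close> unfolding exp_type_class_def by blast
  ultimately have C: "\<And>z. cmod (f z) \<le> C * exp (a * (\<Sum>j\<in>UNIV. cmod (z $ j)))" by metis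
  have contf: "continuous_on UNIV f"
    using ent unfolding entire_m_def
    by (metis continuous_at_imp_continuous_on has_derivative_continuous)
  have C0: "C \<ge> 0" using order_trans[OF norm_ge_zero C[of 0]] by simp
  have "continuous_on UNIV (restr f)"
    unfolding restr_def
    by (intro continuous_on_compose2[OF contf] continuous_intros) auto
  moreover have "\<exists>\<phi>. \<phi> holomorphic_on UNIV \<and>
     (\<forall>t. \<phi> (of_real t) = restr f (x + t *\<^sub>R axis j 1)) \<and>
     (\<forall>z. cmod (\<phi> z) \<le> C * exp (a * ((\<Sum>i\<in>UNIV. \<bar>x $ i\<bar>) + cmod z)))" for j x
  proof -
    define p where "p = (\<lambda>z. (\<chi> i. of_real (x $ i)) + z *s (axis j 1 :: complex^'n))"
    have pd: "(p has_derivative (\<lambda>h. h *s axis j 1)) (at z)" for z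
    proof -
      have bl: "bounded_linear (\<lambda>h. h *s (axis j 1 :: complex^'n))"
      proof (rule bounded_linear_intro[where K=1])
        fix h :: complex
        have "norm (h *s (axis j 1 :: complex^'n)) \<le> (\<Sum>i\<in>UNIV. norm ((h *s (axis j 1 :: complex^'n)) $ i))"
          unfolding norm_vec_def by (rule L2_set_le_sum) auto
        also have "\<dots> = (\<Sum>i\<in>UNIV. if i = j then norm h else 0)"
          by (intro sum.cong) (auto simp: axis_def)
        finally show "norm (h *s (axis j 1 :: complex^'n)) \<le> norm h * 1" by simp
      qed (auto simp: vec_eq_iff algebra_simps)
      show ?thesis unfolding p_def
        by (auto intro!: derivative_eq_intros bounded_linear_imp_has_derivative[OF bl])
    qed
    have "(\<lambda>z. f (p z)) holomorphic_on UNIV"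
      unfolding holomorphic_on_def
    proof
      fix z :: complex
      obtain D where D: "(f has_derivative D) (at (p z))" "\<And>c w. D (c *s w) = c * D w"
        using ent unfolding entire_m_def by blast
      have "((\<lambda>z. f (p z)) has_derivative (\<lambda>h. D (h *s axis j 1))) (at z)"
        using has_derivative_compose[OF pd D(1)] by simp
      then have "((\<lambda>z. f (p z)) has_field_derivative D (axis j 1)) (at z)"
        unfolding has_field_derivative_def D(2) by (simp only: mult_commute_abs)
      then show "(\<lambda>z. f (p z)) field_differentiable at z within UNIV"
        using field_differentiable_def by blast
    qed
    moreover have "f (p (of_real t)) = restr f (x + t *\<^sub>R axis j 1)" for t
      unfolding restr_def p_def by (rule arg_cong[where f=f]) (auto simp: vec_eq_iff axis_def)
    moreover have "cmod (f (p z)) \<le> C * exp (a * ((\<Sum>i\<in>UNIV. \<bar>x $ i\<bar>) + cmod z))" for z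
    proof -
      have "(\<Sum>i\<in>UNIV. cmod (p z $ i)) \<le> (\<Sum>i\<in>UNIV. \<bar>x $ i\<bar> + (if i = j then cmod z else 0))"
        by (intro sum_mono) (auto simp: p_def axis_def intro: norm_triangle_le)
      also have "\<dots> = (\<Sum>i\<in>UNIV. \<bar>x $ i\<bar>) + cmod z" by (simp add: sum.distrib)
      finally show ?thesis
        using assms C0 by (intro order_trans[OF C[of "p z"]] mult_left_mono) auto
    qed
    ultimately show ?thesis by blast
  qed
  ultimately show ?thesis unfolding slice_exp_type_def by blast
qed

lemma slice_bounded_obtain:
  fixes g :: "real^'n \<Rightarrow> complex"
  assumes g: "slice_exp_type a g" and a: "a > 0" and bd: "\<And>x. cmod (g x) \<le> M"
  obtains \<psi> K where "\<psi> holomorphic_on UNIV" "\<And>t. \<psi> (of_real t) = g (x + t *\<^sub>R axis j 1)"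
    "\<And>z. cmod (\<psi> z) \<le> K * exp (a * \<bar>Im z\<bar>)"
proof -
  obtain C where C: "C > 0" "\<And>j x. \<exists>\<phi>. \<phi> holomorphic_on UNIV \<and>
     (\<forall>t. \<phi> (of_real t) = g (x + t *\<^sub>R axis j 1)) \<and>
     (\<forall>z. cmod (\<phi> z) \<le> C * exp (a * ((\<Sum>i\<in>UNIV. \<bar>x $ i\<bar>) + cmod z)))"
    using slice_exp_type_obtain[OF g] by blast
  obtain \<psi> where \<psi>: "\<psi> holomorphic_on UNIV" "\<And>t. \<psi> (of_real t) = g (x + t *\<^sub>R axis j 1)"
      "\<And>z. cmod (\<psi> z) \<le> C * exp (a * ((\<Sum>i\<in>UNIV. \<bar>x $ i\<bar>) + cmod z))"
    using C(2)[of x j] by blast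
  define C' where "C' = C * exp (a * (\<Sum>i\<in>UNIV. \<bar>x $ i\<bar>))"
  have gr: "cmod (\<psi> z) \<le> C' * exp (a * cmod z)" for z
    using \<psi>(3)[of z] by (simp add: C'_def algebra_simps exp_add)
  have "C' > 0" using C(1) by (simp add: C'_def)
  then have "cmod (\<psi> z) \<le> max M C' * exp (a * \<bar>Im z\<bar>)" for z
    using bd \<psi>(2) a by (intro exp_type_bounded_on_reals[OF \<psi>(1) gr]) (auto simp: le_max_iff_disj)
  then show ?thesis using that \<psi>(1,2) by blast
qed

lemma slice_exp_type_lipschitz:
  fixes g :: "real^'n \<Rightarrow> complex"
  assumes g: "slice_exp_type a g" and a: "a > 0" and bd: "\<And>x. cmod (g x) \<le> M"
  shows "cmod (g y - g x) \<le> a * M * (\<Sum>i\<in>UNIV. \<bar>y $ i - x $ i\<bar>)"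
\<comment> \<open>The one-variable estimate holds everywhere, so the cube only has to be large
  enough to contain x and y.\<close>
proof (rule coordinatewise_lipschitz[where \<rho>="(\<Sum>i\<in>UNIV. \<bar>x $ i\<bar>) + (\<Sum>i\<in>UNIV. \<bar>y $ i\<bar>)"])
  fix x :: "real^'n" and j t
  obtain \<psi> K where \<psi>: "\<psi> holomorphic_on UNIV" "\<And>t. \<psi> (of_real t) = g (x + t *\<^sub>R axis j 1)"
    "\<And>z. cmod (\<psi> z) \<le> K * exp (a * \<bar>Im z\<bar>)" using slice_bounded_obtain[OF g a bd] by blast
  have "cmod (\<psi> (of_real t) - \<psi> (of_real 0)) \<le> a * M * cmod (of_real t - of_real 0)"
  proof (rule field_differentiable_bound[where S="closed_segment (of_real 0) (of_real t)" and f'="deriv \<psi>"])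
    fix z :: complex assume "z \<in> closed_segment (of_real 0) (of_real t)"
    then have z: "z = of_real (Re z)"
      by (auto simp: closed_segment_def complex_eq_iff)
    show "(\<psi> has_field_derivative deriv \<psi> z) (at z within closed_segment (of_real 0) (of_real t))"
      using \<psi>(1) by (meson DERIV_subset UNIV_I holomorphic_derivI open_UNIV subset_UNIV)
    show "cmod (deriv \<psi> z) \<le> a * M"
      using bernstein_inequality[OF \<psi>(1,3) a, of M "Re z"] bd \<psi>(2) z by auto
  qed auto
  then show "cmod (g (x + t *\<^sub>R axis j 1) - g x) \<le> a * M * \<bar>t\<bar>"
    using \<psi>(2)[of 0] \<psi>(2)[of t] by simp
next
  fix i
  have "\<bar>x $ i\<bar> \<le> (\<Sum>i\<in>UNIV. \<bar>x $ i\<bar>)" "\<bar>y $ i\<bar> \<le> (\<Sum>i\<in>UNIV. \<bar>y $ i\<bar>)"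
    by (rule member_le_sum; simp)+
  moreover have "(\<Sum>i\<in>UNIV. \<bar>x $ i\<bar>) \<ge> 0" "(\<Sum>i\<in>UNIV. \<bar>y $ i\<bar>) \<ge> 0" by (auto intro: sum_nonneg)
  ultimately show "\<bar>x $ i\<bar> \<le> (\<Sum>i\<in>UNIV. \<bar>x $ i\<bar>) + (\<Sum>i\<in>UNIV. \<bar>y $ i\<bar>)"
    "\<bar>y $ i\<bar> \<le> (\<Sum>i\<in>UNIV. \<bar>x $ i\<bar>) + (\<Sum>i\<in>UNIV. \<bar>y $ i\<bar>)" by linarith+
qed

subsection \<open>Boundedness from a discrete set\<close>

text \<open>The condition on \<open>E\<close> is solved by \<open>E = a (1 + sqrt m) / 2\<close>. With \<open>R = k / E\<close> the damping
  factor then exactly offsets the exponential growth on the boundary of the cube.\<close>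

locale damped_slices =
  fixes g :: "real^'n \<Rightarrow> complex" and a C E R :: real and k :: nat
  assumes a: "a > 0" and C: "C > 0" and cont: "continuous_on UNIV g"
    and slice: "\<And>j x. \<exists>\<phi>. \<phi> holomorphic_on UNIV \<and>
     (\<forall>t. \<phi> (of_real t) = g (x + t *\<^sub>R axis j 1)) \<and>
     (\<forall>z. cmod (\<phi> z) \<le> C * exp (a * ((\<Sum>i\<in>UNIV. \<bar>x $ i\<bar>) + cmod z)))"
    and E: "E > 0" "E = a + (real CARD('n) - 1) * (a^2 / (4 * E))"
    and k: "k \<ge> 1" and R: "R = real k / E"
begin

definition \<omega> :: "real \<Rightarrow> real" where
  "\<omega> t = (1 - t^2 / R^2) ^ k"

definition damped :: "real^'n \<Rightarrow> real" where
  "damped x = cmod (g x) * (\<Prod>i\<in>UNIV. \<omega> (x $ i))"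

definition cube :: "(real^'n) set" where
  "cube = {x. \<forall>i. \<bar>x $ i\<bar> \<le> R}"

lemma R_pos: "R > 0" and k_eq: "real k = E * R"
  using k E(1) by (auto simp: R)

text \<open>Since 1 - u is at most exp(-u), the weight is below the Gaussian exp(-E t^2/R).
  Completing the square against exp(a |t|) leaves exp(a^2 R/(4E)), the price of each real
  variable.\<close>

lemma \<omega>_bounds:
  assumes "\<bar>t\<bar> \<le> R"
  shows "0 \<le> \<omega> t" "\<omega> t \<le> 1" "exp (a * \<bar>t\<bar>) * \<omega> t \<le> exp (a^2 / (4 * E) * R)"
proof -
  have "t^2 \<le> R^2" using assms R_pos power_mono[OF assms, of 2] by simp
  then have "t^2 / R^2 \<le> 1" using R_pos by simp
  then have b: "0 \<le> 1 - t^2 / R^2" "1 - t^2 / R^2 \<le> 1" by auto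
  then show "0 \<le> \<omega> t" "\<omega> t \<le> 1" by (auto simp: \<omega>_def power_le_one)
  have "1 - t^2 / R^2 \<le> exp (- (t^2 / R^2))" using exp_ge_add_one_self[of "- (t^2 / R^2)"] by simp
  then have "\<omega> t \<le> exp (- (t^2 / R^2)) ^ k" unfolding \<omega>_def using b by (intro power_mono) auto
  also have "\<dots> = exp (- (E * t^2 / R))"
    using R_pos by (simp add: k_eq power2_eq_square flip: exp_of_nat_mult)
  finally have "exp (a * \<bar>t\<bar>) * \<omega> t \<le> exp (a * \<bar>t\<bar>) * exp (- (E * t^2 / R))" by simp
  also have "\<dots> = exp (a * \<bar>t\<bar> - E * t^2 / R)" by (simp add: exp_diff exp_minus field_simps)
  also have "a * \<bar>t\<bar> - E * t^2 / R \<le> a^2 / (4 * E) * R"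
  proof -
    have "0 \<le> (2 * E * \<bar>t\<bar> - a * R)^2 / (4 * E * R)" using E R_pos by simp
    also have "\<dots> = E * t^2 / R - a * \<bar>t\<bar> + a^2 / (4 * E) * R"
      using E(1) R_pos by (simp add: power2_diff field_simps power2_eq_square)
    finally show ?thesis by linarith
  qed
  finally show "exp (a * \<bar>t\<bar>) * \<omega> t \<le> exp (a^2 / (4 * E) * R)" by simp
qed

text \<open>The exponents of growth balance: \<open>a * R\<close> for one variable at full radius
  and a^2 R/(4E) for each of the others add up to \<open>E * R = k\<close>, exactly what the degree
  k of the damping can offset.\<close>

lemma E_R: "(real CARD('n) - 1) * (a^2 / (4 * E) * R) + a * R = E * R"
proof -
  have "E * R = (a + (real CARD('n) - 1) * (a^2 / (4 * E))) * R" using E(2) by simp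
  then show ?thesis by (simp add: algebra_simps)
qed

lemma prod_others:
  fixes x :: "real^'n"
  assumes "x \<in> cube"
  shows "exp (a * (\<Sum>i\<in>-{j}. \<bar>x $ i\<bar>)) * (\<Prod>i\<in>-{j}. \<omega> (x $ i))
      \<le> exp ((real CARD('n) - 1) * (a^2 / (4 * E) * R))"
proof -
  have "exp (a * (\<Sum>i\<in>-{j}. \<bar>x $ i\<bar>)) * (\<Prod>i\<in>-{j}. \<omega> (x $ i))
      = (\<Prod>i\<in>-{j}. exp (a * \<bar>x $ i\<bar>) * \<omega> (x $ i))"
    by (simp add: sum_distrib_left exp_sum prod.distrib)
  also have "\<dots> \<le> (\<Prod>i\<in>-{j}. exp (a^2 / (4 * E) * R))"
    using assms \<omega>_bounds by (intro prod_mono) (auto simp: cube_def)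
  also have "\<dots> = exp (a^2 / (4 * E) * R) ^ (CARD('n) - 1)"
    by (simp add: Compl_eq_Diff_UNIV card_Diff_singleton)
  also have "\<dots> = exp (real (CARD('n) - 1) * (a^2 / (4 * E) * R))"
    by (rule exp_of_nat_mult[symmetric])
  also have "real (CARD('n) - 1) = real CARD('n) - 1"
    using zero_less_card_finite[where 'a='n] by (simp add: of_nat_diff)
  finally show ?thesis .
qed

lemma prod_UNIV_split: "(\<Prod>i\<in>UNIV. h i) = h j * (\<Prod>i\<in>-{j}. h i)" for h :: "'n \<Rightarrow> real"
  by (metis Compl_eq_Diff_UNIV UNIV_I finite prod.remove)

lemma sum_UNIV_split: "(\<Sum>i\<in>UNIV. h i) = h j + (\<Sum>i\<in>-{j}. h i)" for h :: "'n \<Rightarrow> real"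
  by (metis Compl_eq_Diff_UNIV UNIV_I finite sum.remove)

text \<open>The threshold 5/6 is such that 1 - (5/6)^2 = 11/36 is below 1/e; the weight of that
  coordinate is then at most exp(-k) and cancels all growth. A maximum above \<open>C\<close> is
  thus forced away from the boundary, leaving room for Cauchy discs and for a nearby point
  X.\<close>

lemma damped_near_boundary:
  assumes x: "x \<in> cube" and j: "\<bar>x $ j\<bar> \<ge> 5/6 * R"
  shows "damped x \<le> C"
proof -
  define W where "W = (\<Prod>i\<in>-{j}. \<omega> (x $ i))"
  have W: "W \<ge> 0" unfolding W_def using x \<omega>_bounds by (intro prod_nonneg) (auto simp: cube_def)
  have xj: "\<bar>x $ j\<bar> \<le> R" using x by (simp add: cube_def)
  have "(5/6 * R)^2 \<le> \<bar>x $ j\<bar>^2" using j R_pos by (intro power_mono) auto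
  then have "(x $ j)^2 / R^2 \<ge> 25/36" using R_pos by (simp add: field_simps power2_eq_square)
  moreover have "(x $ j)^2 / R^2 \<le> 1"
    using power_mono[OF xj, of 2] R_pos by simp
  moreover have "(11::real)/36 \<le> exp (- 1)"
    using exp_le by (simp add: exp_minus field_simps)
  ultimately have "\<omega> (x $ j) \<le> exp (- 1) ^ k"
    unfolding \<omega>_def by (intro power_mono) auto
  also have "\<dots> = exp (- (E * R))" by (simp add: k_eq flip: exp_of_nat_mult)
  finally have wj: "\<omega> (x $ j) \<le> exp (- (E * R))" .
  have "damped x \<le> C * exp (a * (\<Sum>i\<in>UNIV. \<bar>x $ i\<bar>)) * (\<omega> (x $ j) * W)"
    unfolding damped_def prod_UNIV_split[of _ j] W_def[symmetric]
    using slice_exp_type_growth[OF slice] W \<omega>_bounds(1)[OF xj] by (intro mult_right_mono) auto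
  also have "\<dots> = C * exp (a * \<bar>x $ j\<bar>) * \<omega> (x $ j) * (exp (a * (\<Sum>i\<in>-{j}. \<bar>x $ i\<bar>)) * W)"
    unfolding sum_UNIV_split[of _ j] by (simp add: distrib_left exp_add mult_ac)
  also have "\<dots> \<le> C * exp (a * R) * exp (- (E * R)) * exp ((real CARD('n) - 1) * (a^2 / (4 * E) * R))"
    using wj xj a C W prod_others[OF x, of j] \<omega>_bounds(1)[OF xj] unfolding W_def[symmetric]
    by (intro mult_mono mult_nonneg_nonneg) auto
  also have "\<dots> = C * exp ((real CARD('n) - 1) * (a^2 / (4 * E) * R) + a * R - E * R)"
    by (simp add: exp_add exp_diff exp_minus field_simps)
  also have "\<dots> = C" unfolding E_R by simp
  finally show ?thesis .
qed

lemma damped_continuous: "continuous_on UNIV damped"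
  unfolding damped_def \<omega>_def by (intro continuous_intros cont) (use R_pos in auto)

text \<open>With one variable made complex, the damped function extends to an entire \<Phi>, bounded
  on reals in [-R, R] by the maximum B. On the circle |z| = R the damping offsets the growth up to
  exp(2 E |Im z|), so \<open>half_disc_bound\<close> controls the whole disc, and Cauchy's
  inequality bounds the derivative by a multiple of B that does not depend on R.\<close>

lemma damped_step:
  assumes max: "\<And>x. x \<in> cube \<Longrightarrow> damped x \<le> B" and BC: "C \<le> B"
    and x: "\<And>i. \<bar>x $ i\<bar> \<le> R - 1 / (2 * E)" and x': "\<And>i. \<bar>(x + t *\<^sub>R axis j 1) $ i\<bar> \<le> R - 1 / (2 * E)"
  shows "\<bar>damped (x + t *\<^sub>R axis j 1) - damped x\<bar> \<le> 2 * exp 1 * E * B * \<bar>t\<bar>"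
proof -
  \<comment> \<open>With coordinate j set to 0 the slice variable is the coordinate itself, so the
    damping factor extends as a polynomial in z.\<close>
  define x0 where "x0 = x - (x $ j) *\<^sub>R axis j 1"
  define W where "W = (\<Prod>i\<in>-{j}. \<omega> (x $ i))"
  have iE: "1 / (2 * E) > 0" using E by simp
  have xc: "x \<in> cube"
  proof -
    have "\<bar>x $ i\<bar> \<le> R" for i using x[of i] iE by linarith
    then show ?thesis by (simp add: cube_def)
  qed
  have W: "W \<ge> 0" unfolding W_def using xc \<omega>_bounds by (intro prod_nonneg) (auto simp: cube_def)
  have x0i: "x0 $ i = (if i = j then 0 else x $ i)" for i by (simp add: x0_def axis_def)
  obtain \<phi> where \<phi>: "\<phi> holomorphic_on UNIV" "\<And>t. \<phi> (of_real t) = g (x0 + t *\<^sub>R axis j 1)"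
     "\<And>z. cmod (\<phi> z) \<le> C * exp (a * ((\<Sum>i\<in>UNIV. \<bar>x0 $ i\<bar>) + cmod z))"
    using slice[of x0 j] by blast
  define \<Phi> where "\<Phi> = (\<lambda>z. \<phi> z * of_real W * (1 - z^2 / of_real R^2) ^ k)"
  have hol: "\<Phi> holomorphic_on UNIV" unfolding \<Phi>_def using \<phi>(1) R_pos by (intro holomorphic_intros) auto
  have dam: "cmod (\<Phi> (of_real s)) = damped (x0 + s *\<^sub>R axis j 1)" if "\<bar>s\<bar> \<le> R" for s
  proof -
    have "1 - (complex_of_real s)^2 / of_real R^2 = of_real (1 - s^2 / R^2)" by simp
    then have "(1 - (complex_of_real s)^2 / of_real R^2) ^ k = of_real (\<omega> s)"
      by (simp only: \<omega>_def of_real_power)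
    then have "cmod (\<Phi> (of_real s)) = cmod (g (x0 + s *\<^sub>R axis j 1)) * W * \<omega> s"
      using W \<omega>_bounds(1)[OF that] by (simp add: \<Phi>_def \<phi>(2) norm_mult)
    moreover have "(\<Prod>i\<in>UNIV. \<omega> ((x0 + s *\<^sub>R axis j 1) $ i)) = \<omega> s * W"
    proof -
      have "(\<Prod>i\<in>-{j}. \<omega> ((x0 + s *\<^sub>R axis j 1) $ i)) = W"
        unfolding W_def by (intro prod.cong) (auto simp: x0i axis_def)
      then show ?thesis unfolding prod_UNIV_split[of _ j] by (simp add: x0i)
    qed
    ultimately show ?thesis by (simp add: damped_def mult_ac)
  qed
  have cub: "x0 + s *\<^sub>R axis j 1 \<in> cube" if "\<bar>s\<bar> \<le> R" for s
    using that xc by (auto simp: cube_def x0i axis_def)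
  have bound: "cmod (\<Phi> z) \<le> B * exp (2 * E * \<bar>Im z\<bar>)" if "cmod z \<le> R" for z
  proof (rule half_disc_bound[OF hol _ _ that])
    fix s assume "\<bar>s\<bar> \<le> R"
    then show "cmod (\<Phi> (of_real s)) \<le> B" using dam cub max by simp
  next
    fix z assume z: "cmod z = R"
    \<comment> \<open>On the circle R^2 = z * cnj z, hence R^2 - z^2 = -2 i (Im z) z. Then v \<le>
      exp(v - 1) with v = 2 |Im z|/R turns the k-th power into the factor exp(2 E |Im z| - E
      R).\<close>
    have "cmod (1 - z^2 / of_real R^2) = 2 * \<bar>Im z\<bar> / R"
    proof -
      have z2: "(Re z)^2 = R^2 - (Im z)^2" using z cmod_power2[of z] by simp
      have "1 - z^2 / of_real R^2 = (of_real (R^2) - z^2) / of_real R^2"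
        using R_pos by (simp add: field_simps)
      then have "cmod (1 - z^2 / of_real R^2) = cmod (of_real (R^2) - z^2) / R^2"
        using R_pos by (simp add: norm_divide norm_power)
      also have "of_real (R^2) - z^2 = - 2 * \<i> * of_real (Im z) * z"
        using z2 by (auto simp: complex_eq_iff power2_eq_square)
      also have "cmod \<dots> = 2 * \<bar>Im z\<bar> * R" by (simp add: norm_mult z)
      finally show ?thesis using R_pos by (simp add: power2_eq_square)
    qed
    then have "cmod ((1 - z^2 / of_real R^2) ^ k) = (2 * \<bar>Im z\<bar> / R) ^ k" by (simp add: norm_power)
    also have "\<dots> \<le> exp (2 * \<bar>Im z\<bar> / R - 1) ^ k"
      using exp_ge_add_one_self[of "2 * \<bar>Im z\<bar> / R - 1"] R_pos by (intro power_mono) auto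
    also have "\<dots> = exp (2 * E * \<bar>Im z\<bar> - E * R)"
      using R_pos by (simp add: k_eq algebra_simps flip: exp_of_nat_mult)
    finally have zk: "cmod ((1 - z^2 / of_real R^2) ^ k) \<le> exp (2 * E * \<bar>Im z\<bar> - E * R)" .
    have s0: "(\<Sum>i\<in>UNIV. \<bar>x0 $ i\<bar>) = (\<Sum>i\<in>-{j}. \<bar>x $ i\<bar>)"
      unfolding sum_UNIV_split[of _ j] by (auto simp: x0i intro!: sum.cong)
    have "cmod (\<Phi> z) = cmod (\<phi> z) * W * cmod ((1 - z^2 / of_real R^2) ^ k)"
      using W by (simp add: \<Phi>_def norm_mult)
    also have "\<dots> \<le> (C * exp (a * ((\<Sum>i\<in>-{j}. \<bar>x $ i\<bar>) + R))) * W * exp (2 * E * \<bar>Im z\<bar> - E * R)"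
      using \<phi>(3)[of z] zk W C unfolding z s0 by (intro mult_mono mult_nonneg_nonneg) auto
    also have "\<dots> = C * (exp (a * (\<Sum>i\<in>-{j}. \<bar>x $ i\<bar>)) * W) * exp (a * R + 2 * E * \<bar>Im z\<bar> - E * R)"
      by (simp add: distrib_left exp_add exp_diff mult_ac)
    also have "\<dots> \<le> C * exp ((real CARD('n) - 1) * (a^2 / (4 * E) * R)) * exp (a * R + 2 * E * \<bar>Im z\<bar> - E * R)"
      using prod_others[OF xc, of j] C unfolding W_def by (intro mult_right_mono mult_left_mono) auto
    also have "\<dots> = C * exp ((real CARD('n) - 1) * (a^2 / (4 * E) * R) + a * R - E * R + 2 * E * \<bar>Im z\<bar>)"
      by (simp add: mult.assoc algebra_simps flip: exp_add)
    also have "\<dots> = C * exp (2 * E * \<bar>Im z\<bar>)" unfolding E_R by simp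
    also have "\<dots> \<le> B * exp (2 * E * \<bar>Im z\<bar>)" using BC by simp
    finally show "cmod (\<Phi> z) \<le> B * exp (2 * E * \<bar>Im z\<bar>)" .
  qed
  have B0: "B \<ge> 0" using C BC by simp
  define \<rho> where "\<rho> = R - 1 / (2 * E)"
  have der: "cmod (deriv \<Phi> (of_real s)) \<le> 2 * exp 1 * E * B" if s: "\<bar>s\<bar> \<le> \<rho>" for s
  proof -
    \<comment> \<open>The radius 1/(2E) keeps exp(2 E |Im w|) at most e, and the disc stays within
      |w| \<le> R because |s| is at most R - 1/(2E).\<close>
    have "cmod ((deriv ^^ 1) \<Phi> (of_real s)) \<le> fact 1 * (B * exp 1) / (1 / (2 * E)) ^ 1"
    proof (rule Cauchy_inequality)
      show "\<Phi> holomorphic_on ball (of_real s) (1 / (2 * E))" using hol holomorphic_on_subset by blast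
      show "continuous_on (cball (of_real s) (1 / (2 * E))) \<Phi>"
        using hol holomorphic_on_imp_continuous_on holomorphic_on_subset by blast
      show "1 / (2 * E) > 0" by (rule iE)
      fix w assume w: "cmod (of_real s - w) = 1 / (2 * E)"
      have "cmod w \<le> \<bar>s\<bar> + 1 / (2 * E)"
        using w norm_triangle_ineq4[of "of_real s" "of_real s - w"] by simp
      then have "cmod w \<le> R" using s by (simp add: \<rho>_def)
      then have "cmod (\<Phi> w) \<le> B * exp (2 * E * \<bar>Im w\<bar>)" by (rule bound)
      also have "\<bar>Im w\<bar> \<le> 1 / (2 * E)" using abs_Im_le_cmod[of "of_real s - w"] w by simp
      then have "2 * E * \<bar>Im w\<bar> \<le> 1" using E(1) by (simp add: field_simps)
      then have "B * exp (2 * E * \<bar>Im w\<bar>) \<le> B * exp 1" using B0 by (intro mult_left_mono) auto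
      finally show "cmod (\<Phi> w) \<le> B * exp 1" .
    qed
    then show ?thesis by (simp add: mult_ac)
  qed
  define s where "s = x $ j"
  define s' where "s' = x $ j + t"
  have s: "\<bar>s\<bar> \<le> \<rho>" "\<bar>s'\<bar> \<le> \<rho>" using x[of j] x'[of j] by (auto simp: s_def s'_def \<rho>_def)
  have "\<rho> \<le> R" using iE by (simp add: \<rho>_def)
  have "cmod (\<Phi> (of_real s') - \<Phi> (of_real s)) \<le> 2 * exp 1 * E * B * cmod (of_real s' - of_real s)"
  proof (rule field_differentiable_bound[where S="closed_segment (of_real s) (of_real s')" and f'="deriv \<Phi>"])
    fix z :: complex assume "z \<in> closed_segment (of_real s) (of_real s')"
    then obtain u where u: "u \<in> closed_segment s s'" "z = of_real u"
      using closed_segment_of_real by blast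
    have "\<bar>u\<bar> \<le> \<rho>" using u(1) s by (auto simp: closed_segment_eq_real_ivl split: if_splits)
    then show "cmod (deriv \<Phi> z) \<le> 2 * exp 1 * E * B" using der u(2) by simp
    show "(\<Phi> has_field_derivative deriv \<Phi> z) (at z within closed_segment (of_real s) (of_real s'))"
      using hol by (meson DERIV_subset UNIV_I holomorphic_derivI open_UNIV subset_UNIV)
  qed auto
  also have "cmod (of_real s' - of_real s) = \<bar>t\<bar>" by (simp add: s_def s'_def flip: of_real_diff)
  finally have "\<bar>cmod (\<Phi> (of_real s')) - cmod (\<Phi> (of_real s))\<bar> \<le> 2 * exp 1 * E * B * \<bar>t\<bar>"
    using norm_triangle_ineq3 order_trans by blast
  moreover have "cmod (\<Phi> (of_real s)) = damped x"
    using s \<open>\<rho> \<le> R\<close> by (subst dam) (auto simp: s_def x0_def)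
  moreover have "cmod (\<Phi> (of_real s')) = damped (x + t *\<^sub>R axis j 1)"
    using s \<open>\<rho> \<le> R\<close> by (subst dam) (auto simp: s'_def x0_def algebra_simps)
  ultimately show ?thesis by simp
qed

text \<open>At a maximum point with value G, a point X within \<delta> has a damped value of at
  least (1 - \<theta>) G, by \<open>damped_step\<close> with B = G. Damping only decreases |g X|, so
  G is at most M/(1 - \<theta>), with no dependence on R.\<close>

lemma damped_bound:
  assumes near: "\<And>x. \<exists>X. (\<forall>i. \<bar>x $ i - X $ i\<bar> \<le> \<delta>) \<and> cmod (g X) \<le> M"
    and \<delta>: "\<delta> \<ge> 0" and \<theta>: "real CARD('n) * \<delta> * (2 * exp 1 * E) \<le> \<theta>" "\<theta> < 1"
    and R_large: "\<delta> + 1 / (2 * E) \<le> R / 6" and x: "x \<in> cube"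
  shows "damped x \<le> max C (M / (1 - \<theta>))"
proof -
  have "cube = cbox (\<chi> i. - R) (\<chi> i. R)" by (auto simp: cube_def mem_box_cart abs_le_iff) (metis minus_le_iff)+
  then have "compact cube" by simp
  moreover have "cube \<noteq> {}" using x by auto
  ultimately obtain xs where xs: "xs \<in> cube" "\<And>y. y \<in> cube \<Longrightarrow> damped y \<le> damped xs"
    using continuous_attains_sup[of cube damped] damped_continuous continuous_on_subset by blast
  define G where "G = damped xs"
  show ?thesis
  proof (cases "G \<le> C")
    case True
    then show ?thesis using xs(2)[OF x] by (simp add: G_def)
  next
    case False
    have in56: "\<bar>xs $ i\<bar> < 5/6 * R" for i
      using damped_near_boundary[OF xs(1), of i] False by (force simp: G_def)
    obtain X where X: "\<And>i. \<bar>xs $ i - X $ i\<bar> \<le> \<delta>" "cmod (g X) \<le> M" using near[of xs] by blast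
    have iE: "1 / (2 * E) > 0" using E by simp
    have b1: "\<bar>xs $ i\<bar> \<le> R - 1 / (2 * E)" for i using in56[of i] R_large \<delta> by linarith
    have b2: "\<bar>X $ i\<bar> \<le> R - 1 / (2 * E)" for i using in56[of i] X(1)[of i] R_large by linarith
    have "norm (damped X - damped xs) \<le> 2 * exp 1 * E * G * (\<Sum>i\<in>UNIV. \<bar>X $ i - xs $ i\<bar>)"
    proof (rule coordinatewise_lipschitz[where \<rho>="R - 1 / (2 * E)"])
      fix y :: "real^'n" and j t
      assume "\<And>i. \<bar>y $ i\<bar> \<le> R - 1 / (2 * E)" "\<And>i. \<bar>(y + t *\<^sub>R axis j 1) $ i\<bar> \<le> R - 1 / (2 * E)"
      then show "norm (damped (y + t *\<^sub>R axis j 1) - damped y) \<le> 2 * exp 1 * E * G * \<bar>t\<bar>"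
        using damped_step[of G y t j] xs(2) False by (simp add: G_def)
    qed (use b1 b2 in auto)
    also have "\<dots> \<le> 2 * exp 1 * E * G * (\<Sum>i\<in>(UNIV::'n set). \<delta>)"
      using X(1) False C E by (intro mult_left_mono sum_mono) (auto simp: abs_minus_commute)
    also have "\<dots> = real CARD('n) * \<delta> * (2 * exp 1 * E) * G" by simp
    also have "\<dots> \<le> \<theta> * G" using \<theta> False C by (intro mult_right_mono) auto
    finally have "G \<le> damped X + \<theta> * G" by (simp add: G_def)
    moreover have "damped X \<le> M"
    proof -
      have "\<bar>X $ i\<bar> \<le> R" for i using b2[of i] iE by linarith
      then have "0 \<le> (\<Prod>i\<in>UNIV. \<omega> (X $ i))" "(\<Prod>i\<in>UNIV. \<omega> (X $ i)) \<le> 1"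
        using \<omega>_bounds by (auto intro!: prod_nonneg prod_le_1)
      then have "damped X \<le> cmod (g X)" unfolding damped_def by (simp add: mult_left_le)
      then show ?thesis using X(2) by simp
    qed
    ultimately have "G * (1 - \<theta>) \<le> M" by (simp add: algebra_simps)
    then have "G \<le> M / (1 - \<theta>)" using \<theta> by (simp add: pos_le_divide_eq)
    then show ?thesis using xs(2)[OF x] by (simp add: G_def)
  qed
qed

end

text \<open>The point x stays fixed while k, and with it R = k/E, tends to infinity. The bound on
  the damped value is uniform in k, and by Bernoulli each weight is at least 1 - (E x_i)^2/k, which
  tends to 1. The smallness condition is \<theta> < 1 with 2E = a (1 + sqrt m).\<close>

lemma slice_exp_type_bounded:
  fixes g :: "real^'n \<Rightarrow> complex"
  assumes g: "slice_exp_type a g" and a: "a > 0"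
    and near: "\<And>x. \<exists>X. (\<forall>i. \<bar>x $ i - X $ i\<bar> \<le> \<delta>) \<and> cmod (g X) \<le> M"
    and \<delta>: "\<delta> \<ge> 0" and small: "real CARD('n) * \<delta> * (exp 1 * a * (1 + sqrt (real CARD('n)))) < 1"
  shows "\<exists>B. \<forall>x. cmod (g x) \<le> B"
proof -
  obtain C where C: "C > 0" "\<And>j x. \<exists>\<phi>. \<phi> holomorphic_on UNIV \<and>
     (\<forall>t. \<phi> (of_real t) = g (x + t *\<^sub>R axis j 1)) \<and>
     (\<forall>z. cmod (\<phi> z) \<le> C * exp (a * ((\<Sum>i\<in>UNIV. \<bar>x $ i\<bar>) + cmod z)))"
    using slice_exp_type_obtain[OF g] by blast
  have cont: "continuous_on UNIV g" using g by (simp add: slice_exp_type_def)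
  define m where "m = real CARD('n)"
  have m1: "m \<ge> 1" using zero_less_card_finite[where 'a='n] by (simp add: m_def)
  define E where "E = a * (1 + sqrt m) / 2"
  have E0: "E > 0" unfolding E_def using a m1 by (intro divide_pos_pos mult_pos_pos) (auto intro: add_pos_nonneg)
  have E2: "E = a + (m - 1) * (a^2 / (4 * E))"
  proof -
    have "E * E = a * E + (m - 1) * a^2 / 4"
    proof -
      have "sqrt m * sqrt m = m" using m1 by simp
      moreover have "4 * (E * E - a * E) = a^2 * (sqrt m * sqrt m - 1)"
        by (simp add: E_def field_simps power2_eq_square)
      ultimately have "4 * (E * E - a * E) = a^2 * (m - 1)" by simp
      then have "E * E - a * E = a^2 * (m - 1) / 4" by simp
      then show ?thesis by (simp only: algebra_simps)
    qed
    then show ?thesis using E0 by (simp add: field_simps)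
  qed
  define \<theta> where "\<theta> = m * \<delta> * (2 * exp 1 * E)"
  have "\<theta> = m * \<delta> * (exp 1 * a * (1 + sqrt m))" by (simp add: \<theta>_def E_def)
  then have \<theta>: "\<theta> < 1" using small by (simp add: m_def)
  define B where "B = max C (M / (1 - \<theta>))"
  have "cmod (g x) \<le> B" for x
  proof -
    have lim: "(\<lambda>k. cmod (g x) * (\<Prod>i\<in>UNIV. 1 - (E * x $ i)^2 / real k)) \<longlonglongrightarrow>
        cmod (g x) * (\<Prod>i\<in>(UNIV::'n set). 1 - 0)"
      by (intro tendsto_mult tendsto_const tendsto_prod tendsto_diff
          tendsto_divide_0[OF tendsto_const] filterlim_at_top_imp_at_infinity filterlim_real_sequentially)
    \<comment> \<open>The four conditions provide a positive degree, the inequality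
      \<open>R_large\<close>, nonnegative Bernoulli factors, and x in the cube.\<close>
    have "eventually (\<lambda>k. k \<ge> 1 \<and> real k \<ge> 6 * E * (\<delta> + 1 / (2 * E)) \<and>
        (\<forall>i. real k \<ge> (E * x $ i)^2) \<and> (\<forall>i. real k \<ge> E * \<bar>x $ i\<bar>)) sequentially"
      by (intro eventually_conj eventually_ge_at_top eventually_all_finite
          eventually_compose_filterlim[OF eventually_ge_at_top filterlim_real_sequentially])
    then have ev: "eventually (\<lambda>k. cmod (g x) * (\<Prod>i\<in>UNIV. 1 - (E * x $ i)^2 / real k) \<le> B) sequentially"
    proof (rule eventually_mono)
      fix k :: nat
      assume large: "k \<ge> 1 \<and> real k \<ge> 6 * E * (\<delta> + 1 / (2 * E)) \<and>
        (\<forall>i. real k \<ge> (E * x $ i)^2) \<and> (\<forall>i. real k \<ge> E * \<bar>x $ i\<bar>)"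
      interpret damped_slices g a C E "real k / E" k
        using a C cont E0 E2 large by unfold_locales (auto simp: m_def)
      have xc: "x \<in> cube" using large E0 by (auto simp: cube_def field_simps)
      have "damped x \<le> B"
        unfolding B_def using \<delta> near \<theta> xc large E0
        by (intro damped_bound[where \<delta>=\<delta>]) (auto simp: \<theta>_def m_def field_simps)
      moreover have "cmod (g x) * (\<Prod>i\<in>UNIV. 1 - (E * x $ i)^2 / real k) \<le> damped x"
        unfolding damped_def
      proof (intro mult_left_mono prod_mono conjI)
        fix i
        have le: "(E * x $ i)^2 / real k \<le> 1" using large by simp
        then show "0 \<le> 1 - (E * x $ i)^2 / real k" by simp
        define u where "u = (E * x $ i)^2 / real k ^ 2"
        have "u \<le> (E * x $ i)^2 / real k"
          unfolding u_def using large by (intro divide_left_mono) (auto simp: power2_eq_square)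
        then have "1 + real k * (- u) \<le> (1 + (- u)) ^ k"
          using le by (intro Bernoulli_inequality) auto
        moreover have "real k * u = (E * x $ i)^2 / real k"
          using large by (simp add: u_def power2_eq_square)
        moreover have "(x $ i)^2 / (real k / E)^2 = u"
          using large E0 by (simp add: u_def field_simps power2_eq_square)
        ultimately show "1 - (E * x $ i)^2 / real k \<le> \<omega> (x $ i)"
          unfolding \<omega>_def by simp
      qed auto
      ultimately show "cmod (g x) * (\<Prod>i\<in>UNIV. 1 - (E * x $ i)^2 / real k) \<le> B" by linarith
    qed
    show ?thesis using tendsto_upperbound[OF lim ev] by simp
  qed
  then show ?thesis by blast
qed

subsection \<open>Weighted averages of translates\<close>

text \<open>Convexity of the power is used on the open half line; at x = 0 the claim reduces to b^q
  \<le> q b^q.\<close>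

lemma powr_above_tangent:
  fixes x b q :: real
  assumes "x \<ge> 0" "b > 0" "q \<ge> 1"
  shows "x powr q \<ge> b powr q + q * b powr (q - 1) * (x - b)"
proof (cases "x = 0")
  case True
  have "b powr (q - 1) * b = b powr q" using assms by (simp add: powr_diff)
  then have e: "q * b powr (q - 1) * (x - b) = - (q * b powr q)" using True by (simp add: mult.assoc)
  have "1 * b powr q \<le> q * b powr q" using assms by (intro mult_right_mono) auto
  then show ?thesis unfolding e using True by simp
next
  case False
  have "x powr q - b powr q \<ge> (q * b powr (q - 1)) * (x - b)"
    using False assms
    by (intro convex_on_imp_above_tangent[where A="{0<..}"] powr_convex)
      (auto simp: interior_open intro!: derivative_eq_intros)
  then show ?thesis by simp
qed

text \<open>Convexity for the points x/s and y/t with weights s and t: the tangent at their mean (x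
  + y)/(s + t) is summed and its linear part cancels. Free weights are what gives Minkowski's
  inequality with its sharp constant after integration.\<close>

lemma powr_add_weighted:
  fixes x y s t q :: real
  assumes "x \<ge> 0" "y \<ge> 0" "s > 0" "t > 0" "q \<ge> 1"
  shows "(x + y) powr q \<le> (s + t) powr (q - 1) * (s * (x / s) powr q + t * (y / t) powr q)"
proof (cases "x + y = 0")
  case True
  then show ?thesis using assms by (auto intro!: mult_nonneg_nonneg)
next
  case False
  define b where "b = (x + y) / (s + t)"
  have b: "b > 0" using False assms by (simp add: b_def)
  have "s * (x / s) powr q \<ge> s * (b powr q + q * b powr (q - 1) * (x / s - b))"
    "t * (y / t) powr q \<ge> t * (b powr q + q * b powr (q - 1) * (y / t - b))"
    using assms b by (intro mult_left_mono powr_above_tangent; simp)+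
  moreover have "s * (b powr q + q * b powr (q - 1) * (x / s - b)) + t * (b powr q + q * b powr (q - 1) * (y / t - b))
      = (s + t) * b powr q + q * b powr (q - 1) * (x + y - (s + t) * b)"
    using assms by (simp add: field_simps)
  moreover have "x + y - (s + t) * b = 0" using assms by (simp add: b_def)
  ultimately have "(s + t) * b powr q \<le> s * (x / s) powr q + t * (y / t) powr q" by simp
  then have "(s + t) powr (q - 1) * ((s + t) * b powr q) \<le> (s + t) powr (q - 1) * (s * (x / s) powr q + t * (y / t) powr q)"
    by (intro mult_left_mono) auto
  moreover have "(s + t) powr (q - 1) * ((s + t) * b powr q) = (x + y) powr q"
  proof -
    have "(s + t) powr (q - 1) * ((s + t) * b powr q) = ((s + t) powr (q - 1) * (s + t)) * b powr q"
      by simp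
    also have "(s + t) powr (q - 1) * (s + t) = (s + t) powr q" using assms by (simp add: powr_diff)
    also have "(s + t) powr q * b powr q = ((s + t) * b) powr q" using assms b by (simp add: powr_mult)
    finally show ?thesis using assms by (simp add: b_def)
  qed
  ultimately show ?thesis by simp
qed

text \<open>The norm inequality with constant \<kappa>, raised to the power q. As a statement about
  extended nonnegative integrals it stays meaningful when the norms are infinite.\<close>

definition Lq_dom :: "real \<Rightarrow> real \<Rightarrow> (real^'n \<Rightarrow> real) \<Rightarrow> (real^'n \<Rightarrow> real) \<Rightarrow> bool" where
  "Lq_dom q \<kappa> F H \<longleftrightarrow> (\<integral>\<^sup>+x. ennreal (H x powr q) \<partial>lborel) \<le> ennreal (\<kappa> powr q) * (\<integral>\<^sup>+x. ennreal (F x powr q) \<partial>lborel)"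

text \<open>Boundedness makes all Bochner integrals against finite measures exist, so averages can
  be formed and compared before any integrability over the space is known.\<close>

definition bounded_nonneg :: "(real^'n \<Rightarrow> real) \<Rightarrow> bool" where
  "bounded_nonneg G \<longleftrightarrow> G \<in> borel_measurable borel \<and> (\<exists>B. \<forall>y. 0 \<le> G y \<and> G y \<le> B)"

lemma bounded_nonnegD:
  assumes "bounded_nonneg G"
  shows "G \<in> borel_measurable borel" "0 \<le> G y"
  using assms by (auto simp: bounded_nonneg_def)

lemma bounded_nonneg_add:
  assumes "bounded_nonneg G" "bounded_nonneg H"
  shows "bounded_nonneg (\<lambda>y. G y + H y)"
proof -
  obtain B B' where "\<And>y. 0 \<le> G y \<and> G y \<le> B" "\<And>y. 0 \<le> H y \<and> H y \<le> B'"
    using assms by (auto simp: bounded_nonneg_def)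
  then have "\<forall>y. 0 \<le> G y + H y \<and> G y + H y \<le> B + B'" by (meson add_mono add_nonneg_nonneg)
  then show ?thesis using assms by (auto simp: bounded_nonneg_def)
qed

lemma Lq_dom_refl: "Lq_dom q 1 F F"
  by (simp add: Lq_dom_def)

lemma Lq_dom_trans:
  assumes "Lq_dom q \<kappa> F G" "Lq_dom q \<kappa>' G H" "\<kappa> \<ge> 0" "\<kappa>' \<ge> 0"
  shows "Lq_dom q (\<kappa>' * \<kappa>) F H"
proof -
  have "(\<integral>\<^sup>+x. ennreal (H x powr q) \<partial>lborel) \<le> ennreal (\<kappa>' powr q) * (\<integral>\<^sup>+x. ennreal (G x powr q) \<partial>lborel)"
    using assms by (simp add: Lq_dom_def)
  also have "\<dots> \<le> ennreal (\<kappa>' powr q) * (ennreal (\<kappa> powr q) * (\<integral>\<^sup>+x. ennreal (F x powr q) \<partial>lborel))"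
    using assms by (intro mult_left_mono) (auto simp: Lq_dom_def)
  also have "\<dots> = ennreal ((\<kappa>' * \<kappa>) powr q) * (\<integral>\<^sup>+x. ennreal (F x powr q) \<partial>lborel)"
    using assms by (simp add: powr_mult ennreal_mult mult.assoc)
  finally show ?thesis by (simp add: Lq_dom_def)
qed

text \<open>Minkowski's inequality. With the weights s and t in \<open>powr_add_weighted\<close>,
  the two integrals are at most s and t times that of F, and the powers of s + t combine to exponent
  q.\<close>

lemma Lq_dom_add:
  assumes q: "q \<ge> 1" and G: "bounded_nonneg G" and H: "bounded_nonneg H"
    and dG: "Lq_dom q s F G" and dH: "Lq_dom q t F H" and st: "s > 0" "t > 0"
  shows "Lq_dom q (s + t) F (\<lambda>y. G y + H y)"
proof -
  note [measurable] = bounded_nonnegD(1)[OF G] bounded_nonnegD(1)[OF H]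
  define A where "A = (\<integral>\<^sup>+x. ennreal (F x powr q) \<partial>lborel)"
  have scal: "(\<integral>\<^sup>+x. ennreal (r * (K x / r) powr q) \<partial>lborel) \<le> ennreal r * A"
    if "Lq_dom q r F K" "r > 0" and [measurable]: "K \<in> borel_measurable borel" and nn: "\<And>x. K x \<ge> 0" for r K
  proof -
    have e: "r * (K x / r) powr q = r * r powr (- q) * K x powr q" for x
      using that by (simp add: powr_divide powr_minus field_simps)
    have "(\<integral>\<^sup>+x. ennreal (r * (K x / r) powr q) \<partial>lborel) = ennreal (r * r powr (- q)) * (\<integral>\<^sup>+x. ennreal (K x powr q) \<partial>lborel)"
      unfolding e using that by (subst ennreal_mult) (auto simp: nn_integral_cmult)
    also have "\<dots> \<le> ennreal (r * r powr (- q)) * (ennreal (r powr q) * A)"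
      using that by (intro mult_left_mono) (auto simp: Lq_dom_def A_def)
    also have "\<dots> = ennreal r * A"
      using that by (simp add: mult.assoc[symmetric] ennreal_mult[symmetric]) (simp add: mult.assoc powr_add[symmetric])
    finally show ?thesis .
  qed
  have "(\<integral>\<^sup>+x. ennreal ((G x + H x) powr q) \<partial>lborel)
      \<le> (\<integral>\<^sup>+x. ennreal ((s + t) powr (q - 1)) * (ennreal (s * (G x / s) powr q) + ennreal (t * (H x / t) powr q)) \<partial>lborel)"
    using powr_add_weighted[OF bounded_nonnegD(2)[OF G] bounded_nonnegD(2)[OF H] st q] st
    by (intro nn_integral_mono) (auto simp: ennreal_mult[symmetric] ennreal_plus[symmetric] intro!: ennreal_leI simp del: ennreal_plus)
  also have "\<dots> = ennreal ((s + t) powr (q - 1)) * ((\<integral>\<^sup>+x. ennreal (s * (G x / s) powr q) \<partial>lborel) + (\<integral>\<^sup>+x. ennreal (t * (H x / t) powr q) \<partial>lborel))"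
    by (simp add: nn_integral_cmult nn_integral_add)
  also have "\<dots> \<le> ennreal ((s + t) powr (q - 1)) * (ennreal s * A + ennreal t * A)"
    using st dG dH bounded_nonnegD[OF G] bounded_nonnegD[OF H] by (intro mult_left_mono add_mono scal) auto
  also have "\<dots> = ennreal ((s + t) powr (q - 1)) * (ennreal (s + t) * A)"
    using st by (simp add: distrib_right)
  also have "\<dots> = ennreal ((s + t) powr q) * A"
  proof -
    have "(s + t) powr (q - 1) * (s + t) = (s + t) powr q" using st by (simp add: powr_diff)
    then show ?thesis using st by (simp add: mult.assoc[symmetric] ennreal_mult[symmetric] del: ennreal_plus)
  qed
  finally show ?thesis by (simp add: Lq_dom_def A_def)
qed

lemma averaging_bounded_nonneg:
  fixes \<tau> :: "'k \<Rightarrow> real^'n"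
  assumes \<nu>: "finite_measure \<nu>" and [measurable]: "\<tau> \<in> borel_measurable \<nu>"
    and G: "bounded_nonneg G"
  shows "integrable \<nu> (\<lambda>k. G (y + \<tau> k))" "bounded_nonneg (\<lambda>y. \<integral>k. G (y + \<tau> k) \<partial>\<nu>)"
proof -
  interpret finite_measure \<nu> by fact
  obtain B where B: "\<And>y. 0 \<le> G y \<and> G y \<le> B" using G by (auto simp: bounded_nonneg_def)
  note [measurable] = bounded_nonnegD(1)[OF G]
  show int: "integrable \<nu> (\<lambda>k. G (y + \<tau> k))" for y
    using B by (intro integrable_const_bound[where B=B]) auto
  have "(\<lambda>y. \<integral>k. G (y + \<tau> k) \<partial>\<nu>) \<in> borel_measurable borel"
    by (intro borel_measurable_lebesgue_integral) measurable
  moreover have "(\<integral>k. G (y + \<tau> k) \<partial>\<nu>) \<le> (\<integral>k. B \<partial>\<nu>)" for y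
    using B int by (intro integral_mono) auto
  moreover have "0 \<le> (\<integral>k. G (y + \<tau> k) \<partial>\<nu>)" for y
    using B by (intro integral_nonneg_AE) auto
  ultimately show "bounded_nonneg (\<lambda>y. \<integral>k. G (y + \<tau> k) \<partial>\<nu>)"
    unfolding bounded_nonneg_def by blast
qed

lemma nn_integral_lborel_shift:
  fixes c :: "'a::euclidean_space"
  assumes [measurable]: "f \<in> borel_measurable borel"
  shows "(\<integral>\<^sup>+x. f (x + c) \<partial>lborel) = (\<integral>\<^sup>+x. f x \<partial>lborel)"
proof -
  have "(\<integral>\<^sup>+x. f x \<partial>lborel) = (\<integral>\<^sup>+x. f x \<partial>distr lborel borel ((+) c))"
    by (simp add: lborel_distr_plus)
  also have "\<dots> = (\<integral>\<^sup>+x. f (c + x) \<partial>lborel)"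
    by (subst nn_integral_distr) auto
  finally show ?thesis by (simp add: add.commute)
qed

text \<open>Minkowski's integral inequality for averages of translates: pointwise Jensen, then
  Tonelli and translation invariance. The tangent is taken at H(y)/\<kappa>, with \<kappa> only an
  upper bound for the mass; the defect contributes (q - 1) b^q (\<kappa> - \<mu>), which has the
  favourable sign.\<close>

lemma averaging_Lq_dom:
  fixes \<tau> :: "'k \<Rightarrow> real^'n"
  assumes \<nu>: "finite_measure \<nu>" and [measurable]: "\<tau> \<in> borel_measurable \<nu>"
    and G: "bounded_nonneg G" and q: "q \<ge> 1"
    and mass: "measure \<nu> (space \<nu>) \<le> \<kappa>" and \<kappa>: "\<kappa> > 0"
  shows "Lq_dom q \<kappa> G (\<lambda>y. \<integral>k. G (y + \<tau> k) \<partial>\<nu>)"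
proof -
  interpret finite_measure \<nu> by fact
  interpret pair_sigma_finite lborel \<nu> ..
  obtain B where B: "\<And>y. 0 \<le> G y \<and> G y \<le> B" using G by (auto simp: bounded_nonneg_def)
  note [measurable] = bounded_nonnegD(1)[OF G]
  note int = averaging_bounded_nonneg(1)[OF \<nu> assms(2) G]
  have intq: "integrable \<nu> (\<lambda>k. G (y + \<tau> k) powr q)" for y
    using B q by (intro integrable_const_bound[where B="B powr q"]) (auto intro!: powr_mono2)
  define H where "H = (\<lambda>y. \<integral>k. G (y + \<tau> k) \<partial>\<nu>)"
  have H0: "H y \<ge> 0" for y unfolding H_def using B by (intro integral_nonneg_AE) auto
  have jensen: "H y powr q \<le> \<kappa> powr (q - 1) * (\<integral>k. G (y + \<tau> k) powr q \<partial>\<nu>)" for y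
  proof (cases "H y = 0")
    case True
    then show ?thesis using B by (auto intro!: mult_nonneg_nonneg integral_nonneg_AE)
  next
    case False
    define b where "b = H y / \<kappa>"
    define \<mu> where "\<mu> = measure \<nu> (space \<nu>)"
    have b: "b > 0" using False H0[of y] \<kappa> by (simp add: b_def)
    have "(\<integral>k. b powr q + q * b powr (q - 1) * (G (y + \<tau> k) - b) \<partial>\<nu>) \<le> (\<integral>k. G (y + \<tau> k) powr q \<partial>\<nu>)"
      using int intq powr_above_tangent[OF _ b q] B by (intro integral_mono) auto
    also have "(\<integral>k. b powr q + q * b powr (q - 1) * (G (y + \<tau> k) - b) \<partial>\<nu>)
        = b powr q * \<mu> + q * b powr (q - 1) * (H y - b * \<mu>)"
      using int[of y] by (simp add: H_def \<mu>_def mult.commute)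
    also have "H y = \<kappa> * b" using \<kappa> by (simp add: b_def)
    also have "q * b powr (q - 1) * (\<kappa> * b - b * \<mu>) = q * (b powr (q - 1) * b) * (\<kappa> - \<mu>)"
      by (simp add: algebra_simps)
    also have "b powr (q - 1) * b = b powr q" using b by (simp add: powr_diff)
    also have "b powr q * \<mu> + q * b powr q * (\<kappa> - \<mu>) = b powr q * \<kappa> + (q - 1) * b powr q * (\<kappa> - \<mu>)"
      by (simp add: algebra_simps)
    finally have "b powr q * \<kappa> + (q - 1) * b powr q * (\<kappa> - \<mu>) \<le> (\<integral>k. G (y + \<tau> k) powr q \<partial>\<nu>)" .
    moreover have "(q - 1) * b powr q * (\<kappa> - \<mu>) \<ge> 0"
      using q mass by (simp add: \<mu>_def)
    ultimately have "b powr q * \<kappa> \<le> (\<integral>k. G (y + \<tau> k) powr q \<partial>\<nu>)" by linarith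
    then have "\<kappa> powr (q - 1) * (b powr q * \<kappa>) \<le> \<kappa> powr (q - 1) * (\<integral>k. G (y + \<tau> k) powr q \<partial>\<nu>)"
      by (intro mult_left_mono) auto
    moreover have "\<kappa> powr (q - 1) * (b powr q * \<kappa>) = H y powr q"
      using \<kappa> b H0[of y] by (simp add: b_def powr_divide powr_diff)
    ultimately show ?thesis by simp
  qed
  have "(\<integral>\<^sup>+y. ennreal (H y powr q) \<partial>lborel)
      \<le> (\<integral>\<^sup>+y. ennreal (\<kappa> powr (q - 1)) * (\<integral>\<^sup>+k. ennreal (G (y + \<tau> k) powr q) \<partial>\<nu>) \<partial>lborel)"
  proof (rule nn_integral_mono)
    fix y
    have "(\<integral>\<^sup>+k. ennreal (G (y + \<tau> k) powr q) \<partial>\<nu>) = ennreal (\<integral>k. G (y + \<tau> k) powr q \<partial>\<nu>)"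
      using intq by (intro nn_integral_eq_integral) auto
    then show "ennreal (H y powr q) \<le> ennreal (\<kappa> powr (q - 1)) * (\<integral>\<^sup>+k. ennreal (G (y + \<tau> k) powr q) \<partial>\<nu>)"
      using jensen[of y] by (simp add: ennreal_mult'[symmetric] ennreal_leI)
  qed
  also have "\<dots> = ennreal (\<kappa> powr (q - 1)) * (\<integral>\<^sup>+y. (\<integral>\<^sup>+k. ennreal (G (y + \<tau> k) powr q) \<partial>\<nu>) \<partial>lborel)"
    by (intro nn_integral_cmult) measurable
  also have "(\<integral>\<^sup>+y. (\<integral>\<^sup>+k. ennreal (G (y + \<tau> k) powr q) \<partial>\<nu>) \<partial>lborel)
      = (\<integral>\<^sup>+k. (\<integral>\<^sup>+y. ennreal (G (y + \<tau> k) powr q) \<partial>lborel) \<partial>\<nu>)"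
    by (intro Fubini'[symmetric]) measurable
  also have "\<dots> = (\<integral>\<^sup>+k. (\<integral>\<^sup>+y. ennreal (G y powr q) \<partial>lborel) \<partial>\<nu>)"
    by (intro nn_integral_cong nn_integral_lborel_shift[of "\<lambda>y. ennreal (G y powr q)"]) measurable
  also have "\<dots> = ennreal (measure \<nu> (space \<nu>)) * (\<integral>\<^sup>+y. ennreal (G y powr q) \<partial>lborel)"
    by (simp add: emeasure_eq_measure mult.commute)
  also have "ennreal (\<kappa> powr (q - 1)) * (ennreal (measure \<nu> (space \<nu>)) * (\<integral>\<^sup>+y. ennreal (G y powr q) \<partial>lborel))
      \<le> ennreal (\<kappa> powr (q - 1)) * (ennreal \<kappa> * (\<integral>\<^sup>+y. ennreal (G y powr q) \<partial>lborel))"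
    using mass by (intro mult_left_mono mult_right_mono ennreal_leI) auto
  also have "\<dots> = ennreal (\<kappa> powr q) * (\<integral>\<^sup>+y. ennreal (G y powr q) \<partial>lborel)"
    using \<kappa> by (simp add: mult.assoc[symmetric] ennreal_mult'[symmetric] powr_diff)
  finally show ?thesis unfolding Lq_dom_def H_def .
qed

subsection \<open>Oscillation over cubes\<close>

text \<open>Writing the Riesz series as an integral lets the same averaging lemmas serve both for
  sums over nodes and for integrals over a segment.\<close>

definition riesz_measure :: "nat measure" where
  "riesz_measure = density (count_space UNIV) (\<lambda>n. ennreal (riesz_weight n))"

lemma measurable_riesz_measure [measurable]: "f \<in> borel_measurable riesz_measure"
  by (simp add: riesz_measure_def)

lemma emeasure_riesz_measure: "emeasure riesz_measure (space riesz_measure) = ennreal (1/2)"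
  using suminf_ennreal_eq[OF riesz_weight_nonneg riesz_weight_sums]
  by (simp add: riesz_measure_def emeasure_density nn_integral_count_space_nat)

lemma finite_riesz_measure: "finite_measure riesz_measure"
  by (rule finite_measureI) (simp add: emeasure_riesz_measure)

lemma measure_riesz_measure: "measure riesz_measure (space riesz_measure) = 1/2"
  unfolding measure_def emeasure_riesz_measure by (rule enn2real_ennreal) simp

lemma integral_riesz_measure:
  fixes K :: "nat \<Rightarrow> real"
  assumes "integrable riesz_measure K"
  shows "(\<integral>n. K n \<partial>riesz_measure) = (\<Sum>n. riesz_weight n * K n)"
proof -
  have "integrable (count_space UNIV) (\<lambda>n. riesz_weight n *\<^sub>R K n)"
    using assms unfolding riesz_measure_def by (subst (asm) integrable_density) (auto simp: riesz_weight_nonneg)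
  then show ?thesis
    unfolding riesz_measure_def by (subst integral_density) (auto simp: riesz_weight_nonneg integral_count_space_nat)
qed

definition riesz_average :: "real \<Rightarrow> 'n \<Rightarrow> (real^'n \<Rightarrow> real) \<Rightarrow> real^'n \<Rightarrow> real" where
  "riesz_average a j G y =
     (\<integral>n. G (y + (riesz_node n / a) *\<^sub>R axis j 1) \<partial>riesz_measure)
   + (\<integral>n. G (y + (- riesz_node n / a) *\<^sub>R axis j 1) \<partial>riesz_measure)"

lemma riesz_average_bounded_nonneg:
  assumes "bounded_nonneg G"
  shows "bounded_nonneg (riesz_average a j G)"
  unfolding riesz_average_def[abs_def]
  by (intro bounded_nonneg_add averaging_bounded_nonneg finite_riesz_measure assms) measurable

lemma riesz_average_Lq_dom:
  assumes "bounded_nonneg G" "q \<ge> 1"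
  shows "Lq_dom q 1 G (riesz_average a j G)"
proof -
  have "Lq_dom q (1/2 + 1/2) G (riesz_average a j G)"
    unfolding riesz_average_def[abs_def]
    by (intro Lq_dom_add averaging_bounded_nonneg averaging_Lq_dom finite_riesz_measure assms)
      (auto simp: measure_riesz_measure)
  then show ?thesis by simp
qed

lemma averaging_mono:
  fixes \<tau> :: "'k \<Rightarrow> real^'n"
  assumes "finite_measure \<nu>" "\<tau> \<in> borel_measurable \<nu>" "bounded_nonneg G" "bounded_nonneg G'" "\<And>y. G y \<le> G' y"
  shows "(\<integral>k. G (y + \<tau> k) \<partial>\<nu>) \<le> (\<integral>k. G' (y + \<tau> k) \<partial>\<nu>)"
  using assms by (intro integral_mono averaging_bounded_nonneg)

lemma riesz_average_mono:
  assumes "bounded_nonneg G" "bounded_nonneg G'" "\<And>y. G y \<le> G' y"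
  shows "riesz_average a j G y \<le> riesz_average a j G' y"
  unfolding riesz_average_def
  by (intro add_mono averaging_mono finite_riesz_measure assms) measurable

definition interval_measure :: "real \<Rightarrow> real measure" where
  "interval_measure h = density lborel (\<lambda>s. ennreal (indicator {-h..h} s))"

lemma interval_measure_props:
  assumes "h \<ge> 0"
  shows "finite_measure (interval_measure h)"
    "measure (interval_measure h) (space (interval_measure h)) = 2 * h"
proof -
  have e: "emeasure (interval_measure h) (space (interval_measure h)) = ennreal (2 * h)"
    using assms by (simp add: interval_measure_def emeasure_density ennreal_indicator)
  show "finite_measure (interval_measure h)" by (rule finite_measureI) (simp add: e)
  show "measure (interval_measure h) (space (interval_measure h)) = 2 * h"
    using assms by (simp add: measure_def e)
qed

lemma measurable_interval_measure [measurable_cong]: "sets (interval_measure h) = sets borel"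
  by (simp add: interval_measure_def)

text \<open>For G = |g| the integrand majorizes the modulus of the j-th partial derivative, by Riesz
  interpolation, so the integral over the segment majorizes every change of g along axis j up to
  distance h.\<close>

definition oscillation_operator :: "real \<Rightarrow> real \<Rightarrow> 'n \<Rightarrow> (real^'n \<Rightarrow> real) \<Rightarrow> real^'n \<Rightarrow> real" where
  "oscillation_operator a h j G y =
     (\<integral>s. a * riesz_average a j G (y + s *\<^sub>R axis j 1) \<partial>interval_measure h)"

lemma bounded_nonneg_scale:
  assumes "bounded_nonneg G" "a \<ge> 0"
  shows "bounded_nonneg (\<lambda>y. a * G y)"
proof -
  obtain B where "\<And>y. 0 \<le> G y \<and> G y \<le> B" using assms by (auto simp: bounded_nonneg_def)
  then have "\<forall>y. 0 \<le> a * G y \<and> a * G y \<le> a * B" using assms(2) by (auto intro: mult_left_mono)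
  moreover have "(\<lambda>y. a * G y) \<in> borel_measurable borel"
    using bounded_nonnegD(1)[OF assms(1)] by measurable
  ultimately show ?thesis unfolding bounded_nonneg_def by blast
qed

lemma Lq_dom_scale:
  assumes "bounded_nonneg G" "a \<ge> 0"
  shows "Lq_dom q a G (\<lambda>y. a * G y)"
proof -
  note [measurable] = bounded_nonnegD(1)[OF assms(1)]
  have "(\<integral>\<^sup>+y. ennreal ((a * G y) powr q) \<partial>lborel) = (\<integral>\<^sup>+y. ennreal (a powr q) * ennreal (G y powr q) \<partial>lborel)"
    using assms bounded_nonnegD(2)[OF assms(1)] by (simp add: powr_mult ennreal_mult')
  then show ?thesis unfolding Lq_dom_def by (simp add: nn_integral_cmult)
qed

lemma oscillation_operator_bounded_nonneg:
  assumes "bounded_nonneg G" "a \<ge> 0" "h \<ge> 0"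
  shows "bounded_nonneg (oscillation_operator a h j G)"
  unfolding oscillation_operator_def[abs_def]
  by (rule averaging_bounded_nonneg(2)[OF interval_measure_props(1)[OF assms(3)] _
        bounded_nonneg_scale[OF riesz_average_bounded_nonneg[OF assms(1)] assms(2)]]) measurable

lemma oscillation_operator_Lq_dom:
  assumes "bounded_nonneg G" "a > 0" "h > 0" "q \<ge> 1"
  shows "Lq_dom q (2 * h * a) G (oscillation_operator a h j G)"
proof -
  have "Lq_dom q (a * 1) G (\<lambda>y. a * riesz_average a j G y)"
    using assms by (intro Lq_dom_trans[OF riesz_average_Lq_dom Lq_dom_scale] riesz_average_bounded_nonneg) auto
  moreover have "Lq_dom q (2 * h) (\<lambda>y. a * riesz_average a j G y) (oscillation_operator a h j G)"
    unfolding oscillation_operator_def[abs_def]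
  proof (rule averaging_Lq_dom)
    show "finite_measure (interval_measure h)"
      "measure (interval_measure h) (space (interval_measure h)) \<le> 2 * h"
      using assms interval_measure_props[of h] by auto
    show "bounded_nonneg (\<lambda>y. a * riesz_average a j G y)"
      using assms by (intro bounded_nonneg_scale riesz_average_bounded_nonneg) auto
  qed (use assms in auto)
  ultimately have "Lq_dom q (2 * h * (a * 1)) G (oscillation_operator a h j G)"
    using assms by (intro Lq_dom_trans[of q "a * 1" G "\<lambda>y. a * riesz_average a j G y"]) auto
  then show ?thesis by simp
qed

lemma oscillation_operator_mono:
  assumes "bounded_nonneg G" "bounded_nonneg G'" "\<And>y. G y \<le> G' y" "a \<ge> 0" "h \<ge> 0"
  shows "oscillation_operator a h j G y \<le> oscillation_operator a h j G' y"
  unfolding oscillation_operator_def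
  by (rule averaging_mono[OF interval_measure_props(1)[OF assms(5)] _
        bounded_nonneg_scale[OF riesz_average_bounded_nonneg[OF assms(1)] assms(4)]
        bounded_nonneg_scale[OF riesz_average_bounded_nonneg[OF assms(2)] assms(4)]
        mult_left_mono[OF riesz_average_mono[OF assms(1-3)] assms(4)]]) measurable

lemma bounded_nonneg_cmod:
  assumes "slice_exp_type a g" "\<And>x. cmod (g x) \<le> M"
  shows "bounded_nonneg (\<lambda>x. cmod (g x))"
proof -
  have "continuous_on UNIV (\<lambda>x. cmod (g x))"
    using assms by (auto simp: slice_exp_type_def intro: continuous_intros)
  then show ?thesis using assms(2) unfolding bounded_nonneg_def
    by (auto intro: borel_measurable_continuous_onI)
qed

text \<open>The fundamental theorem of calculus on the segment from 0 to u, followed by enlarging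
  the segment to [-h, h]. The majorant is nonnegative, so this only increases the integral, and it
  removes the dependence on u.\<close>

lemma slice_oscillation:
  fixes g :: "real^'n \<Rightarrow> complex"
  assumes g: "slice_exp_type a g" and a: "a > 0" and bd: "\<And>x. cmod (g x) \<le> M" and u: "\<bar>u\<bar> \<le> h"
  shows "cmod (g (y + u *\<^sub>R axis j 1) - g y) \<le> oscillation_operator a h j (\<lambda>x. cmod (g x)) y"
proof -
  have h: "h \<ge> 0" using u by linarith
  obtain \<psi> K where \<psi>: "\<psi> holomorphic_on UNIV" "\<And>t. \<psi> (of_real t) = g (y + t *\<^sub>R axis j 1)"
    "\<And>z. cmod (\<psi> z) \<le> K * exp (a * \<bar>Im z\<bar>)" using slice_bounded_obtain[OF g a bd] by blast
  have nn: "bounded_nonneg (\<lambda>x. cmod (g x))" using bounded_nonneg_cmod[OF g bd] .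
  define A where "A = (\<lambda>s. a * riesz_average a j (\<lambda>x. cmod (g x)) (y + s *\<^sub>R axis j 1))"
  have dA: "cmod (deriv \<psi> (of_real s)) \<le> A s" for s
  proof -
    have i: "(\<integral>n. cmod (g (y + s *\<^sub>R axis j 1 + t n *\<^sub>R axis j 1)) \<partial>riesz_measure)
        = (\<Sum>n. riesz_weight n * cmod (\<psi> (of_real (s + t n))))" for t
      by (subst integral_riesz_measure)
        (auto intro!: averaging_bounded_nonneg(1)[OF finite_riesz_measure _ nn] simp: \<psi>(2) scaleR_add_left add.assoc simp del: of_real_add)
    have "A s = a * ((\<Sum>n. riesz_weight n * cmod (\<psi> (of_real (s + riesz_node n / a))))
         + (\<Sum>n. riesz_weight n * cmod (\<psi> (of_real (s + - riesz_node n / a)))))"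
      unfolding A_def riesz_average_def i ..
    then show ?thesis using riesz_derivative_bound(3)[OF \<psi>(1,3) a, of s] by simp
  qed
  have nnA: "bounded_nonneg (\<lambda>x. a * riesz_average a j (\<lambda>x. cmod (g x)) x)"
    using a nn by (intro bounded_nonneg_scale riesz_average_bounded_nonneg) auto
  have [measurable]: "A \<in> borel_measurable borel"
    unfolding A_def using bounded_nonnegD(1)[OF nnA] by measurable
  have A0: "A s \<ge> 0" for s unfolding A_def using bounded_nonnegD(2)[OF nnA] by simp
  have "integrable (interval_measure h) A"
    unfolding A_def
    by (rule averaging_bounded_nonneg(1)[OF interval_measure_props(1)[OF h] _ nnA]) measurable
  then have setA: "set_integrable lborel {-h..h} A"
    unfolding interval_measure_def set_integrable_def by (subst (asm) integrable_density) auto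
  have "oscillation_operator a h j (\<lambda>x. cmod (g x)) y = (\<integral>s. A s \<partial>interval_measure h)"
    by (simp add: oscillation_operator_def A_def)
  also have "\<dots> = (LINT s:{-h..h}|lborel. A s)"
    unfolding interval_measure_def set_lebesgue_integral_def by (subst integral_density) auto
  also have "\<dots> = integral {-h..h} A" using set_borel_integral_eq_integral(2)[OF setA] .
  finally have op: "oscillation_operator a h j (\<lambda>x. cmod (g x)) y = integral {-h..h} A" .
  have intA: "A integrable_on {-h..h}" using set_borel_integral_eq_integral(1)[OF setA] .
  define lo where "lo = min 0 u"
  define hi where "hi = max 0 u"
  have sub: "{lo..hi} \<subseteq> {-h..h}" using u h by (auto simp: lo_def hi_def)
  have intA': "A integrable_on {lo..hi}" using intA sub by (rule integrable_on_subinterval)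
  have ftc: "((\<lambda>s. deriv \<psi> (of_real s)) has_integral (\<psi> (of_real hi) - \<psi> (of_real lo))) {lo..hi}"
  proof (rule fundamental_theorem_of_calculus)
    show "lo \<le> hi" by (simp add: lo_def hi_def)
    fix s
    have "(\<psi> has_field_derivative deriv \<psi> (of_real s)) (at (of_real s))"
      using \<psi>(1) by (simp add: holomorphic_derivI)
    from has_vector_derivative_real_field[OF this]
    show "((\<lambda>s. \<psi> (of_real s)) has_vector_derivative deriv \<psi> (of_real s)) (at s within {lo..hi})"
      by (simp add: o_def)
  qed
  have "cmod (g (y + u *\<^sub>R axis j 1) - g y) = cmod (\<psi> (of_real hi) - \<psi> (of_real lo))"
    using \<psi>(2)[of 0] \<psi>(2)[of u] by (auto simp: lo_def hi_def min_def max_def norm_minus_commute)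
  also have "\<dots> = cmod (integral {lo..hi} (\<lambda>s. deriv \<psi> (of_real s)))"
    using integral_unique[OF ftc] by simp
  also have "\<dots> \<le> integral {lo..hi} A"
    using ftc dA intA' by (intro Henstock_Kurzweil_Integration.integral_norm_bound_integral) (auto simp: has_integral_integrable)
  also have "\<dots> \<le> integral {-h..h} A"
    using sub intA' intA A0 by (intro integral_subset_le) auto
  finally show ?thesis unfolding op .
qed

lemma slice_exp_type_translate:
  fixes g :: "real^'n \<Rightarrow> complex"
  assumes g: "slice_exp_type a g" and a: "a \<ge> 0"
  shows "slice_exp_type a (\<lambda>y. g (y + v))"
proof -
  obtain C where C: "C > 0" "\<And>j x. \<exists>\<phi>. \<phi> holomorphic_on UNIV \<and>
     (\<forall>t. \<phi> (of_real t) = g (x + t *\<^sub>R axis j 1)) \<and>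
     (\<forall>z. cmod (\<phi> z) \<le> C * exp (a * ((\<Sum>i\<in>UNIV. \<bar>x $ i\<bar>) + cmod z)))"
    using slice_exp_type_obtain[OF g] by blast
  have "\<exists>\<phi>. \<phi> holomorphic_on UNIV \<and>
     (\<forall>t. \<phi> (of_real t) = g (x + t *\<^sub>R axis j 1 + v)) \<and>
     (\<forall>z. cmod (\<phi> z) \<le> (C * exp (a * (\<Sum>i\<in>UNIV. \<bar>v $ i\<bar>))) * exp (a * ((\<Sum>i\<in>UNIV. \<bar>x $ i\<bar>) + cmod z)))" for j x
  proof -
    obtain \<phi> where \<phi>: "\<phi> holomorphic_on UNIV" "\<And>t. \<phi> (of_real t) = g (x + v + t *\<^sub>R axis j 1)"
      "\<And>z. cmod (\<phi> z) \<le> C * exp (a * ((\<Sum>i\<in>UNIV. \<bar>(x + v) $ i\<bar>) + cmod z))"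
      using C(2)[of "x + v" j] by blast
    have "(\<Sum>i\<in>UNIV. \<bar>(x + v) $ i\<bar>) \<le> (\<Sum>i\<in>UNIV. \<bar>x $ i\<bar>) + (\<Sum>i\<in>UNIV. \<bar>v $ i\<bar>)"
      unfolding sum.distrib[symmetric] by (intro sum_mono) auto
    then have "C * exp (a * ((\<Sum>i\<in>UNIV. \<bar>(x + v) $ i\<bar>) + cmod z))
        \<le> C * exp (a * ((\<Sum>i\<in>UNIV. \<bar>x $ i\<bar>) + (\<Sum>i\<in>UNIV. \<bar>v $ i\<bar>) + cmod z))" for z
      using a C(1) by (intro mult_left_mono) (auto intro!: mult_left_mono)
    then have "cmod (\<phi> z) \<le> (C * exp (a * (\<Sum>i\<in>UNIV. \<bar>v $ i\<bar>))) * exp (a * ((\<Sum>i\<in>UNIV. \<bar>x $ i\<bar>) + cmod z))" for z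
      using order_trans[OF \<phi>(3)[of z]] by (simp add: distrib_left exp_add mult_ac)
    moreover have "\<phi> (of_real t) = g (x + t *\<^sub>R axis j 1 + v)" for t
      using \<phi>(2)[of t] by (simp add: add_ac)
    ultimately show ?thesis using \<phi>(1) by blast
  qed
  moreover have "continuous_on UNIV (\<lambda>y. g (y + v))"
    using g by (auto simp: slice_exp_type_def intro!: continuous_on_compose2[of UNIV g] continuous_intros)
  ultimately show ?thesis unfolding slice_exp_type_def by blast
qed

text \<open>Induction on the set S of coordinates allowed to move. A step along axis j starts from y
  + v, where v moves the coordinates of S; there |g| is at most G = |g| + H, whatever v is. Hence
  the operator applied to G at y serves for all v, and 1 + \<kappa> is multiplied by 1 + b.\<close>

lemma oscillation_majorant:
  fixes g :: "real^'n \<Rightarrow> complex"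
  assumes g: "slice_exp_type a g" and a: "a > 0" and h: "h > 0" and q: "q \<ge> 1"
    and bd: "\<And>x. cmod (g x) \<le> M"
  obtains H where "bounded_nonneg H"
    "\<And>y u. (\<And>i. \<bar>u $ i\<bar> \<le> h) \<Longrightarrow> cmod (g (y + u) - g y) \<le> H y"
    "Lq_dom q ((1 + 2 * h * a) ^ (CARD('n) + 1) - 1) (\<lambda>y. cmod (g y)) H"
proof -
  define b where "b = 2 * h * a"
  have b: "b > 0" using a h by (simp add: b_def)
  note nn = bounded_nonneg_cmod[OF g bd]
  have "\<exists>H. bounded_nonneg H \<and>
      (\<forall>y u. (\<forall>i. \<bar>u $ i\<bar> \<le> h) \<longrightarrow> (\<forall>i. i \<notin> S \<longrightarrow> u $ i = 0) \<longrightarrow> cmod (g (y + u) - g y) \<le> H y) \<and>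
      Lq_dom q ((1 + b) ^ (card S + 1) - 1) (\<lambda>y. cmod (g y)) H" if "finite S" for S
    using that
  proof induction
    case empty
    have "bounded_nonneg (\<lambda>y::real^'n. 0)" by (auto simp: bounded_nonneg_def)
    moreover have "cmod (g (y + u) - g y) \<le> 0" if "\<forall>i. i \<notin> {} \<longrightarrow> u $ i = 0" for y u :: "real^'n"
    proof -
      have "u = 0" using that by (simp add: vec_eq_iff)
      then show ?thesis by simp
    qed
    moreover have "Lq_dom q ((1 + b) ^ (card {} + 1) - 1) (\<lambda>y. cmod (g y)) (\<lambda>_. 0)"
      by (simp add: Lq_dom_def)
    ultimately show ?case by (intro exI[of _ "\<lambda>_. 0"]) blast
  next
    case (insert j S)
    obtain H where H: "bounded_nonneg H"
      "\<And>y u. (\<forall>i. \<bar>u $ i\<bar> \<le> h) \<Longrightarrow> (\<forall>i. i \<notin> S \<longrightarrow> u $ i = 0) \<Longrightarrow> cmod (g (y + u) - g y) \<le> H y"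
      "Lq_dom q ((1 + b) ^ (card S + 1) - 1) (\<lambda>y. cmod (g y)) H" using insert.IH by blast
    define \<kappa> where "\<kappa> = (1 + b) ^ (card S + 1) - 1"
    \<comment> \<open>The exponent is card S + 1 instead of card S so that \<kappa> is positive even
      for empty S, as the weights in \<open>Lq_dom_add\<close> must be.\<close>
    have \<kappa>: "\<kappa> > 0" unfolding \<kappa>_def using b one_less_power[of "1 + b" "card S + 1"] by simp
    define G where "G = (\<lambda>y. cmod (g y) + H y)"
    have G: "bounded_nonneg G" unfolding G_def by (intro bounded_nonneg_add nn H(1))
    have dG: "Lq_dom q (1 + \<kappa>) (\<lambda>y. cmod (g y)) G"
      unfolding G_def using H(3) \<kappa> by (intro Lq_dom_add q nn H(1) Lq_dom_refl) (auto simp: \<kappa>_def)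
    define H' where "H' = (\<lambda>y. H y + oscillation_operator a h j G y)"
    have D: "bounded_nonneg (oscillation_operator a h j G)"
      using a h by (intro oscillation_operator_bounded_nonneg G) auto
    have "Lq_dom q (b * (1 + \<kappa>)) (\<lambda>y. cmod (g y)) (oscillation_operator a h j G)"
      using oscillation_operator_Lq_dom[OF G a h q, of j] b \<kappa> unfolding b_def
      by (intro Lq_dom_trans[OF dG]) auto
    then have "Lq_dom q (\<kappa> + b * (1 + \<kappa>)) (\<lambda>y. cmod (g y)) H'"
      unfolding H'_def using H \<kappa> b D by (intro Lq_dom_add q) (auto simp: \<kappa>_def)
    moreover have "\<kappa> + b * (1 + \<kappa>) = (1 + b) ^ (card (insert j S) + 1) - 1"
      using insert.hyps by (simp add: \<kappa>_def algebra_simps)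
    moreover have "bounded_nonneg H'" unfolding H'_def by (intro bounded_nonneg_add H(1) D)
    moreover have "cmod (g (y + u) - g y) \<le> H' y"
      if u: "\<forall>i. \<bar>u $ i\<bar> \<le> h" "\<forall>i. i \<notin> insert j S \<longrightarrow> u $ i = 0" for y u
    proof -
      define v where "v = u - (u $ j) *\<^sub>R axis j 1"
      have vi: "v $ i = (if i = j then 0 else u $ i)" for i by (simp add: v_def axis_def)
      have v: "\<forall>i. \<bar>v $ i\<bar> \<le> h" "\<forall>i. i \<notin> S \<longrightarrow> v $ i = 0" using u h by (auto simp: vi)
      have uv: "y + u = y + (u $ j) *\<^sub>R axis j 1 + v" by (simp add: v_def)
      note gv = slice_exp_type_translate[OF g, of v]
      have gvn: "bounded_nonneg (\<lambda>x. cmod (g (x + v)))"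
        using bounded_nonneg_cmod[OF gv, of M] a bd by simp
      have "cmod (g (y + (u $ j) *\<^sub>R axis j 1 + v) - g (y + v)) \<le> oscillation_operator a h j (\<lambda>x. cmod (g (x + v))) y"
        using slice_oscillation[OF gv a, of M "u $ j" h y j] bd u(1) a by simp
      also have "\<dots> \<le> oscillation_operator a h j G y"
      proof (rule oscillation_operator_mono[OF gvn G])
        fix x
        show "cmod (g (x + v)) \<le> G x"
          using H(2)[OF v, of x] norm_triangle_sub[of "g (x + v)" "g x"] by (simp add: G_def)
      qed (use a h in auto)
      finally have "cmod (g (y + u) - g (y + v)) \<le> oscillation_operator a h j G y" unfolding uv .
      moreover have "cmod (g (y + v) - g y) \<le> H y" using H(2)[OF v] .
      moreover have "cmod (g (y + u) - g y) \<le> cmod (g (y + u) - g (y + v)) + cmod (g (y + v) - g y)"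
        using norm_triangle_ineq[of "g (y + u) - g (y + v)" "g (y + v) - g y"] by simp
      ultimately show ?thesis by (simp add: H'_def)
    qed
    ultimately show ?case by (intro exI[of _ H']) auto
  qed
  from this[of UNIV] obtain H where "bounded_nonneg H"
    "\<And>y u. (\<forall>i. \<bar>u $ i\<bar> \<le> h) \<Longrightarrow> cmod (g (y + u) - g y) \<le> H y"
    "Lq_dom q ((1 + b) ^ (CARD('n) + 1) - 1) (\<lambda>y. cmod (g y)) H" by auto
  then show ?thesis using that unfolding b_def by blast
qed

subsection \<open>Sampling on nets\<close>

lemma supn_less_iff: "supn x < h \<longleftrightarrow> (\<forall>i. \<bar>x $ i\<bar> < h)"
  unfolding supn_def by (subst Max_less_iff) auto

lemma open_cube_iff: "y \<in> open_cube h x \<longleftrightarrow> (\<forall>i. \<bar>y $ i - x $ i\<bar> < h)"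
  by (simp add: open_cube_def supn_less_iff)

lemma open_cube_eq_box: "open_cube h x = box (x - (\<chi> i. h)) (x + (\<chi> i. h))"
proof -
  have "\<bar>y $ i - x $ i\<bar> < h \<longleftrightarrow> x $ i - h < y $ i \<and> y $ i < x $ i + h" for y i by arith
  then show ?thesis by (auto simp: open_cube_iff mem_box_cart)
qed

lemma open_cube_measurable [measurable]: "open_cube h x \<in> sets borel"
  by (simp add: open_cube_eq_box)

lemma emeasure_open_cube:
  fixes x :: "real^'n"
  assumes "h \<ge> 0"
  shows "emeasure lborel (open_cube h x) = ennreal ((2 * h) ^ CARD('n))"
proof -
  have i: "(\<chi> i. h) \<bullet> b = h" if "b \<in> Basis" for b :: "real^'n"
    using axis_index[OF that] by (metis inner_axis inner_real_def mult.right_neutral vec_lambda_beta)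
  have "emeasure lborel (open_cube h x) = (\<Prod>b\<in>(Basis::(real^'n) set). ((x + (\<chi> i. h)) - (x - (\<chi> i. h))) \<bullet> b)"
    unfolding open_cube_eq_box using assms i by (intro emeasure_lborel_box) (auto simp: inner_add_left inner_diff_left)
  also have "(\<Prod>b\<in>(Basis::(real^'n) set). ((x + (\<chi> i. h)) - (x - (\<chi> i. h))) \<bullet> b) = (\<Prod>b\<in>(Basis::(real^'n) set). 2 * h)"
  proof (rule prod.cong[OF refl])
    fix b :: "real^'n" assume "b \<in> Basis"
    then show "((x + (\<chi> i. h)) - (x - (\<chi> i. h))) \<bullet> b = 2 * h"
      using i by (simp only: inner_add_left inner_diff_left)
  qed
  also have "\<dots> = (2 * h) ^ CARD('n)" by simp
  finally show ?thesis .
qed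

lemma eroot_mono:
  assumes "A \<le> B" "q > 0"
  shows "eroot q A \<le> eroot q B"
proof (cases "B = \<infinity>")
  case False
  then have B: "B < \<infinity>" by (simp add: less_top)
  then have A: "A < \<infinity>" using assms(1) by (rule le_less_trans[rotated])
  have "enn2real A \<le> enn2real B" using assms B by (intro enn2real_mono) auto
  then show ?thesis using A B assms by (auto simp: eroot_def intro!: ennreal_leI powr_mono2)
qed (simp add: eroot_def)

lemma eroot_scale:
  assumes "c > 0" "q > 0"
  shows "eroot q (ennreal (c powr q) * I) = ennreal c * eroot q I"
proof (cases "I = \<infinity>")
  case True
  then show ?thesis using assms by (simp add: eroot_def ennreal_mult_top)
next
  case False
  then obtain r where r: "I = ennreal r" "r \<ge> 0" by (cases I) auto
  have "(c powr q * r) powr (1 / q) = c * r powr (1 / q)"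
    using assms r by (simp add: powr_mult powr_powr)
  then show ?thesis using assms r by (simp add: eroot_def ennreal_mult[symmetric])
qed

lemma slice_exp_type_mono:
  fixes g :: "real^'n \<Rightarrow> complex"
  assumes g: "slice_exp_type a g" and "a \<le> b"
  shows "slice_exp_type b g"
proof -
  obtain C where C: "C > 0" "\<And>j x. \<exists>\<phi>. \<phi> holomorphic_on UNIV \<and>
     (\<forall>t. \<phi> (of_real t) = g (x + t *\<^sub>R axis j 1)) \<and>
     (\<forall>z. cmod (\<phi> z) \<le> C * exp (a * ((\<Sum>i\<in>UNIV. \<bar>x $ i\<bar>) + cmod z)))"
    using slice_exp_type_obtain[OF g] by blast
  have "C * exp (a * ((\<Sum>i\<in>UNIV. \<bar>x $ i\<bar>) + cmod z)) \<le> C * exp (b * ((\<Sum>i\<in>UNIV. \<bar>x $ i\<bar>) + cmod z))" for x :: "real^'n" and z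
    using assms C(1) by (auto intro!: mult_left_mono mult_right_mono add_nonneg_nonneg sum_nonneg)
  then have "\<exists>\<phi>. \<phi> holomorphic_on UNIV \<and>
     (\<forall>t. \<phi> (of_real t) = g (x + t *\<^sub>R axis j 1)) \<and>
     (\<forall>z. cmod (\<phi> z) \<le> C * exp (b * ((\<Sum>i\<in>UNIV. \<bar>x $ i\<bar>) + cmod z)))" for j x
    using C(2)[of x j] by (meson order_trans)
  then show ?thesis using g unfolding slice_exp_type_def by blast
qed

text \<open>Boundedness comes first, from the samples and the smallness of \<delta>\<sigma>. Then
  the Lipschitz bound compares each value with the nearby sample, and the supremum M, now finite,
  satisfies M \<le> s + a M m \<delta> for every a > \<sigma>.\<close>

lemma covering_sup_bound:
  fixes f :: "complex^'n \<Rightarrow> complex"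
  assumes \<sigma>: "\<sigma> > 0" and \<delta>: "\<delta> > 0" and cov: "covering_net \<delta> \<Omega>"
    and small: "11 * real CARD('n) powr (3/2) * \<delta> * \<sigma> \<le> 1"
    and f: "f \<in> exp_type_class \<sigma>" and bdd: "bdd_above ((\<lambda>X. cmod (restr f X)) ` \<Omega>)"
  shows "bounded (range (restr f))"
    and "(SUP X\<in>\<Omega>. cmod (restr f X)) \<ge> (1 - real CARD('n) * \<delta> * \<sigma>) * (SUP x. cmod (restr f x))"
proof -
  define m where "m = real CARD('n)"
  have m1: "m \<ge> 1" using zero_less_card_finite[where 'a='n] by (simp add: m_def)
  define g where "g = restr f"
  define s where "s = (SUP X\<in>\<Omega>. cmod (g X))"
  have gX: "cmod (g X) \<le> s" if "X \<in> \<Omega>" for X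
    unfolding s_def using bdd that by (intro cSUP_upper) (auto simp: g_def)
  have net: "\<exists>X\<in>\<Omega>. \<forall>i. \<bar>x $ i - X $ i\<bar> < \<delta>" for x
    using cov by (auto simp: covering_net_def supn_less_iff)
  have "\<exists>B. \<forall>x. cmod (g x) \<le> B"
  proof (rule slice_exp_type_bounded[where a="3/2 * \<sigma>" and \<delta>=\<delta> and M=s])
    show "slice_exp_type (3/2 * \<sigma>) g" unfolding g_def using f \<sigma> by (intro slice_exp_type_restr[where \<sigma>=\<sigma>]) auto
    show "\<exists>X. (\<forall>i. \<bar>x $ i - X $ i\<bar> \<le> \<delta>) \<and> cmod (g X) \<le> s" for x
      using net[of x] gX less_imp_le by meson
    have s1: "1 \<le> sqrt m" using m1 by simp
    have "m powr (1 + 1/2) = m powr 1 * m powr (1/2)" by (rule powr_add)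
    also have "\<dots> = m * sqrt m" using m1 by (simp add: powr_half_sqrt)
    finally have p: "m powr (3/2) = m * sqrt m" by simp
    \<comment> \<open>With e \<le> 3 and 1 + sqrt m \<le> 2 sqrt m the required product is at most 9
      m^(3/2) \<delta>\<sigma>, and the hypothesis makes this at most 9/11.\<close>
    have "m * \<delta> * (exp 1 * (3/2 * \<sigma>) * (1 + sqrt m)) \<le> m * \<delta> * (3 * (3/2 * \<sigma>) * (sqrt m + sqrt m))"
      using m1 \<delta> \<sigma> exp_le s1 by (intro mult_left_mono mult_mono) auto
    also have "\<dots> = 9 * (m powr (3/2) * \<delta> * \<sigma>)" unfolding p by simp
    also have "\<dots> < 1" using small unfolding m_def[symmetric] by simp
    finally show "real CARD('n) * \<delta> * (exp 1 * (3/2 * \<sigma>) * (1 + sqrt (real CARD('n)))) < 1"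
      by (simp add: m_def)
  qed (use \<sigma> \<delta> in auto)
  then obtain B where B: "\<And>x. cmod (g x) \<le> B" by blast
  then show "bounded (range (restr f))" unfolding g_def[symmetric] bounded_iff by blast
  define M where "M = (SUP x. cmod (g x))"
  have "bdd_above (range (\<lambda>x. cmod (g x)))" using B by (intro bdd_aboveI[of _ B]) auto
  then have gM: "cmod (g x) \<le> M" for x unfolding M_def by (intro cSUP_upper) auto
  have M0: "M \<ge> 0" using order_trans[OF norm_ge_zero gM] .
  have "M \<le> s + a * M * (m * \<delta>)" if "a > \<sigma>" for a
    unfolding M_def
  proof (rule cSUP_least)
    fix x
    obtain X where X: "X \<in> \<Omega>" "\<And>i. \<bar>x $ i - X $ i\<bar> < \<delta>" using net[of x] by blast
    have "cmod (g x - g X) \<le> a * M * (\<Sum>i\<in>UNIV. \<bar>x $ i - X $ i\<bar>)"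
      using that \<sigma> f gM unfolding g_def by (intro slice_exp_type_lipschitz slice_exp_type_restr[where \<sigma>=\<sigma>]) auto
    also have "\<dots> \<le> a * M * (\<Sum>i\<in>(UNIV::'n set). \<delta>)"
      using X(2) that \<sigma> M0 by (intro mult_left_mono sum_mono mult_nonneg_nonneg) (auto intro: less_imp_le)
    also have "\<dots> = a * M * (m * \<delta>)" by (simp add: m_def)
    finally show "cmod (g x) \<le> s + a * (SUP x. cmod (g x)) * (m * \<delta>)"
      using gX[OF X(1)] norm_triangle_sub[of "g x" "g X"] by (simp add: M_def)
  qed simp
  \<comment> \<open>Any fixed a > \<sigma> would spoil the factor 1 - m\<delta>\<sigma>; neither M
    nor s depends on a, so a may tend to \<sigma>.\<close>
  then have ev: "eventually (\<lambda>a. M \<le> s + a * M * (m * \<delta>)) (at_right \<sigma>)"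
    by (auto simp: eventually_at_right_field intro!: exI[of _ "\<sigma> + 1"])
  have "((\<lambda>a. s + a * M * (m * \<delta>)) \<longlongrightarrow> s + \<sigma> * M * (m * \<delta>)) (at_right \<sigma>)"
    by (intro tendsto_intros)
  then have "M \<le> s + \<sigma> * M * (m * \<delta>)" using ev by (rule tendsto_lowerbound) simp
  then show "(SUP X\<in>\<Omega>. cmod (restr f X)) \<ge> (1 - real CARD('n) * \<delta> * \<sigma>) * (SUP x. cmod (restr f x))"
    unfolding g_def[symmetric] s_def[symmetric] M_def[symmetric] m_def[symmetric] by (simp add: algebra_simps)
qed

text \<open>If |g| exceeded M throughout some cube of half side \<delta>, that cube alone would
  contribute M^q V = I + 1 to an integral equal to I. So small values occur near every point, which
  is the hypothesis of \<open>slice_exp_type_bounded\<close>; \<delta> is chosen from the type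
  alone.\<close>

lemma Lq_imp_bounded:
  fixes g :: "real^'n \<Rightarrow> complex"
  assumes g: "slice_exp_type a g" and a: "a > 0" and q: "q \<ge> 1"
    and fin: "(\<integral>\<^sup>+x. ennreal (cmod (g x) powr q) \<partial>lborel) < \<infinity>"
  shows "\<exists>B. \<forall>x. cmod (g x) \<le> B"
proof -
  define L where "L = real CARD('n) * (exp 1 * a * (1 + sqrt (real CARD('n))))"
  have L: "L > 0" unfolding L_def using a zero_less_card_finite[where 'a='n]
    by (intro mult_pos_pos add_pos_nonneg) auto
  define \<delta> where "\<delta> = 1 / (2 * L)"
  have \<delta>: "\<delta> > 0" "L * \<delta> < 1" using L by (auto simp: \<delta>_def)
  obtain I where I: "(\<integral>\<^sup>+x. ennreal (cmod (g x) powr q) \<partial>lborel) = ennreal I" "I \<ge> 0"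
    using fin by (cases "\<integral>\<^sup>+x. ennreal (cmod (g x) powr q) \<partial>lborel") auto
  define V where "V = (2 * \<delta>) ^ CARD('n)"
  have V: "V > 0" using \<delta> by (simp add: V_def)
  define M where "M = ((I + 1) / V) powr (1/q)"
  have Mq: "M powr q = (I + 1) / V" using q I V by (simp add: M_def powr_powr)
  have "\<exists>X. (\<forall>i. \<bar>x $ i - X $ i\<bar> \<le> \<delta>) \<and> cmod (g X) \<le> M" for x
  proof (rule ccontr)
    assume neg: "\<not> ?thesis"
    have big: "M \<le> cmod (g X)" if "X \<in> open_cube \<delta> x" for X
    proof -
      have "\<forall>i. \<bar>x $ i - X $ i\<bar> \<le> \<delta>"
        using that by (auto simp: open_cube_iff abs_minus_commute intro: less_imp_le)
      then show ?thesis using neg by force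
    qed
    have "ennreal (M powr q) * emeasure lborel (open_cube \<delta> x) = (\<integral>\<^sup>+y. ennreal (M powr q) * indicator (open_cube \<delta> x) y \<partial>lborel)"
      by (subst nn_integral_cmult_indicator) auto
    also have "\<dots> \<le> (\<integral>\<^sup>+x. ennreal (cmod (g x) powr q) \<partial>lborel)"
      using big q by (intro nn_integral_mono) (auto split: split_indicator intro!: ennreal_leI powr_mono2 simp: M_def)
    finally have "ennreal ((I + 1) / V) * ennreal V \<le> ennreal I"
      using \<delta> by (simp add: Mq I emeasure_open_cube V_def)
    then have "ennreal (I + 1) \<le> ennreal I" using V I by (simp add: ennreal_mult[symmetric] del: ennreal_plus)
    then show False using I by (simp add: ennreal_le_iff del: ennreal_plus)
  qed
  then show ?thesis using \<delta> by (intro slice_exp_type_bounded[OF g a, where \<delta>=\<delta> and M=M]) (auto simp: L_def mult_ac)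
qed

lemma power_one_plus_le:
  fixes x :: real
  assumes "0 \<le> x" "x \<le> 1"
  shows "(1 + x) ^ n - 1 \<le> x * 2 ^ n"
proof (induction n)
  case (Suc n)
  have "(1 + x) ^ n \<le> 2 ^ n" using assms by (intro power_mono) auto
  then have "x * (1 + x) ^ n \<le> x * 2 ^ n" using assms by (intro mult_left_mono) auto
  then show ?case using Suc by (simp add: algebra_simps)
qed (use assms in simp)

lemma Lq_dom_weaken:
  assumes "Lq_dom q \<kappa> F H" "0 \<le> \<kappa>" "\<kappa> \<le> \<kappa>'" "q \<ge> 1"
  shows "Lq_dom q \<kappa>' F H"
proof -
  have "ennreal (\<kappa> powr q) * I \<le> ennreal (\<kappa>' powr q) * I" for I
    using assms by (intro mult_right_mono ennreal_leI powr_mono2) auto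
  then show ?thesis using assms(1) order_trans unfolding Lq_dom_def by blast
qed

text \<open>Two centres whose cubes of half side \<delta>/4 (with \<delta> the packing parameter)
  both contain y differ by less than \<delta>/2. All such centres therefore lie in the packing cube
  around any one of them, which is why cells of this size are used.\<close>

lemma packing_overlap:
  fixes \<Omega> :: "(real^'n) set"
  assumes pack: "packing_net \<delta>\<^sub>1 N \<Omega>"
  shows "(\<integral>\<^sup>+X. indicator (open_cube (\<delta>\<^sub>1/4) X) y \<partial>count_space \<Omega>) \<le> ennreal (real N + 1)"
proof -
  define S where "S = {X\<in>\<Omega>. y \<in> open_cube (\<delta>\<^sub>1/4) X}"
  have fin: "finite S \<and> card S \<le> N + 1"
  proof (cases "S = {}")
    case False
    then obtain X0 where X0: "X0 \<in> S" by blast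
    have "S \<subseteq> \<Omega> \<inter> open_cube (\<delta>\<^sub>1/2) X0"
    proof
      fix X assume X: "X \<in> S"
      have "\<bar>X $ i - X0 $ i\<bar> < \<delta>\<^sub>1/2" for i
      proof -
        have "\<bar>y $ i - X $ i\<bar> < \<delta>\<^sub>1/4" "\<bar>y $ i - X0 $ i\<bar> < \<delta>\<^sub>1/4"
          using X X0 by (auto simp: S_def open_cube_iff)
        then show ?thesis by linarith
      qed
      then show "X \<in> \<Omega> \<inter> open_cube (\<delta>\<^sub>1/2) X0" using X by (auto simp: S_def open_cube_iff)
    qed
    moreover have "finite (\<Omega> \<inter> open_cube (\<delta>\<^sub>1/2) X0)" "card (\<Omega> \<inter> open_cube (\<delta>\<^sub>1/2) X0) \<le> N + 1"
      using pack X0 by (auto simp: packing_net_def S_def)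
    ultimately show ?thesis by (meson card_mono finite_subset order_trans)
  qed simp
  have "(\<integral>\<^sup>+X. indicator (open_cube (\<delta>\<^sub>1/4) X) y \<partial>count_space \<Omega>) = (\<integral>\<^sup>+X. indicator S X \<partial>count_space \<Omega>)"
    by (intro nn_integral_cong) (auto simp: S_def split: split_indicator)
  also have "\<dots> = emeasure (count_space \<Omega>) S" by (subst nn_integral_indicator) (auto simp: S_def)
  also have "\<dots> = of_nat (card S)" using fin by (intro emeasure_count_space_finite) (auto simp: S_def)
  also have "\<dots> \<le> of_nat (N + 1)" using fin by (intro of_nat_mono) auto
  also have "\<dots> = ennreal (real N + 1)" by (simp add: ennreal_of_nat_eq_real_of_nat[symmetric] ennreal_plus)
  finally show ?thesis .
qed

text \<open>On the cell around X, |g X| is at most |g| + H. Integrating over the cells, of volume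
  \<open>(\<delta>\<^sub>1/2) ^ CARD('n)\<close> each, and bounding their overlap by N + 1 gives the
  two prefactors. An infinite norm is trivial; a finite one gives the boundedness that the majorant
  needs.\<close>

lemma packing_sum_bound:
  fixes f :: "complex^'n \<Rightarrow> complex" and \<Omega> :: "(real^'n) set"
  assumes q: "q \<ge> 1" and \<sigma>: "\<sigma> > 0" and \<delta>: "\<delta>\<^sub>1 > 0" and small: "\<delta>\<^sub>1 * \<sigma> \<le> 1"
    and cnt: "countable \<Omega>" and pack: "packing_net \<delta>\<^sub>1 N \<Omega>" and f: "f \<in> exp_type_class \<sigma>"
  shows "lq_sum q \<Omega> (restr f) \<le> ennreal ((\<delta>\<^sub>1/2) powr (- real CARD('n) / q) * (real N + 1) powr (1/q) *
           (1 + 2 ^ (CARD('n) + 1) * (\<delta>\<^sub>1 * \<sigma>))) * Lq_norm q (restr f)"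
proof -
  define g where "g = restr f"
  define c where "c = (\<delta>\<^sub>1/2) powr (- real CARD('n) / q) * (real N + 1) powr (1/q) *
           (1 + 2 ^ (CARD('n) + 1) * (\<delta>\<^sub>1 * \<sigma>))"
  have pos: "1 + 2 ^ (CARD('n) + 1) * (\<delta>\<^sub>1 * \<sigma>) > 0" using \<sigma> \<delta> by (intro add_pos_pos) auto
  have c: "c > 0" unfolding c_def using \<delta> pos by (intro mult_pos_pos) auto
  define I where "I = (\<integral>\<^sup>+x. ennreal (cmod (g x) powr q) \<partial>lborel)"
  define S where "S = (\<integral>\<^sup>+X. ennreal (cmod (g X) powr q) \<partial>count_space \<Omega>)"
  have cq: "c powr q = (\<delta>\<^sub>1/2) powr (- real CARD('n)) * (real N + 1) * (1 + 2 ^ (CARD('n) + 1) * (\<delta>\<^sub>1 * \<sigma>)) powr q"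
    unfolding c_def using \<delta> pos q by (simp add: powr_mult powr_powr)
  have "S \<le> ennreal (c powr q) * I"
  proof (cases "I = \<infinity>")
    case True
    then show ?thesis using c by (simp add: ennreal_mult_top)
  next
    case False
    have g: "slice_exp_type (2 * \<sigma>) g" unfolding g_def using f \<sigma> by (intro slice_exp_type_restr[where \<sigma>=\<sigma>]) auto
    obtain B where B: "\<And>x. cmod (g x) \<le> B"
      using Lq_imp_bounded[OF g _ q] False \<sigma> by (auto simp: I_def less_top)
    have a2: "2 * \<sigma> > 0" "\<delta>\<^sub>1/4 > 0" using \<sigma> \<delta> by auto
    obtain H where H: "bounded_nonneg H"
      "\<And>y u. (\<And>i. \<bar>u $ i\<bar> \<le> \<delta>\<^sub>1/4) \<Longrightarrow> cmod (g (y + u) - g y) \<le> H y"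
      "Lq_dom q ((1 + 2 * (\<delta>\<^sub>1/4) * (2 * \<sigma>)) ^ (CARD('n) + 1) - 1) (\<lambda>y. cmod (g y)) H"
      using oscillation_majorant[OF g a2 q B] by blast
    \<comment> \<open>Half side \<open>\<delta>\<^sub>1/4\<close> and type 2\<sigma> make the
      oscillation parameter 2 h a exactly \<open>\<delta>\<^sub>1 * \<sigma>\<close>.\<close>
    have e: "2 * (\<delta>\<^sub>1/4) * (2 * \<sigma>) = \<delta>\<^sub>1 * \<sigma>" by simp
    note nn = bounded_nonneg_cmod[OF g B]
    have "Lq_dom q (2 ^ (CARD('n) + 1) * (\<delta>\<^sub>1 * \<sigma>)) (\<lambda>y. cmod (g y)) H"
    proof (rule Lq_dom_weaken[OF H(3) _ _ q])
      show "0 \<le> (1 + 2 * (\<delta>\<^sub>1/4) * (2 * \<sigma>)) ^ (CARD('n) + 1) - 1"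
        unfolding e using \<sigma> \<delta> one_le_power[of "1 + \<delta>\<^sub>1 * \<sigma>" "CARD('n) + 1"] by simp
      show "(1 + 2 * (\<delta>\<^sub>1/4) * (2 * \<sigma>)) ^ (CARD('n) + 1) - 1 \<le> 2 ^ (CARD('n) + 1) * (\<delta>\<^sub>1 * \<sigma>)"
        unfolding e using power_one_plus_le[of "\<delta>\<^sub>1 * \<sigma>" "CARD('n) + 1"] \<sigma> \<delta> small by (simp add: mult.commute)
    qed
    then have dom: "Lq_dom q (1 + 2 ^ (CARD('n) + 1) * (\<delta>\<^sub>1 * \<sigma>)) (\<lambda>y. cmod (g y)) (\<lambda>y. cmod (g y) + H y)"
      using \<sigma> \<delta> by (intro Lq_dom_add q nn H(1) Lq_dom_refl) auto
    define P where "P = (\<lambda>y. ennreal ((cmod (g y) + H y) powr q))"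
    have [measurable]: "P \<in> borel_measurable borel"
      unfolding P_def using bounded_nonnegD(1)[OF nn] bounded_nonnegD(1)[OF H(1)] by measurable
    define V where "V = (\<delta>\<^sub>1/2) ^ CARD('n)"
    have V: "V > 0" using \<delta> by (simp add: V_def)
    have cell: "ennreal V * ennreal (cmod (g X) powr q) \<le> (\<integral>\<^sup>+y. P y * indicator (open_cube (\<delta>\<^sub>1/4) X) y \<partial>lborel)" for X
    proof -
      have "ennreal V * ennreal (cmod (g X) powr q) = ennreal (cmod (g X) powr q) * emeasure lborel (open_cube (\<delta>\<^sub>1/4) X)"
        using \<delta> by (simp add: emeasure_open_cube V_def mult.commute)
      also have "\<dots> = (\<integral>\<^sup>+y. ennreal (cmod (g X) powr q) * indicator (open_cube (\<delta>\<^sub>1/4) X) y \<partial>lborel)"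
        by (subst nn_integral_cmult_indicator) auto
      also have "\<dots> \<le> (\<integral>\<^sup>+y. P y * indicator (open_cube (\<delta>\<^sub>1/4) X) y \<partial>lborel)"
      proof (intro nn_integral_mono)
        fix y
        have "cmod (g X) \<le> cmod (g y) + H y" if "y \<in> open_cube (\<delta>\<^sub>1/4) X"
        proof -
          have "cmod (g (y + (X - y)) - g y) \<le> H y"
            using that by (intro H(2)) (auto simp: open_cube_iff abs_minus_commute intro: less_imp_le)
          then show ?thesis using norm_triangle_sub[of "g X" "g y"] by simp
        qed
        then show "ennreal (cmod (g X) powr q) * indicator (open_cube (\<delta>\<^sub>1/4) X) y \<le> P y * indicator (open_cube (\<delta>\<^sub>1/4) X) y"
          using q by (auto simp: P_def split: split_indicator intro!: ennreal_leI powr_mono2)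
      qed
      finally show ?thesis .
    qed
    have "ennreal V * S = (\<integral>\<^sup>+X. ennreal V * ennreal (cmod (g X) powr q) \<partial>count_space \<Omega>)"
      unfolding S_def by (subst nn_integral_cmult) auto
    also have "\<dots> \<le> (\<integral>\<^sup>+X. (\<integral>\<^sup>+y. P y * indicator (open_cube (\<delta>\<^sub>1/4) X) y \<partial>lborel) \<partial>count_space \<Omega>)"
      by (intro nn_integral_mono cell)
    also have "\<dots> = (\<integral>\<^sup>+y. (\<integral>\<^sup>+X. P y * indicator (open_cube (\<delta>\<^sub>1/4) X) y \<partial>count_space \<Omega>) \<partial>lborel)"
      by (intro nn_integral_count_space_nn_integral[symmetric] cnt) measurable
    also have "\<dots> \<le> (\<integral>\<^sup>+y. P y * ennreal (real N + 1) \<partial>lborel)"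
      by (intro nn_integral_mono) (auto simp: nn_integral_cmult intro!: mult_left_mono packing_overlap pack simp del: ennreal_plus)
    also have "\<dots> = ennreal (real N + 1) * (\<integral>\<^sup>+y. P y \<partial>lborel)"
      by (subst nn_integral_multc) (auto simp: mult.commute)
    also have "\<dots> \<le> ennreal (real N + 1) * (ennreal ((1 + 2 ^ (CARD('n) + 1) * (\<delta>\<^sub>1 * \<sigma>)) powr q) * I)"
      using dom unfolding Lq_dom_def P_def I_def by (intro mult_left_mono) auto
    finally have VS: "ennreal V * S \<le> \<dots>" .
    have "S = ennreal (1 / V) * (ennreal V * S)"
      using V by (simp add: mult.assoc[symmetric] ennreal_mult'[symmetric])
    also have "\<dots> \<le> ennreal (1 / V) * (ennreal (real N + 1) * (ennreal ((1 + 2 ^ (CARD('n) + 1) * (\<delta>\<^sub>1 * \<sigma>)) powr q) * I))"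
      by (intro mult_left_mono VS) auto
    also have "\<dots> = ennreal (1 / V * (real N + 1) * (1 + 2 ^ (CARD('n) + 1) * (\<delta>\<^sub>1 * \<sigma>)) powr q) * I"
    proof -
      have "ennreal u * (ennreal v * (ennreal w * I)) = ennreal (u * v * w) * I"
        if "u \<ge> 0" "v \<ge> 0" "w \<ge> 0" for u v w
        using that by (simp add: ennreal_mult mult.assoc)
      from this[of "1 / V" "real N + 1" "(1 + 2 ^ (CARD('n) + 1) * (\<delta>\<^sub>1 * \<sigma>)) powr q"]
      show ?thesis using V by (simp del: ennreal_plus)
    qed
    also have "1 / V = (\<delta>\<^sub>1/2) powr (- real CARD('n))"
      using \<delta> by (simp add: V_def powr_minus powr_realpow inverse_eq_divide)
    finally show ?thesis unfolding cq .
  qed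
  then have "eroot q S \<le> eroot q (ennreal (c powr q) * I)" using q by (intro eroot_mono) auto
  also have "\<dots> = ennreal c * eroot q I" using c q by (intro eroot_scale) auto
  finally show ?thesis unfolding lq_sum_def Lq_norm_def S_def I_def c_def g_def .
qed

section \<open>Squared sinc damping\<close>

definition csinc :: "complex \<Rightarrow> complex" where
  "csinc z = (if z = 0 then 1 else sin z / z)"

lemma csinc_holomorphic: "csinc holomorphic_on UNIV"
proof -
  have "deriv sin (0::complex) = 1"
    by (rule DERIV_imp_deriv) (auto intro!: derivative_eq_intros)
  then have "csinc = (\<lambda>z. if z = 0 then deriv sin 0 else (sin z - sin 0) / (z - 0))"
    by (auto simp: csinc_def fun_eq_iff)
  then show ?thesis using pole_lemma_open[of sin UNIV 0] holomorphic_on_sin' by (simp add: holomorphic_on_id holomorphic_intros)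
qed

lemma norm_csinc_le: "cmod (csinc z) \<le> exp (cmod z)"
proof (cases "z = 0")
  case False
  have "cmod (sin z - sin 0) \<le> exp (cmod z) * cmod (z - 0)"
  proof (rule field_differentiable_bound[where S="cball 0 (cmod z)" and f'=cos])
    fix w :: complex assume "w \<in> cball 0 (cmod z)"
    then have "exp (cmod w) \<le> exp (cmod z)" by simp
    then show "cmod (cos w) \<le> exp (cmod z)" using norm_cos_le[of w] by (rule order_trans[rotated])
  qed (auto intro!: derivative_eq_intros)
  then show ?thesis using False by (simp add: csinc_def norm_divide field_simps)
qed (simp add: csinc_def)

lemma norm_csinc_real_le: "cmod (csinc (of_real x)) \<le> 1" "cmod (csinc (of_real x)) ^ 2 \<le> 2 / (1 + x^2)"
proof -
  have e: "cmod (csinc (of_real x)) = (if x = 0 then 1 else \<bar>sin x\<bar> / \<bar>x\<bar>)"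
    by (auto simp: csinc_def norm_divide sin_of_real)
  show le1: "cmod (csinc (of_real x)) \<le> 1"
    unfolding e using abs_sin_x_le_abs_x[of x] by auto
  have "cmod (csinc (of_real x)) ^ 2 \<le> 1" using le1 by (simp add: power_le_one)
  moreover have "x^2 * cmod (csinc (of_real x)) ^ 2 \<le> 1"
  proof -
    have "\<bar>sin x\<bar> ^ 2 \<le> 1" using abs_sin_le_one[of x] by (intro power_le_one) auto
    then show ?thesis unfolding e by (simp add: power_divide)
  qed
  ultimately have "(1 + x^2) * cmod (csinc (of_real x)) ^ 2 \<le> 2" by (simp add: distrib_right)
  then show "cmod (csinc (of_real x)) ^ 2 \<le> 2 / (1 + x^2)"
    by (subst pos_le_divide_eq) (auto simp: mult.commute add_pos_nonneg)
qed

text \<open>Squaring gives decay like 1/t^2 in each variable, enough for integrability. The factors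
  never exceed 1 in modulus and tend to 1 as \<epsilon> tends to 0.\<close>

definition sinc_damp :: "real \<Rightarrow> (real^'n \<Rightarrow> complex) \<Rightarrow> real^'n \<Rightarrow> complex" where
  "sinc_damp \<epsilon> g x = g x * (\<Prod>i\<in>UNIV. csinc (of_real (\<epsilon> * x $ i)) ^ 2)"

lemma norm_sinc_prod_le: "cmod (\<Prod>i\<in>A. csinc (of_real (\<epsilon> * x $ i)) ^ 2) \<le> 1"
  unfolding prod_norm[symmetric] norm_power
  by (intro prod_le_1) (auto simp: power_le_one norm_csinc_real_le simp del: of_real_mult)

lemma norm_sinc_damp_le: "cmod (sinc_damp \<epsilon> g x) \<le> cmod (g x)"
  unfolding sinc_damp_def norm_mult by (rule mult_left_le[OF norm_sinc_prod_le norm_ge_zero])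

lemma slice_exp_type_sinc_damp:
  fixes g :: "real^'n \<Rightarrow> complex"
  assumes g: "slice_exp_type a g" and a: "a \<ge> 0" and \<epsilon>: "\<epsilon> \<ge> 0"
  shows "slice_exp_type (a + 2 * \<epsilon>) (sinc_damp \<epsilon> g)"
proof -
  have contc: "continuous_on UNIV csinc" using csinc_holomorphic holomorphic_on_imp_continuous_on by blast
  have contg: "continuous_on UNIV g" using g by (simp add: slice_exp_type_def)
  have "continuous_on UNIV (sinc_damp \<epsilon> g)"
    unfolding sinc_damp_def
    by (intro continuous_intros contg continuous_on_compose2[OF contc]) auto
  moreover obtain C where C: "C > 0" "\<And>j x. \<exists>\<phi>. \<phi> holomorphic_on UNIV \<and>
     (\<forall>t. \<phi> (of_real t) = g (x + t *\<^sub>R axis j 1)) \<and>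
     (\<forall>z. cmod (\<phi> z) \<le> C * exp (a * ((\<Sum>i\<in>UNIV. \<bar>x $ i\<bar>) + cmod z)))"
    using slice_exp_type_obtain[OF g] by blast
  have "\<exists>\<phi>. \<phi> holomorphic_on UNIV \<and>
     (\<forall>t. \<phi> (of_real t) = sinc_damp \<epsilon> g (x + t *\<^sub>R axis j 1)) \<and>
     (\<forall>z. cmod (\<phi> z) \<le> C * exp ((a + 2 * \<epsilon>) * ((\<Sum>i\<in>UNIV. \<bar>x $ i\<bar>) + cmod z)))" for j x
  proof -
    obtain \<phi> where \<phi>: "\<phi> holomorphic_on UNIV" "\<And>t. \<phi> (of_real t) = g (x + t *\<^sub>R axis j 1)"
      "\<And>z. cmod (\<phi> z) \<le> C * exp (a * ((\<Sum>i\<in>UNIV. \<bar>x $ i\<bar>) + cmod z))"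
      using C(2)[of x j] by blast
    define W where "W = (\<Prod>i\<in>-{j}. csinc (of_real (\<epsilon> * x $ i)) ^ 2)"
    define \<phi>' where "\<phi>' = (\<lambda>z. \<phi> z * W * csinc (of_real \<epsilon> * (of_real (x $ j) + z)) ^ 2)"
    have "(\<lambda>z. csinc (of_real \<epsilon> * (of_real (x $ j) + z))) holomorphic_on UNIV"
      using holomorphic_on_compose_gen[OF _ csinc_holomorphic, of "\<lambda>z. of_real \<epsilon> * (of_real (x $ j) + z)" UNIV]
      by (simp add: o_def holomorphic_intros)
    then have "\<phi>' holomorphic_on UNIV" unfolding \<phi>'_def using \<phi>(1) by (intro holomorphic_intros)
    moreover have "\<phi>' (of_real t) = sinc_damp \<epsilon> g (x + t *\<^sub>R axis j 1)" for t
    proof -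
      have "(\<Prod>i\<in>-{j}. csinc (of_real (\<epsilon> * (x + t *\<^sub>R axis j 1) $ i)) ^ 2) = W"
        unfolding W_def by (intro prod.cong) (auto simp: axis_def)
      moreover have "(\<Prod>i\<in>UNIV. h i) = h j * (\<Prod>i\<in>-{j}. h i)" for h :: "'n \<Rightarrow> complex"
        by (metis Compl_eq_Diff_UNIV UNIV_I finite prod.remove)
      ultimately show ?thesis unfolding sinc_damp_def \<phi>'_def by (simp add: \<phi>(2))
    qed
    moreover have "cmod (\<phi>' z) \<le> C * exp ((a + 2 * \<epsilon>) * ((\<Sum>i\<in>UNIV. \<bar>x $ i\<bar>) + cmod z))" for z
    proof -
      define s where "s = (\<Sum>i\<in>UNIV. \<bar>x $ i\<bar>) + cmod z"
      have xj: "\<bar>x $ j\<bar> \<le> (\<Sum>i\<in>UNIV. \<bar>x $ i\<bar>)" by (rule member_le_sum) auto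
      have "cmod (csinc (of_real \<epsilon> * (of_real (x $ j) + z))) \<le> exp (cmod (of_real \<epsilon> * (of_real (x $ j) + z)))"
        by (rule norm_csinc_le)
      also have "cmod (of_real \<epsilon> * (of_real (x $ j) + z)) \<le> \<epsilon> * s"
        unfolding norm_mult s_def using \<epsilon> xj norm_triangle_ineq[of "of_real (x $ j)" z]
        by (intro mult_mono) auto
      finally have "cmod (csinc (of_real \<epsilon> * (of_real (x $ j) + z))) \<le> exp (\<epsilon> * s)" by simp
      then have "cmod (csinc (of_real \<epsilon> * (of_real (x $ j) + z))) ^ 2 \<le> exp (\<epsilon> * s) ^ 2"
        by (intro power_mono) auto
      then have "cmod (\<phi>' z) \<le> C * exp (a * s) * 1 * exp (\<epsilon> * s) ^ 2"
        unfolding \<phi>'_def norm_mult norm_power W_def using \<phi>(3)[of z] C(1)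
        by (intro mult_mono norm_sinc_prod_le mult_nonneg_nonneg) (auto simp: s_def simp del: of_real_mult)
      also have "\<dots> = C * exp ((a + 2 * \<epsilon>) * s)"
        by (simp add: exp_double[symmetric] exp_add[symmetric] distrib_right mult.assoc)
      finally show ?thesis by (simp add: s_def)
    qed
    ultimately show ?thesis by blast
  qed
  ultimately show ?thesis unfolding slice_exp_type_def by blast
qed

lemma nn_integral_inverse_one_plus_square_finite:
  assumes "\<epsilon> > 0"
  shows "(\<integral>\<^sup>+x. ennreal (2 / (1 + (\<epsilon> * x)^2)) \<partial>lborel) < \<infinity>"
proof -
  define f where "f = (\<lambda>x. 2 / (1 + (\<epsilon> * x)^2))"
  have nz: "1 + (\<epsilon> * x)^2 > 0" for x by (simp add: add_pos_nonneg)
  have [measurable]: "f \<in> borel_measurable borel" unfolding f_def by measurable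
  have f0: "f x \<ge> 0" for x unfolding f_def using nz[of x] by simp
  have half: "(\<integral>\<^sup>+x. ennreal (f x) * indicator {0..} x \<partial>lborel) = ennreal (2 / \<epsilon> * (pi/2) - 2 / \<epsilon> * arctan (\<epsilon> * 0))"
  proof (rule nn_integral_FTC_atLeast)
    show "((\<lambda>x. 2 / \<epsilon> * arctan (\<epsilon> * x)) has_real_derivative f x) (at x)" for x
    proof -
      have "((\<lambda>x. 2 / \<epsilon> * arctan (\<epsilon> * x)) has_real_derivative 2 / \<epsilon> * (inverse (1 + (\<epsilon> * x)^2) * \<epsilon>)) (at x)"
        by (auto intro!: derivative_eq_intros)
      moreover have "2 / \<epsilon> * (inverse (1 + (\<epsilon> * x)^2) * \<epsilon>) = f x"
        using assms by (simp add: f_def inverse_eq_divide)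
      ultimately show ?thesis by simp
    qed
    have "filterlim (\<lambda>x. \<epsilon> * x) at_top at_top"
      using assms by (intro filterlim_tendsto_pos_mult_at_top[OF tendsto_const]) (auto intro: filterlim_ident)
    then show "((\<lambda>x. 2 / \<epsilon> * arctan (\<epsilon> * x)) \<longlongrightarrow> 2 / \<epsilon> * (pi/2)) at_top"
      by (intro tendsto_intros filterlim_compose[OF tendsto_arctan_at_top])
  qed (use f0 in auto)
  have "(\<integral>\<^sup>+x. ennreal (f x) \<partial>lborel)
      \<le> (\<integral>\<^sup>+x. ennreal (f x) * indicator {0..} x + ennreal (f x) * indicator {0..} (- x) \<partial>lborel)"
    by (intro nn_integral_mono) (auto split: split_indicator)
  also have "\<dots> = (\<integral>\<^sup>+x. ennreal (f x) * indicator {0..} x \<partial>lborel) + (\<integral>\<^sup>+x. ennreal (f x) * indicator {0..} (- x) \<partial>lborel)"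
    by (subst nn_integral_add) auto
  also have "(\<integral>\<^sup>+x. ennreal (f x) * indicator {0..} (- x) \<partial>lborel) = (\<integral>\<^sup>+x. ennreal (f x) * indicator {0..} x \<partial>lborel)"
    by (subst nn_integral_real_affine[where c="- 1" and t=0]) (auto simp: f_def)
  also have "(\<integral>\<^sup>+x. ennreal (f x) * indicator {0..} x \<partial>lborel) + (\<integral>\<^sup>+x. ennreal (f x) * indicator {0..} x \<partial>lborel) < \<infinity>"
    unfolding half by simp
  finally show ?thesis by (simp add: f_def)
qed

lemma prod_Basis_cart: "(\<Prod>b\<in>(Basis::(real^'n) set). h (x \<bullet> b)) = (\<Prod>i\<in>UNIV. h (x $ i))"
proof -
  have B: "(Basis::(real^'n) set) = range (\<lambda>i. axis i 1)" by (auto simp: Basis_vec_def)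
  have "inj (\<lambda>i. axis i (1::real) :: real^'n)" by (auto simp: inj_def axis_eq_axis)
  then show ?thesis unfolding B by (simp add: prod.reindex inner_axis)
qed

lemma sinc_damp_Lq:
  fixes g :: "real^'n \<Rightarrow> complex"
  assumes bd: "\<And>x. cmod (g x) \<le> M" and \<epsilon>: "\<epsilon> > 0" and q: "q \<ge> 1"
  shows "(\<integral>\<^sup>+x. ennreal (cmod (sinc_damp \<epsilon> g x) powr q) \<partial>lborel) < \<infinity>"
proof -
  define \<beta> where "\<beta> = (\<lambda>t::real. 2 / (1 + (\<epsilon> * t)^2))"
  have [measurable]: "\<beta> \<in> borel_measurable borel" unfolding \<beta>_def by measurable
  have \<beta>0: "\<beta> t \<ge> 0" for t by (simp add: \<beta>_def add_nonneg_nonneg)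
  have M0: "M \<ge> 0" using order_trans[OF norm_ge_zero bd] .
  have "cmod (sinc_damp \<epsilon> g x) powr q \<le> M powr q * (\<Prod>i\<in>UNIV. \<beta> (x $ i))" for x
  proof -
    define t where "t = cmod (\<Prod>i\<in>UNIV. csinc (of_real (\<epsilon> * x $ i)) ^ 2)"
    have t: "0 \<le> t" "t \<le> 1" using norm_sinc_prod_le unfolding t_def by auto
    \<comment> \<open>As t is at most 1, the case q = 1 suffices, and there the majorant is a
      product of one-variable functions whose integral factorizes.\<close>
    have "t powr q \<le> t powr 1" using t q by (intro powr_mono') auto
    then have "t powr q \<le> t" using t by simp
    also have "t \<le> (\<Prod>i\<in>UNIV. \<beta> (x $ i))"
      unfolding t_def prod_norm[symmetric] norm_power \<beta>_def
      by (intro prod_mono conjI norm_csinc_real_le(2) zero_le_power2)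
    finally have tb: "t powr q \<le> (\<Prod>i\<in>UNIV. \<beta> (x $ i))" .
    have "cmod (sinc_damp \<epsilon> g x) powr q = cmod (g x) powr q * t powr q"
      unfolding sinc_damp_def norm_mult t_def[symmetric] by (rule powr_mult)
    also have "\<dots> \<le> M powr q * (\<Prod>i\<in>UNIV. \<beta> (x $ i))"
      using bd q tb by (intro mult_mono powr_mono2) auto
    finally show ?thesis .
  qed
  then have "(\<integral>\<^sup>+x. ennreal (cmod (sinc_damp \<epsilon> g x) powr q) \<partial>lborel)
      \<le> (\<integral>\<^sup>+x. ennreal (M powr q) * (\<Prod>b\<in>(Basis::(real^'n) set). ennreal (\<beta> (x \<bullet> b))) \<partial>lborel)"
    unfolding prod_Basis_cart[where h="\<lambda>t. ennreal (\<beta> t)"]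
    using \<beta>0 by (intro nn_integral_mono) (auto simp: prod_ennreal ennreal_mult'[symmetric] prod_nonneg intro!: ennreal_leI)
  also have "\<dots> = ennreal (M powr q) * (\<integral>\<^sup>+x. (\<Prod>b\<in>(Basis::(real^'n) set). ennreal (\<beta> (x \<bullet> b))) \<partial>lborel)"
    by (intro nn_integral_cmult) measurable
  also have "(\<integral>\<^sup>+x. (\<Prod>b\<in>(Basis::(real^'n) set). ennreal (\<beta> (x \<bullet> b))) \<partial>lborel)
      = (\<Prod>b\<in>(Basis::(real^'n) set). (\<integral>\<^sup>+x. ennreal (\<beta> x) \<partial>lborel))"
    by (intro nn_integral_lborel_prod) auto
  also have "ennreal (M powr q) * \<dots> < \<infinity>"
  proof -
    obtain r where "(\<integral>\<^sup>+x. ennreal (\<beta> x) \<partial>lborel) = ennreal r" "r \<ge> 0"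
      using nn_integral_inverse_one_plus_square_finite[OF \<epsilon>]
      by (cases "\<integral>\<^sup>+x. ennreal (\<beta> x) \<partial>lborel") (auto simp: \<beta>_def)
    then show ?thesis by (simp add: ennreal_power ennreal_mult'[symmetric])
  qed
  finally show ?thesis .
qed

lemma sinc_damp_tendsto:
  fixes g :: "real^'n \<Rightarrow> complex"
  shows "(\<lambda>n. sinc_damp (c / real (Suc n)) g x) \<longlonglongrightarrow> g x"
proof -
  have "isCont csinc 0"
    using csinc_holomorphic holomorphic_on_imp_continuous_on continuous_on_eq_continuous_at by blast
  moreover have "(\<lambda>n. complex_of_real (c / real (Suc n) * x $ i)) \<longlonglongrightarrow> of_real (0 * x $ i)" for i
    by (intro tendsto_intros LIMSEQ_Suc[of "\<lambda>n. c / real n"] tendsto_divide_0[OF tendsto_const]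
        filterlim_at_top_imp_at_infinity filterlim_real_sequentially)
  ultimately have lim: "(\<lambda>n. csinc (of_real (c / real (Suc n) * x $ i))) \<longlonglongrightarrow> csinc 0" for i
    using isCont_tendsto_compose by fastforce
  have "(\<lambda>n. sinc_damp (c / real (Suc n)) g x) \<longlonglongrightarrow> g x * (\<Prod>i\<in>(UNIV::'n set). csinc 0 ^ 2)"
    unfolding sinc_damp_def by (intro tendsto_mult tendsto_const tendsto_prod tendsto_power lim)
  then show ?thesis by (simp add: csinc_def)
qed

text \<open>Every y has a sample X within \<delta>, so |g y| is at most |g X| + H y. Summing |g X|^q
  over all samples whose cube contains y avoids a measurable choice of X; integration gives each
  sample the cube volume. The integral of |g|^q remains on the right with a small factor, to be
  absorbed once it is known to be finite.\<close>

lemma covering_integral_bound: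
  fixes g :: "real^'n \<Rightarrow> complex" and \<Omega> :: "(real^'n) set"
  assumes q: "q \<ge> 1" and \<sigma>: "\<sigma> > 0" and \<delta>: "\<delta> > 0" and small: "4 * (\<delta> * \<sigma>) \<le> 1"
    and cnt: "countable \<Omega>" and cov: "covering_net \<delta> \<Omega>"
    and g: "slice_exp_type (2 * \<sigma>) g" and bd: "\<And>x. cmod (g x) \<le> M"
  shows "(\<integral>\<^sup>+x. ennreal (cmod (g x) powr q) \<partial>lborel) \<le>
     ennreal (2 powr (q - 1)) * (ennreal ((2 * \<delta>) ^ CARD('n)) * (\<integral>\<^sup>+X. ennreal (cmod (g X) powr q) \<partial>count_space \<Omega>)
       + ennreal ((2 ^ (CARD('n) + 3) * (\<delta> * \<sigma>)) powr q) * (\<integral>\<^sup>+x. ennreal (cmod (g x) powr q) \<partial>lborel))"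
proof -
  define I where "I = (\<integral>\<^sup>+x. ennreal (cmod (g x) powr q) \<partial>lborel)"
  define S where "S = (\<integral>\<^sup>+X. ennreal (cmod (g X) powr q) \<partial>count_space \<Omega>)"
  have a2: "2 * \<sigma> > 0" using \<sigma> by simp
  obtain H where H: "bounded_nonneg H"
    "\<And>y u. (\<And>i. \<bar>u $ i\<bar> \<le> \<delta>) \<Longrightarrow> cmod (g (y + u) - g y) \<le> H y"
    "Lq_dom q ((1 + 2 * \<delta> * (2 * \<sigma>)) ^ (CARD('n) + 1) - 1) (\<lambda>y. cmod (g y)) H"
    using oscillation_majorant[OF g a2 \<delta> q bd] by blast
  \<comment> \<open>The oscillation parameter is 4\<delta>\<sigma>, at most 1, so
    \<open>power_one_plus_le\<close> gives the constant 4 * 2^(m+1) = 2^(m+3).\<close>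
  have e: "2 * \<delta> * (2 * \<sigma>) = 4 * (\<delta> * \<sigma>)" by simp
  have dom: "Lq_dom q (2 ^ (CARD('n) + 3) * (\<delta> * \<sigma>)) (\<lambda>y. cmod (g y)) H"
  proof (rule Lq_dom_weaken[OF H(3) _ _ q])
    show "0 \<le> (1 + 2 * \<delta> * (2 * \<sigma>)) ^ (CARD('n) + 1) - 1"
      unfolding e using \<sigma> \<delta> one_le_power[of "1 + 4 * (\<delta> * \<sigma>)" "CARD('n) + 1"] by simp
    show "(1 + 2 * \<delta> * (2 * \<sigma>)) ^ (CARD('n) + 1) - 1 \<le> 2 ^ (CARD('n) + 3) * (\<delta> * \<sigma>)"
      unfolding e using power_one_plus_le[of "4 * (\<delta> * \<sigma>)" "CARD('n) + 1"] \<sigma> \<delta> small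
      by (simp add: power_add mult_ac)
  qed
  note [measurable] = bounded_nonnegD(1)[OF H(1)]
  define T where "T = (\<lambda>y. \<integral>\<^sup>+X. ennreal (cmod (g X) powr q) * indicator (open_cube \<delta> X) y \<partial>count_space \<Omega>)"
  have [measurable]: "T \<in> borel_measurable borel"
  proof -
    interpret sigma_finite_measure "count_space \<Omega>" using cnt by (rule sigma_finite_measure_count_space_countable)
    have "(\<lambda>p. ennreal (cmod (g (snd p)) powr q) * indicator (open_cube \<delta> (snd p)) (fst p)) \<in> borel_measurable (borel \<Otimes>\<^sub>M count_space \<Omega>)"
      by (rule measurable_compose_countable'[OF _ measurable_snd cnt,
            of "\<lambda>X p. ennreal (cmod (g X) powr q) * indicator (open_cube \<delta> X) (fst p)"]) measurable
    from borel_measurable_nn_integral_fst[OF this]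
    show ?thesis by (simp only: T_def fst_conv snd_conv)
  qed
  have pt: "ennreal (cmod (g y) powr q) \<le> ennreal (2 powr (q - 1)) * (T y + ennreal (H y powr q))" for y
  proof -
    obtain X where X: "X \<in> \<Omega>" "\<And>i. \<bar>y $ i - X $ i\<bar> < \<delta>"
      using cov by (auto simp: covering_net_def supn_less_iff)
    have "cmod (g (y + (X - y)) - g y) \<le> H y"
      using X(2) by (intro H(2)) (auto simp: abs_minus_commute intro: less_imp_le)
    then have "cmod (g y) \<le> cmod (g X) + H y"
      using norm_triangle_sub[of "g y" "g X"] by (simp add: norm_minus_commute)
    then have "cmod (g y) powr q \<le> (cmod (g X) + H y) powr q" using q by (intro powr_mono2) auto
    also have "\<dots> \<le> 2 powr (q - 1) * (cmod (g X) powr q + H y powr q)"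
      using powr_add_weighted[of "cmod (g X)" "H y" 1 1 q] bounded_nonnegD(2)[OF H(1)] q by simp
    finally have "ennreal (cmod (g y) powr q) \<le> ennreal (2 powr (q - 1)) * (ennreal (cmod (g X) powr q) + ennreal (H y powr q))"
      by (simp add: ennreal_mult'[symmetric] ennreal_plus[symmetric] ennreal_leI del: ennreal_plus)
    also have "ennreal (cmod (g X) powr q) \<le> T y"
      unfolding T_def using nn_integral_ge_point[OF X(1), of "\<lambda>X. ennreal (cmod (g X) powr q) * indicator (open_cube \<delta> X) y"] X(2)
      by (simp add: open_cube_iff)
    finally show ?thesis by (simp add: add_right_mono mult_left_mono)
  qed
  have "(\<integral>\<^sup>+y. T y \<partial>lborel) = (\<integral>\<^sup>+X. (\<integral>\<^sup>+y. ennreal (cmod (g X) powr q) * indicator (open_cube \<delta> X) y \<partial>lborel) \<partial>count_space \<Omega>)"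
    unfolding T_def by (intro nn_integral_count_space_nn_integral cnt) measurable
  also have "\<dots> = (\<integral>\<^sup>+X. ennreal ((2 * \<delta>) ^ CARD('n)) * ennreal (cmod (g X) powr q) \<partial>count_space \<Omega>)"
  proof (rule nn_integral_cong)
    fix X
    have "(\<integral>\<^sup>+y. ennreal (cmod (g X) powr q) * indicator (open_cube \<delta> X) y \<partial>lborel)
        = ennreal (cmod (g X) powr q) * emeasure lborel (open_cube \<delta> X)"
      by (rule nn_integral_cmult_indicator) simp
    also have "emeasure lborel (open_cube \<delta> X) = ennreal ((2 * \<delta>) ^ CARD('n))"
      using \<delta> by (intro emeasure_open_cube) simp
    finally show "(\<integral>\<^sup>+y. ennreal (cmod (g X) powr q) * indicator (open_cube \<delta> X) y \<partial>lborel)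
        = ennreal ((2 * \<delta>) ^ CARD('n)) * ennreal (cmod (g X) powr q)" by (simp only: mult.commute)
  qed
  also have "\<dots> = ennreal ((2 * \<delta>) ^ CARD('n)) * S" unfolding S_def by (subst nn_integral_cmult) auto
  finally have TS: "(\<integral>\<^sup>+y. T y \<partial>lborel) = ennreal ((2 * \<delta>) ^ CARD('n)) * S" .
  have "I \<le> (\<integral>\<^sup>+y. ennreal (2 powr (q - 1)) * (T y + ennreal (H y powr q)) \<partial>lborel)"
    unfolding I_def by (intro nn_integral_mono pt)
  also have "\<dots> = ennreal (2 powr (q - 1)) * ((\<integral>\<^sup>+y. T y \<partial>lborel) + (\<integral>\<^sup>+y. ennreal (H y powr q) \<partial>lborel))"
    by (simp add: nn_integral_cmult nn_integral_add)
  also have "\<dots> \<le> ennreal (2 powr (q - 1)) * (ennreal ((2 * \<delta>) ^ CARD('n)) * S + ennreal ((2 ^ (CARD('n) + 3) * (\<delta> * \<sigma>)) powr q) * I)"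
    unfolding TS using dom by (intro mult_left_mono add_left_mono) (auto simp: Lq_dom_def I_def)
  finally show ?thesis unfolding I_def S_def .
qed

section \<open>Packing nets with cells of any size\<close>

lemma packing_net_antimono:
  assumes "packing_net \<delta> N \<Omega>" "\<delta>' \<le> \<delta>"
  shows "packing_net \<delta>' N \<Omega>"
  unfolding packing_net_def
proof
  fix X assume X: "X \<in> \<Omega>"
  have "open_cube (\<delta>'/2) X \<subseteq> open_cube (\<delta>/2) X"
    using assms(2) by (fastforce simp: open_cube_def)
  then have "\<Omega> \<inter> open_cube (\<delta>'/2) X \<subseteq> \<Omega> \<inter> open_cube (\<delta>/2) X" by blast
  moreover have "finite (\<Omega> \<inter> open_cube (\<delta>/2) X)" "card (\<Omega> \<inter> open_cube (\<delta>/2) X) \<le> N + 1"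
    using assms(1) X by (auto simp: packing_net_def)
  ultimately show "finite (\<Omega> \<inter> open_cube (\<delta>'/2) X) \<and> card (\<Omega> \<inter> open_cube (\<delta>'/2) X) \<le> N + 1"
    by (meson card_mono finite_subset order_trans)
qed

lemma dexp_ge: "dexp m q \<ge> 1" "q \<ge> 1 \<Longrightarrow> real m / q \<le> real (dexp m q)"
proof -
  show "dexp m q \<ge> 1" by (simp add: dexp_def)
  assume q: "q \<ge> 1"
  show "real m / q \<le> real (dexp m q)"
  proof (cases "m = 1")
    case False
    have "\<lfloor>real m / q\<rfloor> \<ge> 0" using q by simp
    then have "real (dexp m q) = real_of_int \<lfloor>real m / q\<rfloor> + 1" using False by (simp add: dexp_def)
    then show ?thesis by linarith
  qed (use q in \<open>simp add: dexp_def\<close>)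
qed

text \<open>For \<open>r = \<delta>\<^sub>1 * \<sigma> > 1\<close> the net is also packing for the
  smaller parameter 1/\<sigma>, to which the previous bound applies. Returning to the original
  prefactor costs r^(m/q) \<le> r^d. The extra 1 in the constant accounts for the leading term 1,
  which is multiplied by this power too.\<close>

lemma packing_sum_bound_general:
  fixes f :: "complex^'n \<Rightarrow> complex" and \<Omega> :: "(real^'n) set"
  assumes q: "q \<ge> 1" and \<sigma>: "\<sigma> > 0" and \<delta>: "\<delta>\<^sub>1 > 0"
    and cnt: "countable \<Omega>" and pack: "packing_net \<delta>\<^sub>1 N \<Omega>" and f: "f \<in> exp_type_class \<sigma>"
  shows "lq_sum q \<Omega> (restr f) \<le> ennreal ((\<delta>\<^sub>1/2) powr (- real CARD('n) / q) * (real N + 1) powr (1/q) *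
           (1 + (1 + 2 ^ (CARD('n) + 1)) * max (\<delta>\<^sub>1 * \<sigma>) ((\<delta>\<^sub>1 * \<sigma>) ^ dexp CARD('n) q))) * Lq_norm q (restr f)"
proof (cases "\<delta>\<^sub>1 * \<sigma> \<le> 1")
  case True
  have "2 ^ (CARD('n) + 1) * (\<delta>\<^sub>1 * \<sigma>) \<le> (1 + 2 ^ (CARD('n) + 1)) * max (\<delta>\<^sub>1 * \<sigma>) ((\<delta>\<^sub>1 * \<sigma>) ^ dexp CARD('n) q)"
    using \<sigma> \<delta> by (intro mult_mono) auto
  then show ?thesis
    by (intro order_trans[OF packing_sum_bound[OF q \<sigma> \<delta> True cnt pack f]] mult_right_mono ennreal_leI
        mult_left_mono) auto
next
  case False
  define r where "r = \<delta>\<^sub>1 * \<sigma>"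
  define d where "d = dexp CARD('n) q"
  have r: "r > 1" using False by (simp add: r_def)
  have \<delta>': "1 / \<sigma> > 0" "1 / \<sigma> * \<sigma> \<le> 1" "1 / \<sigma> \<le> \<delta>\<^sub>1"
    using \<sigma> r by (auto simp: r_def field_simps)
  have rd: "r powr (real CARD('n) / q) \<le> r ^ d"
  proof -
    have "r powr (real CARD('n) / q) \<le> r powr real d"
      using r dexp_ge(2)[OF q] by (intro powr_mono) (auto simp: d_def)
    then show ?thesis using r by (simp add: powr_realpow)
  qed
  have e: "(1 / \<sigma> / 2) powr (- real CARD('n) / q) = (\<delta>\<^sub>1/2) powr (- real CARD('n) / q) * r powr (real CARD('n) / q)"
  proof -
    have "1 / \<sigma> / 2 = (\<delta>\<^sub>1/2) * (1 / r)" using \<sigma> \<delta> by (simp add: r_def)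
    then have "(1 / \<sigma> / 2) powr (- real CARD('n) / q) = (\<delta>\<^sub>1/2) powr (- real CARD('n) / q) * (1 / r) powr (- real CARD('n) / q)"
      using \<delta> r by (simp only: powr_mult)
    also have "(1 / r) powr (- real CARD('n) / q) = r powr (real CARD('n) / q)"
      using r by (simp add: powr_divide powr_minus_divide)
    finally show ?thesis .
  qed
  define T :: real where "T = 2 ^ (CARD('n) + 1)"
  have T: "T > 0" by (simp add: T_def)
  have main: "r powr (real CARD('n) / q) * (1 + T * (1 / \<sigma> * \<sigma>)) \<le> 1 + (1 + T) * max r (r ^ d)"
  proof -
    have "r powr (real CARD('n) / q) * (1 + T * (1 / \<sigma> * \<sigma>)) = r powr (real CARD('n) / q) * (1 + T)"
      using \<sigma> by simp
    also have "\<dots> \<le> max r (r ^ d) * (1 + T)"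
      using rd T by (intro mult_right_mono) auto
    finally show ?thesis by (simp add: mult.commute)
  qed
  have "lq_sum q \<Omega> (restr f) \<le> ennreal ((1 / \<sigma> / 2) powr (- real CARD('n) / q) * (real N + 1) powr (1/q) *
           (1 + T * (1 / \<sigma> * \<sigma>))) * Lq_norm q (restr f)"
    unfolding T_def by (intro packing_sum_bound q \<sigma> \<delta>' cnt f packing_net_antimono[OF pack])
  also have "(1 / \<sigma> / 2) powr (- real CARD('n) / q) * (real N + 1) powr (1/q) * (1 + T * (1 / \<sigma> * \<sigma>))
      = (\<delta>\<^sub>1/2) powr (- real CARD('n) / q) * (real N + 1) powr (1/q) * (r powr (real CARD('n) / q) * (1 + T * (1 / \<sigma> * \<sigma>)))"
    unfolding e by simp
  also have "ennreal \<dots> * Lq_norm q (restr f)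
      \<le> ennreal ((\<delta>\<^sub>1/2) powr (- real CARD('n) / q) * (real N + 1) powr (1/q) * (1 + (1 + T) * max r (r ^ d))) * Lq_norm q (restr f)"
    by (intro mult_right_mono ennreal_leI mult_left_mono main) auto
  finally show ?thesis unfolding T_def r_def d_def .
qed

text \<open>The damped functions have finite integrals, so the oscillation term can be absorbed for
  each of them; their samples are no larger than those of f. The resulting bound does not depend on
  the damping, and Fatou's lemma transfers it to f.\<close>

lemma covering_sum_bound:
  fixes f :: "complex^'n \<Rightarrow> complex" and \<Omega> :: "(real^'n) set"
  assumes q: "q \<ge> 1" and \<sigma>: "\<sigma> > 0" and \<delta>: "\<delta> > 0"
    and cnt: "countable \<Omega>" and cov: "covering_net \<delta> \<Omega>" and f: "f \<in> exp_type_class \<sigma>"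
    and small: "24 * real CARD('n) ^ 2 * (\<delta> * \<sigma>) \<le> 1"
    and K: "K = 1 - 2 powr (q - 1) * (2 ^ (CARD('n) + 3) * (\<delta> * \<sigma>)) powr q" "K > 0"
    and fin: "(\<integral>\<^sup>+X. ennreal (cmod (restr f X) powr q) \<partial>count_space \<Omega>) = ennreal s" and s: "s \<ge> 0"
  shows "(\<integral>\<^sup>+x. ennreal (cmod (restr f x) powr q) \<partial>lborel)
      \<le> ennreal (2 powr (q - 1) * (2 * \<delta>) ^ CARD('n) * s / K)"
proof -
  define g where "g = restr f"
  define m where "m = real CARD('n)"
  have m1: "m \<ge> 1" using zero_less_card_finite[where 'a='n] by (simp add: m_def)
  have \<delta>\<sigma>: "\<delta> * \<sigma> > 0" using \<sigma> \<delta> by simp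
  have m2: "m^2 \<ge> 1" using m1 by simp
  have m2s: "24 * (m^2 * (\<delta> * \<sigma>)) \<le> 1" using small by (simp add: m_def)
  have "1 * (\<delta> * \<sigma>) \<le> m^2 * (\<delta> * \<sigma>)" using m2 \<delta>\<sigma> by (intro mult_right_mono) auto
  then have small4: "4 * (\<delta> * \<sigma>) \<le> 1" using m2s by simp
  have g: "slice_exp_type (3/2 * \<sigma>) g" unfolding g_def using f \<sigma> by (intro slice_exp_type_restr[where \<sigma>=\<sigma>]) auto
  have gX: "cmod (g X) \<le> s powr (1/q)" if "X \<in> \<Omega>" for X
  proof -
    have "ennreal (cmod (g X) powr q) \<le> ennreal s"
      using nn_integral_ge_point[OF that, of "\<lambda>X. ennreal (cmod (g X) powr q)"] fin by (simp add: g_def)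
    then have "cmod (g X) powr q \<le> s" using s by simp
    then have "(cmod (g X) powr q) powr (1/q) \<le> s powr (1/q)" using q by (intro powr_mono2) auto
    then show ?thesis using q by (simp add: powr_powr)
  qed
  have "\<exists>B. \<forall>x. cmod (g x) \<le> B"
  proof (rule slice_exp_type_bounded[OF g, where \<delta>=\<delta> and M="s powr (1/q)"])
    show "\<exists>X. (\<forall>i. \<bar>x $ i - X $ i\<bar> \<le> \<delta>) \<and> cmod (g X) \<le> s powr (1/q)" for x
    proof -
      obtain X where "X \<in> \<Omega>" "\<forall>i. \<bar>x $ i - X $ i\<bar> < \<delta>"
        using cov by (auto simp: covering_net_def supn_less_iff)
      then show ?thesis using gX by (auto intro: less_imp_le)
    qed
    have "sqrt m \<le> m" using m1 real_sqrt_le_mono[of m "m^2"] by (simp add: power2_eq_square)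
    \<comment> \<open>The bounds e \<le> 3 and 1 + sqrt m \<le> 2m lead to 9 m^2 \<delta>\<sigma>,
      below 1 by the factor 24 in \<open>small\<close>.\<close>
    then have "m * \<delta> * (exp 1 * (3/2 * \<sigma>) * (1 + sqrt m)) \<le> m * \<delta> * (3 * (3/2 * \<sigma>) * (m + m))"
      using m1 \<delta> \<sigma> exp_le by (intro mult_left_mono mult_mono) auto
    also have "\<dots> = 9 * (m^2 * (\<delta> * \<sigma>))" by (simp add: power2_eq_square)
    also have "\<dots> < 1" using m2s by linarith
    finally show "real CARD('n) * \<delta> * (exp 1 * (3/2 * \<sigma>) * (1 + sqrt (real CARD('n)))) < 1"
      by (simp add: m_def)
  qed (use \<sigma> \<delta> in auto)
  then obtain M where M: "\<And>x. cmod (g x) \<le> M" by blast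
  \<comment> \<open>Damping by at most \<sigma>/4 adds at most \<sigma>/2 to the type 3\<sigma>/2,
    so all damped functions share the type 2\<sigma> and one integral bound.\<close>
  define G where "G = (\<lambda>n. sinc_damp ((\<sigma>/4) / real (Suc n)) g)"
  have GM: "cmod (G n x) \<le> M" for n x
    unfolding G_def using norm_sinc_damp_le M by (rule order_trans)
  have Gt: "slice_exp_type (2 * \<sigma>) (G n)" for n
  proof -
    define e where "e = (\<sigma>/4) / real (Suc n)"
    have "e \<le> (\<sigma>/4) / 1" unfolding e_def using \<sigma> by (intro divide_left_mono) auto
    moreover have "e \<ge> 0" using \<sigma> by (simp add: e_def)
    ultimately show ?thesis unfolding G_def e_def[symmetric] using \<sigma>
      by (intro slice_exp_type_mono[OF slice_exp_type_sinc_damp[OF g, of e]]) auto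
  qed
  define A where "A = 2 powr (q - 1)"
  define V where "V = (2 * \<delta>) ^ CARD('n)"
  define D where "D = (2 ^ (CARD('n) + 3) * (\<delta> * \<sigma>)) powr q"
  have pos: "A > 0" "V > 0" "D \<ge> 0" using \<delta> by (auto simp: A_def V_def D_def)
  have bnd: "(\<integral>\<^sup>+x. ennreal (cmod (G n x) powr q) \<partial>lborel) \<le> ennreal (A * V * s / K)" for n
  proof -
    have "(\<integral>\<^sup>+x. ennreal (cmod (G n x) powr q) \<partial>lborel) < \<infinity>"
      unfolding G_def using \<sigma> by (intro sinc_damp_Lq[OF M _ q]) auto
    then obtain r where r: "(\<integral>\<^sup>+x. ennreal (cmod (G n x) powr q) \<partial>lborel) = ennreal r" "r \<ge> 0"
      by (cases "\<integral>\<^sup>+x. ennreal (cmod (G n x) powr q) \<partial>lborel") auto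
    have "(\<integral>\<^sup>+X. ennreal (cmod (G n X) powr q) \<partial>count_space \<Omega>) \<le> ennreal s"
      unfolding fin[symmetric] g_def[symmetric] G_def using q norm_sinc_damp_le
      by (intro nn_integral_mono ennreal_leI powr_mono2) auto
    then have "ennreal A * (ennreal V * (\<integral>\<^sup>+X. ennreal (cmod (G n X) powr q) \<partial>count_space \<Omega>) + ennreal D * ennreal r)
        \<le> ennreal A * (ennreal V * ennreal s + ennreal D * ennreal r)"
      by (intro mult_left_mono add_right_mono) auto
    moreover have "ennreal r \<le> ennreal A * (ennreal V * (\<integral>\<^sup>+X. ennreal (cmod (G n X) powr q) \<partial>count_space \<Omega>) + ennreal D * ennreal r)"
      using covering_integral_bound[OF q \<sigma> \<delta> small4 cnt cov Gt GM, of n] unfolding r A_def V_def D_def .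
    ultimately have "ennreal r \<le> ennreal A * (ennreal V * ennreal s + ennreal D * ennreal r)" by (rule order_trans[rotated])
    also have "\<dots> = ennreal (A * (V * s + D * r))"
      using pos r s by (simp add: ennreal_mult[symmetric] ennreal_plus[symmetric] del: ennreal_plus)
    finally have "r \<le> A * (V * s + D * r)" using pos r s by (subst (asm) ennreal_le_iff) auto
    moreover have KD: "K = 1 - A * D" using K by (simp add: A_def D_def)
    have "r * K = r - A * (D * r)" unfolding KD by (simp add: algebra_simps)
    ultimately have "r * K \<le> A * V * s" by (simp add: algebra_simps)
    then have "r \<le> A * V * s / K" using K(2) by (simp add: pos_le_divide_eq)
    then show ?thesis unfolding r by (rule ennreal_leI)
  qed
  have lim: "(\<lambda>n. ennreal (cmod (G n x) powr q)) \<longlonglongrightarrow> ennreal (cmod (g x) powr q)" for x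
    unfolding G_def using sinc_damp_tendsto[of "\<sigma>/4" g x] q
    by (intro tendsto_ennrealI tendsto_powr' tendsto_norm tendsto_const) auto
  have "(\<integral>\<^sup>+x. ennreal (cmod (g x) powr q) \<partial>lborel) = (\<integral>\<^sup>+x. liminf (\<lambda>n. ennreal (cmod (G n x) powr q)) \<partial>lborel)"
    using lim_imp_Liminf[OF sequentially_bot lim] by simp
  also have "\<dots> \<le> liminf (\<lambda>n. \<integral>\<^sup>+x. ennreal (cmod (G n x) powr q) \<partial>lborel)"
  proof (rule nn_integral_liminf)
    show "(\<lambda>x. ennreal (cmod (G n x) powr q)) \<in> borel_measurable lborel" for n
      using bounded_nonnegD(1)[OF bounded_nonneg_cmod[OF Gt GM], of n] by measurable
  qed
  also have "\<dots> \<le> limsup (\<lambda>n. \<integral>\<^sup>+x. ennreal (cmod (G n x) powr q) \<partial>lborel)"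
    by (intro Liminf_le_Limsup sequentially_bot)
  also have "\<dots> \<le> ennreal (A * V * s / K)"
    using bnd by (intro Limsup_bounded) auto
  finally show ?thesis by (simp add: g_def A_def V_def)
qed

text \<open>The smallness constant combines the needs of boundedness with 2 T x \<le> 1, where T =
  2^(m+3) and x = \<delta>\<sigma>. The latter gives 2^(q-1) (T x)^q = (2 T x)^q / 2 \<le> 1/2,
  hence K is at least 1/2. As x is at most 1 and d at least 1, the maximum is x^q.\<close>

lemma covering_sum_bound_general:
  fixes f :: "complex^'n \<Rightarrow> complex" and \<Omega> :: "(real^'n) set"
  assumes q: "q \<ge> 1" and \<sigma>: "\<sigma> > 0" and \<delta>: "\<delta> > 0"
    and cnt: "countable \<Omega>" and cov: "covering_net \<delta> \<Omega>" and f: "f \<in> exp_type_class \<sigma>"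
    and small: "\<delta> * \<sigma> \<le> 1 / (24 * real CARD('n) ^ 2 * 2 ^ (CARD('n) + 4))"
    and fin: "lq_sum q \<Omega> (restr f) < \<infinity>"
    and K: "K = 1 - 2 powr (q - 1) * (2 ^ (CARD('n) + 3)) powr q *
       max ((\<delta> * \<sigma>) powr q) ((\<delta> * \<sigma>) powr (real (dexp CARD('n) q) * q))"
  shows "K > 0" "(\<integral>\<^sup>+x. ennreal (cmod (restr f x) powr q) \<partial>lborel) < \<infinity>"
    "lq_sum q \<Omega> (restr f) \<ge>
       ennreal ((4 * \<delta>) powr (- real CARD('n) / q) * 2 powr (1/q - 1) * K powr (1/q)) * Lq_norm q (restr f)"
proof -
  define m where "m = real CARD('n)"
  have m1: "m \<ge> 1" using zero_less_card_finite[where 'a='n] by (simp add: m_def)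
  define x where "x = \<delta> * \<sigma>"
  define T :: real where "T = 2 ^ (CARD('n) + 3)"
  have x0: "x > 0" using \<sigma> \<delta> by (simp add: x_def)
  have T1: "T \<ge> 1" unfolding T_def by (rule one_le_power) simp
  have m2: "m^2 \<ge> 1" using m1 by simp
  have xs: "24 * m^2 * (2 * T) * x \<le> 1"
    using small m1 by (simp add: x_def m_def T_def power_add field_simps)
  have "1 * x \<le> 24 * m^2 * x" using m2 x0 by (intro mult_right_mono) auto
  then have "2 * T * x \<le> 2 * T * (24 * m^2 * x)" using T1 by (intro mult_left_mono) auto
  then have Tx: "2 * T * x \<le> 1" using xs by (simp add: mult_ac)
  have "24 * m^2 * x * 1 \<le> 24 * m^2 * x * (2 * T)" using T1 x0 by (intro mult_left_mono) auto
  then have small24: "24 * m^2 * x \<le> 1" using xs by (simp add: mult_ac)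
  have "1 * x \<le> 2 * T * x" using T1 x0 by (intro mult_right_mono) auto
  then have x1: "x \<le> 1" using Tx by simp
  have "x powr (real (dexp CARD('n) q) * q) \<le> x powr (1 * q)"
    using x0 x1 dexp_ge(1)[of "CARD('n)" q] q by (intro powr_mono' mult_right_mono) auto
  then have mx: "max (x powr q) (x powr (real (dexp CARD('n) q) * q)) = x powr q" by simp
  have K': "K = 1 - 2 powr (q - 1) * (T * x) powr q"
    unfolding K x_def[symmetric] mx T_def[symmetric] using x0 T1 by (simp add: powr_mult)
  have "2 powr (q - 1) * (T * x) powr q = (2 * T * x) powr q / 2"
    using x0 T1 by (simp add: powr_mult powr_diff)
  also have "\<dots> \<le> 1 / 2" using Tx x0 T1 q powr_mono2[of q "2 * T * x" 1] by simp
  finally show K0: "K > 0" unfolding K' by simp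
  obtain s where s: "(\<integral>\<^sup>+X. ennreal (cmod (restr f X) powr q) \<partial>count_space \<Omega>) = ennreal s" "s \<ge> 0"
    using fin by (cases "\<integral>\<^sup>+X. ennreal (cmod (restr f X) powr q) \<partial>count_space \<Omega>") (auto simp: lq_sum_def eroot_def)
  have bnd: "(\<integral>\<^sup>+x. ennreal (cmod (restr f x) powr q) \<partial>lborel)
      \<le> ennreal (2 powr (q - 1) * (2 * \<delta>) ^ CARD('n) * s / K)"
  proof (rule covering_sum_bound[OF q \<sigma> \<delta> cnt cov f _ _ K0 s])
    show "24 * real CARD('n) ^ 2 * (\<delta> * \<sigma>) \<le> 1" using small24 by (simp add: m_def x_def)
    show "K = 1 - 2 powr (q - 1) * (2 ^ (CARD('n) + 3) * (\<delta> * \<sigma>)) powr q"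
      using K' by (simp add: T_def x_def)
  qed
  then show fin': "(\<integral>\<^sup>+x. ennreal (cmod (restr f x) powr q) \<partial>lborel) < \<infinity>"
    by (rule le_less_trans) simp
  define c where "c = (4 * \<delta>) powr (- real CARD('n) / q) * 2 powr (1/q - 1) * K powr (1/q)"
  have c: "c > 0" unfolding c_def using \<delta> K0 by simp
  \<comment> \<open>Raised to the power q, the factor 2^(1/q - 1) becomes 2^(1 - q) and cancels the
    convexity loss 2^(q - 1); K cancels as well. What remains compares (2\<delta>)^m with
    (4\<delta>)^m.\<close>
  have cq: "c powr q = (4 * \<delta>) powr (- m) * 2 powr (1 - q) * K"
  proof -
    have "(1/q - 1) * q = 1 - q" using q by (simp add: field_simps)
    then show ?thesis unfolding c_def using \<delta> K0 q by (simp add: powr_mult powr_powr m_def)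
  qed
  have "ennreal (c powr q) * (\<integral>\<^sup>+x. ennreal (cmod (restr f x) powr q) \<partial>lborel)
      \<le> ennreal (c powr q) * ennreal (2 powr (q - 1) * (2 * \<delta>) ^ CARD('n) * s / K)"
    by (intro mult_left_mono bnd) auto
  also have "\<dots> = ennreal (c powr q * (2 powr (q - 1) * (2 * \<delta>) ^ CARD('n) * s / K))"
    by (rule ennreal_mult'[symmetric]) simp
  also have "c powr q * (2 powr (q - 1) * (2 * \<delta>) ^ CARD('n) * s / K) \<le> s"
  proof -
    have "2 powr (1 - q) * 2 powr (q - 1) = (1::real)" by (simp add: powr_add[symmetric])
    moreover have "(4 * \<delta>) powr (- m) * (2 * \<delta>) ^ CARD('n) \<le> 1"
    proof -
      have "(4 * \<delta>) powr (- m) = 1 / (4 * \<delta>) ^ CARD('n)"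
        using \<delta> by (simp add: m_def powr_minus powr_realpow inverse_eq_divide)
      moreover have "(2 * \<delta>) ^ CARD('n) \<le> (4 * \<delta>) ^ CARD('n)" using \<delta> by (intro power_mono) auto
      ultimately show ?thesis using \<delta> by simp
    qed
    moreover have "c powr q * (2 powr (q - 1) * (2 * \<delta>) ^ CARD('n) * s / K)
        = ((4 * \<delta>) powr (- m) * (2 * \<delta>) ^ CARD('n)) * (2 powr (1 - q) * 2 powr (q - 1)) * s"
      unfolding cq using K0 by simp
    moreover have "u * s \<le> s" if "u \<le> 1" for u using mult_right_mono[OF that s(2)] by simp
    ultimately show ?thesis by simp
  qed
  finally have "ennreal (c powr q) * (\<integral>\<^sup>+x. ennreal (cmod (restr f x) powr q) \<partial>lborel)
      \<le> (\<integral>\<^sup>+X. ennreal (cmod (restr f X) powr q) \<partial>count_space \<Omega>)"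
    unfolding s by (simp add: ennreal_leI)
  then have "eroot q (ennreal (c powr q) * (\<integral>\<^sup>+x. ennreal (cmod (restr f x) powr q) \<partial>lborel)) \<le> lq_sum q \<Omega> (restr f)"
    unfolding lq_sum_def using q by (intro eroot_mono) auto
  then show "lq_sum q \<Omega> (restr f) \<ge>
       ennreal ((4 * \<delta>) powr (- real CARD('n) / q) * 2 powr (1/q - 1) * K powr (1/q)) * Lq_norm q (restr f)"
    unfolding Lq_norm_def c_def[symmetric] using c q by (subst (asm) eroot_scale) auto
qed

theorem theoremT1p1:
  fixes dummy :: "real^'n"
  defines "m \<equiv> CARD('n)"
  shows
  "(\<forall>q::real. 1 \<le> q \<longrightarrow> (\<exists>C>0. \<forall>(\<sigma>::real) (\<delta>\<^sub>1::real) (N::nat) (\<Omega>::(real^'n) set) f.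
      \<sigma> > 0 \<longrightarrow> \<delta>\<^sub>1 > 0 \<longrightarrow> countable \<Omega> \<longrightarrow> packing_net \<delta>\<^sub>1 N \<Omega> \<longrightarrow> f \<in> exp_type_class \<sigma> \<longrightarrow>
      lq_sum q \<Omega> (restr f) \<le>
        ennreal ((\<delta>\<^sub>1/2) powr (- real m / q) * (real N + 1) powr (1/q) *
                 (1 + C * max (\<delta>\<^sub>1 * \<sigma>) ((\<delta>\<^sub>1 * \<sigma>) ^ dexp m q)))
        * Lq_norm q (restr f)))
 \<and> (\<forall>q::real. 1 \<le> q \<longrightarrow> (\<exists>c0>0. \<exists>C>0. \<forall>(\<sigma>::real) (\<delta>::real) (\<Omega>::(real^'n) set) f.
      \<sigma> > 0 \<longrightarrow> \<delta> > 0 \<longrightarrow> countable \<Omega> \<longrightarrow> covering_net \<delta> \<Omega> \<longrightarrow> \<delta> * \<sigma> \<le> c0 \<longrightarrow>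
      f \<in> exp_type_class \<sigma> \<longrightarrow> lq_sum q \<Omega> (restr f) < \<infinity> \<longrightarrow>
      (let K = 1 - C * max ((\<delta> * \<sigma>) powr q) ((\<delta> * \<sigma>) powr (real (dexp m q) * q)) in
        K > 0 \<and>
        (\<integral>\<^sup>+ x. ennreal (cmod (restr f x) powr q) \<partial>lborel) < \<infinity> \<and>
        lq_sum q \<Omega> (restr f) \<ge>
          ennreal ((4 * \<delta>) powr (- real m / q) * 2 powr (1/q - 1) * K powr (1/q))
          * Lq_norm q (restr f))))
 \<and> (\<forall>(\<sigma>::real) (\<delta>::real) (\<Omega>::(real^'n) set) f.
      \<sigma> > 0 \<longrightarrow> \<delta> > 0 \<longrightarrow> countable \<Omega> \<longrightarrow> covering_net \<delta> \<Omega> \<longrightarrow>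
      11 * real m powr (3/2) * \<delta> * \<sigma> \<le> 1 \<longrightarrow> f \<in> exp_type_class \<sigma> \<longrightarrow>
      bdd_above ((\<lambda>X. cmod (restr f X)) ` \<Omega>) \<longrightarrow>
      bounded (range (restr f)) \<and>
      (SUP X\<in>\<Omega>. cmod (restr f X)) \<ge> (1 - real m * \<delta> * \<sigma>) * (SUP x. cmod (restr f x)))"
  unfolding m_def
proof (intro conjI allI impI)
  fix q :: real assume q: "1 \<le> q"
  show "\<exists>C>0. \<forall>(\<sigma>::real) (\<delta>\<^sub>1::real) (N::nat) (\<Omega>::(real^'n) set) f.
      \<sigma> > 0 \<longrightarrow> \<delta>\<^sub>1 > 0 \<longrightarrow> countable \<Omega> \<longrightarrow> packing_net \<delta>\<^sub>1 N \<Omega> \<longrightarrow> f \<in> exp_type_class \<sigma> \<longrightarrow>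
      lq_sum q \<Omega> (restr f) \<le>
        ennreal ((\<delta>\<^sub>1/2) powr (- real CARD('n) / q) * (real N + 1) powr (1/q) *
                 (1 + C * max (\<delta>\<^sub>1 * \<sigma>) ((\<delta>\<^sub>1 * \<sigma>) ^ dexp CARD('n) q)))
        * Lq_norm q (restr f)"
    using packing_sum_bound_general[OF q, where 'n='n]
    by (intro exI[of _ "1 + 2 ^ (CARD('n) + 1)"]) (auto simp: add_pos_pos simp del: power_Suc)
next
  fix q :: real assume q: "1 \<le> q"
  have c0: "1 / (24 * real CARD('n) ^ 2 * 2 ^ (CARD('n) + 4)) > 0"
    using zero_less_card_finite[where 'a='n] by simp
  have C0: "2 powr (q - 1) * (2 ^ (CARD('n) + 3)) powr q > (0::real)" by simp
  show "\<exists>c0>0. \<exists>C>0. \<forall>(\<sigma>::real) (\<delta>::real) (\<Omega>::(real^'n) set) f.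
      \<sigma> > 0 \<longrightarrow> \<delta> > 0 \<longrightarrow> countable \<Omega> \<longrightarrow> covering_net \<delta> \<Omega> \<longrightarrow> \<delta> * \<sigma> \<le> c0 \<longrightarrow>
      f \<in> exp_type_class \<sigma> \<longrightarrow> lq_sum q \<Omega> (restr f) < \<infinity> \<longrightarrow>
      (let K = 1 - C * max ((\<delta> * \<sigma>) powr q) ((\<delta> * \<sigma>) powr (real (dexp CARD('n) q) * q)) in
        K > 0 \<and>
        (\<integral>\<^sup>+ x. ennreal (cmod (restr f x) powr q) \<partial>lborel) < \<infinity> \<and>
        lq_sum q \<Omega> (restr f) \<ge>
          ennreal ((4 * \<delta>) powr (- real CARD('n) / q) * 2 powr (1/q - 1) * K powr (1/q))
          * Lq_norm q (restr f))"
    unfolding Let_def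
  proof (rule exI[of _ "1 / (24 * real CARD('n) ^ 2 * 2 ^ (CARD('n) + 4))"], rule conjI[OF c0],
      rule exI[of _ "2 powr (q - 1) * (2 ^ (CARD('n) + 3)) powr q"], rule conjI[OF C0],
      intro conjI allI impI)
    fix \<sigma> \<delta> :: real and \<Omega> :: "(real^'n) set" and f
    assume A: "\<sigma> > 0" "\<delta> > 0" "countable \<Omega>" "covering_net \<delta> \<Omega>"
      and B: "\<delta> * \<sigma> \<le> 1 / (24 * real CARD('n) ^ 2 * 2 ^ (CARD('n) + 4))"
      and D: "f \<in> exp_type_class \<sigma>" "lq_sum q \<Omega> (restr f) < \<infinity>"
    note general = covering_sum_bound_general[OF q A D(1) B D(2) refl]
    show "1 - 2 powr (q - 1) * (2 ^ (CARD('n) + 3)) powr q *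
        max ((\<delta> * \<sigma>) powr q) ((\<delta> * \<sigma>) powr (real (dexp CARD('n) q) * q)) > 0"
      by (rule general)
    show "(\<integral>\<^sup>+ x. ennreal (cmod (restr f x) powr q) \<partial>lborel) < \<infinity>"
      by (rule general)
    show "ennreal ((4 * \<delta>) powr (- real CARD('n) / q) * 2 powr (1/q - 1) *
          (1 - 2 powr (q - 1) * (2 ^ (CARD('n) + 3)) powr q *
            max ((\<delta> * \<sigma>) powr q) ((\<delta> * \<sigma>) powr (real (dexp CARD('n) q) * q))) powr (1/q))
        * Lq_norm q (restr f) \<le> lq_sum q \<Omega> (restr f)"
      by (rule general)
  qed
next
  fix \<sigma> \<delta> :: real and \<Omega> :: "(real^'n) set" and f :: "complex^'n \<Rightarrow> complex"
  assume A: "\<sigma> > 0" "\<delta> > 0" "covering_net \<delta> \<Omega>" "11 * real CARD('n) powr (3/2) * \<delta> * \<sigma> \<le> 1"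
    "f \<in> exp_type_class \<sigma>" "bdd_above ((\<lambda>X. cmod (restr f X)) ` \<Omega>)"
  show "bounded (range (restr f))" by (rule covering_sup_bound[OF A])
  show "(1 - real CARD('n) * \<delta> * \<sigma>) * (SUP x. cmod (restr f x)) \<le> (SUP X\<in>\<Omega>. cmod (restr f X))"
    by (rule covering_sup_bound[OF A])
qed

end
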